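(* If $D$ is a Cartan subalgebra of a $C^*$-algebra $A$ and $J$ is a regular ideal of $A$, then $D/(J\cap D)$ is a Cartan subalgebra of $A/J$.
   Context: Ideals are closed and two-sided. For $X \subseteq A$, $X^\perp = \{a\in A : ax = xa = 0 \text{ for all } x\in X\}$; an ideal $J$ of $A$ is regular if $J = J^{\perp\perp}$. An inclusion of $C^*$-algebras $D\subseteq A$ means that $D$ is a $C^*$-subalgebra of $A$ containing an approximate unit for $A$. A normalizer of $D$ is an element $n\in A$ with $nDn^*\subseteq D$ and $n^*Dn\subseteq D$. The inclusion is regular if the set of normalizers has dense linear span in $A$. $D$ is a Cartan subalgebra of $A$ if $D\subseteq A$ is a regular inclusion, there is a faithful conditional expectation $E\colon A\to D$ (faithful: $E(a^*a)=0$ implies $a=0$), and $D$ is maximal abelian in $A$. $D/(J\cap D)$ is regarded as a $C^*$-subalgebra of $A/J$ via $d+(J\cap D)\mapsto d+J$. *)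

theory Defs
  imports
    "HOL-Analysis.Analysis"
    "HOL-Algebra.QuotRing"
    "HOL-Algebra.Algebraic_Closure_Type"
begin

section \<open>C*-algebras on explicit carriers\<close>

text \<open>
  The quotient of an algebra by an ideal is again one of the algebras under consideration, so
  algebras are records with a carrier. The field \<open>one\<close> inherited from \<open>ring\<close> plays no role:
  algebras are not assumed to be unital, and nothing below refers to it.
\<close>

record 'a cstar_struct = "(complex, 'a) module" +
  star :: "'a \<Rightarrow> 'a"
  nrm :: "'a \<Rightarrow> real"

abbreviation complex_ring :: "complex ring"
  where "complex_ring \<equiv> ring_of_type_algebra"

text \<open>
  The value off the carrier is irrelevant; it is fixed because \<^locale>\<open>Metric_space\<close>
  requires a total function to be nonnegative and symmetric everywhere.
\<close>

definition nrm_dist :: "('a, 'm) cstar_struct_scheme \<Rightarrow> 'a \<Rightarrow> 'a \<Rightarrow> real"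
  where "nrm_dist A x y =
    (if x \<in> carrier A \<and> y \<in> carrier A then nrm A (x \<ominus>\<^bsub>A\<^esub> y) else 0)"

locale pre_cstar_algebra = module complex_ring A
    for A :: "('a, 'm) cstar_struct_scheme" (structure) +
  assumes m_closed: "\<lbrakk>x \<in> carrier A; y \<in> carrier A\<rbrakk> \<Longrightarrow> x \<otimes> y \<in> carrier A"
    and m_assoc: "\<lbrakk>x \<in> carrier A; y \<in> carrier A; z \<in> carrier A\<rbrakk>
      \<Longrightarrow> (x \<otimes> y) \<otimes> z = x \<otimes> (y \<otimes> z)"
    and l_distr: "\<lbrakk>x \<in> carrier A; y \<in> carrier A; z \<in> carrier A\<rbrakk>
      \<Longrightarrow> (x \<oplus> y) \<otimes> z = x \<otimes> z \<oplus> y \<otimes> z"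
    and r_distr: "\<lbrakk>x \<in> carrier A; y \<in> carrier A; z \<in> carrier A\<rbrakk>
      \<Longrightarrow> z \<otimes> (x \<oplus> y) = z \<otimes> x \<oplus> z \<otimes> y"
    and smult_m_left: "\<lbrakk>x \<in> carrier A; y \<in> carrier A\<rbrakk> \<Longrightarrow> (c \<odot> x) \<otimes> y = c \<odot> (x \<otimes> y)"
    and smult_m_right: "\<lbrakk>x \<in> carrier A; y \<in> carrier A\<rbrakk> \<Longrightarrow> x \<otimes> (c \<odot> y) = c \<odot> (x \<otimes> y)"
    and star_closed: "x \<in> carrier A \<Longrightarrow> star A x \<in> carrier A"
    and star_star: "x \<in> carrier A \<Longrightarrow> star A (star A x) = x"
    and star_add: "\<lbrakk>x \<in> carrier A; y \<in> carrier A\<rbrakk> \<Longrightarrow> star A (x \<oplus> y) = star A x \<oplus> star A y"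
    and star_smult: "x \<in> carrier A \<Longrightarrow> star A (c \<odot> x) = cnj c \<odot> star A x"
    and star_mult: "\<lbrakk>x \<in> carrier A; y \<in> carrier A\<rbrakk> \<Longrightarrow> star A (x \<otimes> y) = star A y \<otimes> star A x"
    and nrm_nonneg: "x \<in> carrier A \<Longrightarrow> 0 \<le> nrm A x"
    and nrm_eq_0: "x \<in> carrier A \<Longrightarrow> nrm A x = 0 \<longleftrightarrow> x = \<zero>"
    and nrm_smult: "x \<in> carrier A \<Longrightarrow> nrm A (c \<odot> x) = cmod c * nrm A x"
    and nrm_triangle: "\<lbrakk>x \<in> carrier A; y \<in> carrier A\<rbrakk> \<Longrightarrow> nrm A (x \<oplus> y) \<le> nrm A x + nrm A y"
    and nrm_mult: "\<lbrakk>x \<in> carrier A; y \<in> carrier A\<rbrakk> \<Longrightarrow> nrm A (x \<otimes> y) \<le> nrm A x * nrm A y"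
    and cstar_identity: "x \<in> carrier A \<Longrightarrow> nrm A (star A x \<otimes> x) = (nrm A x)\<^sup>2"

lemma (in pre_cstar_algebra) Metric_space_nrm_dist: "Metric_space (carrier A) (nrm_dist A)"
proof
  have minus_one: "\<ominus> x = (- 1) \<odot> x" if "x \<in> carrier A" for x
  proof -
    have "(- 1) \<odot> x \<oplus> x = (- 1 + 1) \<odot> x"
      using smult_l_distr[of "- 1" 1 x] smult_one[of x] that
      by (simp add: ring_of_type_algebra_def)
    also have "\<dots> = \<zero>"
      using smult_l_null[of x] that by (simp add: ring_of_type_algebra_def)
    finally show ?thesis
      using that smult_closed[of "- 1" x]
      by (simp add: M.minus_equality ring_of_type_algebra_def)
  qed
  have nrm_neg: "nrm A (\<ominus> x) = nrm A x" if "x \<in> carrier A" for x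
    using that by (simp add: minus_one nrm_smult)
  show "0 \<le> nrm_dist A x y" for x y
    by (simp add: nrm_dist_def nrm_nonneg)
  have "nrm A (x \<ominus> y) = nrm A (y \<ominus> x)" if "x \<in> carrier A" "y \<in> carrier A" for x y
    using nrm_neg[of "y \<ominus> x"] that by (simp add: a_minus_def M.minus_add M.a_comm)
  then show "nrm_dist A x y = nrm_dist A y x" for x y
    by (simp add: nrm_dist_def)
  show "nrm_dist A x y = 0 \<longleftrightarrow> x = y" if "x \<in> carrier A" "y \<in> carrier A" for x y
    using that M.minus_equality[of x "\<ominus> y"]
    by (auto simp: nrm_dist_def nrm_eq_0 a_minus_def M.r_neg)
  show "nrm_dist A x z \<le> nrm_dist A x y + nrm_dist A y z"
    if "x \<in> carrier A" "y \<in> carrier A" "z \<in> carrier A" for x y z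
  proof -
    have "x \<ominus> z = (x \<ominus> y) \<oplus> (y \<ominus> z)"
      using that by (simp add: a_minus_def M.a_assoc M.r_neg2 M.r_neg1)
    then show ?thesis
      using that nrm_triangle[of "x \<ominus> y" "y \<ominus> z"] by (simp add: nrm_dist_def)
  qed
qed

abbreviation nrm_topology :: "('a, 'm) cstar_struct_scheme \<Rightarrow> 'a topology"
  where "nrm_topology A \<equiv> Metric_space.mtopology (carrier A) (nrm_dist A)"

locale cstar_algebra = pre_cstar_algebra +
  assumes complete: "Metric_space.mcomplete (carrier A) (nrm_dist A)"


section \<open>Subalgebras, ideals and quotients\<close>

abbreviation csubspace :: "'a set \<Rightarrow> ('a, 'm) cstar_struct_scheme \<Rightarrow> bool"
  where "csubspace V A \<equiv> submodule V complex_ring A"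

definition cstar_subalgebra :: "'a set \<Rightarrow> ('a, 'm) cstar_struct_scheme \<Rightarrow> bool"
  where "cstar_subalgebra D A \<longleftrightarrow>
    csubspace D A \<and>
    (\<forall>x\<in>D. \<forall>y\<in>D. x \<otimes>\<^bsub>A\<^esub> y \<in> D) \<and>
    (\<forall>x\<in>D. star A x \<in> D) \<and>
    closedin (nrm_topology A) D"

definition cstar_ideal :: "'a set \<Rightarrow> ('a, 'm) cstar_struct_scheme \<Rightarrow> bool"
  where "cstar_ideal J A \<longleftrightarrow>
    csubspace J A \<and>
    (\<forall>a\<in>carrier A. \<forall>x\<in>J. a \<otimes>\<^bsub>A\<^esub> x \<in> J \<and> x \<otimes>\<^bsub>A\<^esub> a \<in> J) \<and>
    closedin (nrm_topology A) J"

definition annihilator :: "('a, 'm) cstar_struct_scheme \<Rightarrow> 'a set \<Rightarrow> 'a set"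
  where "annihilator A S =
    {a \<in> carrier A. \<forall>x\<in>S. a \<otimes>\<^bsub>A\<^esub> x = \<zero>\<^bsub>A\<^esub> \<and> x \<otimes>\<^bsub>A\<^esub> a = \<zero>\<^bsub>A\<^esub>}"

definition regular_ideal :: "'a set \<Rightarrow> ('a, 'm) cstar_struct_scheme \<Rightarrow> bool"
  where "regular_ideal J A \<longleftrightarrow> cstar_ideal J A \<and> J = annihilator A (annihilator A J)"

text \<open>
  Scalar multiplication and involution of cosets follow the pattern of \<^const>\<open>rcoset_mult\<close>:
  they are the coset of \<open>c x\<close>, respectively of \<open>x*\<close>, for representatives \<open>x\<close>.
\<close>

definition cstar_quotient ::
    "('a, 'm) cstar_struct_scheme \<Rightarrow> 'a set \<Rightarrow> 'a set cstar_struct"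
  where "cstar_quotient A J =
    \<lparr>carrier = carrier (A Quot J), mult = mult (A Quot J), one = one (A Quot J),
     zero = zero (A Quot J), add = add (A Quot J),
     smult = (\<lambda>c C. \<Union>x\<in>C. J +>\<^bsub>A\<^esub> (c \<odot>\<^bsub>A\<^esub> x)),
     star = (\<lambda>C. \<Union>x\<in>C. J +>\<^bsub>A\<^esub> star A x),
     nrm = (\<lambda>C. INF x\<in>C. nrm A x)\<rparr>"

text \<open>
  For a subalgebra \<open>D\<close> of \<open>A\<close>, the algebra \<open>D / (J \<inter> D)\<close> has carrier
  \<open>carrier (cstar_quotient (A\<lparr>carrier := D\<rparr>) (J \<inter> D))\<close>. Adding \<open>J\<close> to a coset is the map
  \<open>d + (J \<inter> D) \<mapsto> d + J\<close> into \<open>A / J\<close>.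
\<close>

definition coset_incl :: "('a, 'm) cstar_struct_scheme \<Rightarrow> 'a set \<Rightarrow> 'a set \<Rightarrow> 'a set"
  where "coset_incl A J C = C <+>\<^bsub>A\<^esub> J"

definition quotient_subalgebra ::
    "('a, 'm) cstar_struct_scheme \<Rightarrow> 'a set \<Rightarrow> 'a set \<Rightarrow> 'a set set"
  where "quotient_subalgebra A D J =
    coset_incl A J ` carrier (cstar_quotient (A\<lparr>carrier := D\<rparr>) (J \<inter> D))"

lemma coset_incl_coset:
  assumes "cstar_algebra A" "cstar_subalgebra D A" "cstar_ideal J A" "d \<in> D"
  shows "coset_incl A J ((J \<inter> D) +>\<^bsub>A\<^esub> d) = J +>\<^bsub>A\<^esub> d"
proof -
  interpret cstar_algebra A by fact
  interpret D: submodule D complex_ring A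
    using assms by (simp add: cstar_subalgebra_def)
  interpret J: submodule J complex_ring A
    using assms by (simp add: cstar_ideal_def)
  have d: "d \<in> carrier A"
    using assms D.subset by auto
  have JA: "x \<in> carrier A" if "x \<in> J" for x
    using that J.subset by auto
  show ?thesis
  proof
    show "coset_incl A J ((J \<inter> D) +>\<^bsub>A\<^esub> d) \<subseteq> J +>\<^bsub>A\<^esub> d"
    proof
      fix y assume "y \<in> coset_incl A J ((J \<inter> D) +>\<^bsub>A\<^esub> d)"
      then obtain h k where hk: "h \<in> J" "k \<in> J" "y = (h \<oplus>\<^bsub>A\<^esub> d) \<oplus>\<^bsub>A\<^esub> k"
        by (auto simp: coset_incl_def set_add_def' a_r_coset_def')
      then have "y = (h \<oplus>\<^bsub>A\<^esub> k) \<oplus>\<^bsub>A\<^esub> d"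
        using d JA by (simp add: M.a_assoc M.a_comm[of d k])
      moreover have "h \<oplus>\<^bsub>A\<^esub> k \<in> J"
        using J.m_closed[of h k] hk by simp
      ultimately show "y \<in> J +>\<^bsub>A\<^esub> d"
        by (auto simp: a_r_coset_def')
    qed
    show "J +>\<^bsub>A\<^esub> d \<subseteq> coset_incl A J ((J \<inter> D) +>\<^bsub>A\<^esub> d)"
    proof
      fix y assume "y \<in> J +>\<^bsub>A\<^esub> d"
      then obtain h where h: "h \<in> J" "y = h \<oplus>\<^bsub>A\<^esub> d"
        by (auto simp: a_r_coset_def')
      then have "y = (\<zero>\<^bsub>A\<^esub> \<oplus>\<^bsub>A\<^esub> d) \<oplus>\<^bsub>A\<^esub> h"
        using d JA by (simp add: M.a_comm)
      moreover have "\<zero>\<^bsub>A\<^esub> \<in> J \<inter> D"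
        using J.one_closed D.one_closed by simp
      ultimately show "y \<in> coset_incl A J ((J \<inter> D) +>\<^bsub>A\<^esub> d)"
        using h unfolding coset_incl_def set_add_def' a_r_coset_def' by blast
    qed
  qed
qed

lemma quotient_subalgebra_eq:
  assumes "cstar_algebra A" "cstar_subalgebra D A" "cstar_ideal J A"
  shows "quotient_subalgebra A D J = (\<lambda>d. J +>\<^bsub>A\<^esub> d) ` D"
proof -
  have "carrier (cstar_quotient (A\<lparr>carrier := D\<rparr>) (J \<inter> D)) = (\<lambda>d. (J \<inter> D) +>\<^bsub>A\<^esub> d) ` D"
    by (auto simp: cstar_quotient_def FactRing_def A_RCOSETS_def' a_r_coset_def')
  then show ?thesis
    using coset_incl_coset[OF assms] by (simp add: quotient_subalgebra_def image_image)
qed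


section \<open>Cartan subalgebras\<close>

definition cstar_positive :: "('a, 'm) cstar_struct_scheme \<Rightarrow> 'a set"
  where "cstar_positive A = {star A b \<otimes>\<^bsub>A\<^esub> b |b. b \<in> carrier A}"

text \<open>
  An approximate unit is a net of positive contractions in \<open>A\<close> with \<open>u a \<rightarrow> a\<close> and
  \<open>a u \<rightarrow> a\<close> for all \<open>a\<close>. The net is represented by its filter of tails, so that no index type
  has to be fixed.
\<close>

definition approximate_unit :: "('a, 'm) cstar_struct_scheme \<Rightarrow> 'a filter \<Rightarrow> bool"
  where "approximate_unit A F \<longleftrightarrow>
    F \<noteq> bot \<and>
    (\<forall>\<^sub>F u in F. u \<in> cstar_positive A \<and> nrm A u \<le> 1) \<and>
    (\<forall>a\<in>carrier A.
      ((\<lambda>u. nrm A (u \<otimes>\<^bsub>A\<^esub> a \<ominus>\<^bsub>A\<^esub> a)) \<longlongrightarrow> 0) F \<and>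
      ((\<lambda>u. nrm A (a \<otimes>\<^bsub>A\<^esub> u \<ominus>\<^bsub>A\<^esub> a)) \<longlongrightarrow> 0) F)"

definition cstar_inclusion :: "'a set \<Rightarrow> ('a, 'm) cstar_struct_scheme \<Rightarrow> bool"
  where "cstar_inclusion D A \<longleftrightarrow>
    cstar_algebra A \<and> cstar_subalgebra D A \<and>
    (\<exists>F. approximate_unit A F \<and> (\<forall>\<^sub>F u in F. u \<in> D))"

definition normalizers :: "'a set \<Rightarrow> ('a, 'm) cstar_struct_scheme \<Rightarrow> 'a set"
  where "normalizers D A =
    {n \<in> carrier A. \<forall>d\<in>D.
      n \<otimes>\<^bsub>A\<^esub> d \<otimes>\<^bsub>A\<^esub> star A n \<in> D \<and> star A n \<otimes>\<^bsub>A\<^esub> d \<otimes>\<^bsub>A\<^esub> n \<in> D}"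

definition clinear_span :: "'a set \<Rightarrow> ('a, 'm) cstar_struct_scheme \<Rightarrow> 'a set"
  where "clinear_span S A = (\<lambda>V. csubspace V A) hull S"

definition regular_inclusion :: "'a set \<Rightarrow> ('a, 'm) cstar_struct_scheme \<Rightarrow> bool"
  where "regular_inclusion D A \<longleftrightarrow>
    cstar_inclusion D A \<and>
    nrm_topology A closure_of clinear_span (normalizers D A) A = carrier A"

text \<open>
  Complete positivity is not listed: it is automatic for a positive \<open>D\<close>-bimodule projection
  onto \<open>D\<close>. For \<open>D \<noteq> 0\<close> contractivity is the usual norm-one condition.
\<close>

definition conditional_expectation ::
    "('a \<Rightarrow> 'a) \<Rightarrow> 'a set \<Rightarrow> ('a, 'm) cstar_struct_scheme \<Rightarrow> bool"
  where "conditional_expectation E D A \<longleftrightarrow>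
    E \<in> carrier A \<rightarrow> D \<and>
    (\<forall>x\<in>carrier A. \<forall>y\<in>carrier A. E (x \<oplus>\<^bsub>A\<^esub> y) = E x \<oplus>\<^bsub>A\<^esub> E y) \<and>
    (\<forall>c. \<forall>x\<in>carrier A. E (c \<odot>\<^bsub>A\<^esub> x) = c \<odot>\<^bsub>A\<^esub> E x) \<and>
    (\<forall>d\<in>D. E d = d) \<and>
    (\<forall>d\<in>D. \<forall>x\<in>carrier A. E (d \<otimes>\<^bsub>A\<^esub> x) = d \<otimes>\<^bsub>A\<^esub> E x \<and> E (x \<otimes>\<^bsub>A\<^esub> d) = E x \<otimes>\<^bsub>A\<^esub> d) \<and>
    (\<forall>x\<in>cstar_positive A. E x \<in> cstar_positive A) \<and>
    (\<forall>x\<in>carrier A. nrm A (E x) \<le> nrm A x)"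

definition faithful_map :: "('a \<Rightarrow> 'a) \<Rightarrow> ('a, 'm) cstar_struct_scheme \<Rightarrow> bool"
  where "faithful_map E A \<longleftrightarrow>
    (\<forall>a\<in>carrier A. E (star A a \<otimes>\<^bsub>A\<^esub> a) = \<zero>\<^bsub>A\<^esub> \<longrightarrow> a = \<zero>\<^bsub>A\<^esub>)"

definition abelian_subalgebra :: "'a set \<Rightarrow> ('a, 'm) cstar_struct_scheme \<Rightarrow> bool"
  where "abelian_subalgebra B A \<longleftrightarrow>
    cstar_subalgebra B A \<and> (\<forall>x\<in>B. \<forall>y\<in>B. x \<otimes>\<^bsub>A\<^esub> y = y \<otimes>\<^bsub>A\<^esub> x)"

definition maximal_abelian :: "'a set \<Rightarrow> ('a, 'm) cstar_struct_scheme \<Rightarrow> bool"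
  where "maximal_abelian D A \<longleftrightarrow>
    abelian_subalgebra D A \<and> (\<forall>B. abelian_subalgebra B A \<and> D \<subseteq> B \<longrightarrow> B = D)"

definition cartan_subalgebra :: "'a set \<Rightarrow> ('a, 'm) cstar_struct_scheme \<Rightarrow> bool"
  where "cartan_subalgebra D A \<longleftrightarrow>
    regular_inclusion D A \<and>
    (\<exists>E. conditional_expectation E D A \<and> faithful_map E A) \<and>
    maximal_abelian D A"

end

theory Submission
  imports Defs "HOL-Real_Asymp.Real_Asymp"
begin

text \<open>
  Put \<open>K = J\<^sup>\<bottom>\<close>, so that \<open>J = K\<^sup>\<bottom>\<close>. The key point is that \<open>a \<in> J\<close> as soon as \<open>a\<close> annihilates
  \<open>K \<inter> D\<close>. Since \<open>K \<inter> D\<close> is invariant under conjugation by normalizers, such an \<open>a\<close> satisfies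
  \<open>a A (K \<inter> D) = 0\<close>; hence for \<open>k \<in> K\<close> the element \<open>x = a k\<close> annihilates a left ideal that is
  annihilated by no nonzero element of \<open>D\<close>, and this forces \<open>x = 0\<close>: if \<open>E(x*x) \<noteq> 0\<close>, compress a
  finite sum \<open>s\<close> of normalizers close to \<open>x*x\<close> by an \<open>h \<in> D\<close> supported where \<open>E(x*x)\<close> is large, in
  such a way that \<open>h s h \<in> D\<close>; then \<open>h x*x h\<close> is close to \<open>h E(x*x) h\<close>. Such an \<open>h\<close> exists because
  \<open>D\<close> is maximal abelian: a normalizer \<open>g n g\<close> lies in \<open>D\<close> unless it fails to commute with \<open>D\<close>, and
  then it moves some part of the spectrum of \<open>D\<close> off itself.

  The key point gives \<open>E(J) \<subseteq> J\<close>, so \<open>E\<close> descends to \<open>A / J\<close>. The induced expectation is faithful,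
  because \<open>E(a*a) \<in> J\<close> gives \<open>E((a m)*(a m)) = 0\<close> for \<open>m \<in> K \<inter> D\<close>. If \<open>a\<close> commutes with \<open>D\<close> modulo
  \<open>J\<close>, then \<open>(a - E(a)) m\<close> commutes with \<open>D\<close>, hence lies in \<open>D\<close> and equals its own expectation \<open>0\<close>;
  so \<open>a - E(a) \<in> J\<close>.

  Functional calculus rests on the bound \<open>\<parallel>p(x)\<parallel> \<le> sup {\<bar>p(t)\<bar> | \<bar>t\<bar> \<le> \<parallel>x\<parallel>}\<close> for self-adjoint \<open>x\<close>
  and real polynomials \<open>p\<close>. It needs no spectra: the identity \<open>T\<^sub>n\<^sup>2 + (1 - t\<^sup>2) U\<^sup>2 = 1\<close> shows that
  Chebyshev polynomials of a self-adjoint contraction are contractions, which bounds \<open>\<parallel>p(x)\<parallel>\<close> up to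
  a factor linear in the degree of \<open>p\<close>, and \<open>\<parallel>p(x)\<parallel>\<^sup>2 = \<parallel>p(x)\<^sup>2\<parallel>\<close> removes the factor.
\<close>

section \<open>Norms of real polynomials\<close>

text \<open>Regularity turns membership in \<open>J\<close> into annihilation of \<open>K\<close>, a
  condition that products with elements of \<open>K \<inter> D\<close> can test. \<open>D\<close> is
  never represented as an algebra of functions, so supports have to be expressed algebraically.
  Their substitute is the local unit: a nonzero self-adjoint \<open>h\<close> in \<open>D\<close>
  yields a nonzero \<open>g\<close> in \<open>D\<close> on which \<open>h\<close> is invertible, and
  disjointness of supports becomes the vanishing of a product. For \<open>x = a k\<close> the left
  ideal consists of the \<open>y\<close> with \<open>x y = 0\<close> and \<open>x A y = 0\<close>.
  It contains \<open>J\<close>, because \<open>x\<close> lies in \<open>K\<close>, and it contains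
  \<open>K \<inter> D\<close>, because \<open>a A (K \<inter> D) = 0\<close>. An element
  \<open>d\<close> of \<open>D\<close> that kills this left ideal kills \<open>J\<close>, so it lies
  in \<open>K\<close>; then \<open>star A d\<close> lies in \<open>K \<inter> D\<close>, hence in
  the left ideal, and \<open>d d* = 0\<close> forces \<open>d = 0\<close>. Annihilation from one
  side is enough: \<open>J\<close> and \<open>K\<close> are closed under the involution, and an
  element \<open>y\<close> vanishes once \<open>y y*\<close> does.\<close>

abbreviation psmult :: "real \<Rightarrow> real poly \<Rightarrow> real poly"
  where "psmult \<equiv> Polynomial.smult"
abbreviation pdeg :: "real poly \<Rightarrow> nat"
  where "pdeg \<equiv> Polynomial.degree"

text \<open>
  The model is \<open>B p b \<longleftrightarrow> \<parallel>p(x)\<parallel> \<le> b\<close> for a self-adjoint element \<open>x\<close> of a C*-algebra; the last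
  assumption is the trace of the C*-identity, applied to \<open>p(x) + i q(x)\<close>.
\<close>

locale uniform_bound =
  fixes B :: "real poly \<Rightarrow> real \<Rightarrow> bool"
  assumes B_mono: "\<lbrakk>B p b; b \<le> c\<rbrakk> \<Longrightarrow> B p c"
    and B_closed: "(\<And>e. 0 < e \<Longrightarrow> B p (b + e)) \<Longrightarrow> B p b"
    and B_one: "B 1 1"
    and B_add: "\<lbrakk>B p b; B q c\<rbrakk> \<Longrightarrow> B (p + q) (b + c)"
    and B_smult: "B p b \<Longrightarrow> B (psmult a p) (\<bar>a\<bar> * b)"
    and B_mult: "\<lbrakk>B p b; B q c; 0 \<le> b; 0 \<le> c\<rbrakk> \<Longrightarrow> B (p * q) (b * c)"
    and B_square: "\<lbrakk>B (p\<^sup>2 + q\<^sup>2) b; 0 \<le> b\<rbrakk> \<Longrightarrow> B p (sqrt b)"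
begin

text \<open>Only the existence of a bound matters: in \<open>B_chebT\<close> it multiplies an error
  that can be made arbitrarily small.\<close>

lemma B_finite:
  assumes "B [:0, 1:] R" "0 \<le> R"
  shows "\<exists>b\<ge>0. B p b"
proof (induction p)
  case 0
  show ?case using B_smult[OF B_one, of 0] by auto
next
  case (pCons a p)
  then obtain b where b: "0 \<le> b" "B p b" by blast
  have "B (psmult a 1 + [:0, 1:] * p) (\<bar>a\<bar> * 1 + R * b)"
    by (intro B_add B_smult B_mult B_one assms b)
  moreover have "psmult a 1 + [:0, 1:] * p = pCons a p"
    by simp
  ultimately show ?case
    using b assms by (metis abs_ge_zero add_nonneg_nonneg mult.right_neutral mult_nonneg_nonneg)
qed

lemma B_power: "\<lbrakk>B p b; 0 \<le> b\<rbrakk> \<Longrightarrow> B (p ^ n) (b ^ n)"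
  by (induction n) (auto intro: B_one B_mult)

lemma B_sum:
  assumes "finite I" "\<And>i. i \<in> I \<Longrightarrow> B (f i) (b i)"
  shows "B (sum f I) (sum b I)"
  using assms
proof (induction I rule: finite_induct)
  case empty
  show ?case using B_smult[OF B_one, of 0] by simp
qed (auto intro: B_add)

text \<open>Fixed-point iteration for \<open>y = 1 - \<surd>(1 - s)\<close>, that is, for \<open>y = (s + y\<^sup>2) / 2\<close>.\<close>

lemma B_sqrt:
  assumes s: "B s \<rho>" "0 \<le> \<rho>" "\<rho> < 1" and "0 < e"
  obtains q where "B (q\<^sup>2 - (1 - s)) e"
proof -
  define y where "y n = ((\<lambda>y. psmult (1/2) (s + y\<^sup>2)) ^^ n) 0" for n
  have y_Suc: "y (Suc n) = psmult (1/2) (s + (y n)\<^sup>2)" for n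
    by (simp add: y_def)
  have B0: "B 0 0"
    using B_smult[OF B_one, of 0] by simp
  have By: "B (y n) \<rho>" for n
  proof (induction n)
    case 0
    show ?case using B_mono[OF B0] s by (simp add: y_def)
  next
    case (Suc n)
    have "B (y (Suc n)) (\<bar>1/2\<bar> * (\<rho> + \<rho>\<^sup>2))"
      unfolding y_Suc by (intro B_smult B_add s B_power Suc)
    moreover have "\<rho>\<^sup>2 \<le> \<rho>"
      using s by (simp add: power2_eq_square mult_left_le)
    ultimately show ?case
      by (auto elim: B_mono)
  qed
  \<comment> \<open>A step of the iteration is the previous step times
    \<open>(y (Suc n) + y n) / 2\<close>, and this factor is bounded by \<rho>.\<close>
  have Bd: "B (y (Suc n) - y n) (\<rho> ^ n)" for n
  proof (induction n)
    case 0
    have "B (psmult (1/2) s) (\<bar>1/2\<bar> * \<rho>)"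
      by (intro B_smult s)
    then show ?case
      using s B_mono by (force simp: y_def)
  next
    case (Suc n)
    have "B (psmult (1/2) ((y (Suc n) + y n) * (y (Suc n) - y n))) (\<bar>1/2\<bar> * ((\<rho> + \<rho>) * \<rho> ^ n))"
      using s by (intro B_smult B_mult B_add By Suc) auto
    moreover have "y (Suc (Suc n)) - y (Suc n) = psmult (1/2) ((y (Suc n) + y n) * (y (Suc n) - y n))"
      unfolding y_Suc[of "Suc n"] by (subst (2) y_Suc) (simp add: power2_eq_square algebra_simps smult_diff_right smult_add_right)
    ultimately show ?case by simp
  qed
  obtain n where n: "\<rho> ^ n < e / 2"
    using real_arch_pow_inv[of "e/2" \<rho>] s \<open>0 < e\<close> by auto
  \<comment> \<open>The defect of \<open>1 - y n\<close> as a square root of \<open>1 - s\<close> is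
    exactly twice the next step of the iteration, so it decays geometrically.\<close>
  have "(1 - y n)\<^sup>2 - (1 - s) = psmult 2 (y (Suc n) - y n)"
    unfolding y_Suc by (simp add: power2_eq_square algebra_simps smult_diff_right smult_add_right numeral_poly)
  moreover have "B (psmult 2 (y (Suc n) - y n)) (\<bar>2\<bar> * \<rho> ^ n)"
    by (intro B_smult Bd)
  ultimately have "B ((1 - y n)\<^sup>2 - (1 - s)) e"
    using n by (auto elim!: B_mono)
  then show ?thesis by (rule that)
qed

end

text \<open>The pair consists of the Chebyshev polynomials T_n and U_(n-1), that is, of cos(n x) and
  sin(n x)/sin x as polynomials in cos x; the recursion is the addition formula. The index of the
  second component is shifted so that the Pell identity relates the two components of one
  pair.\<close>

primrec cheb :: "nat \<Rightarrow> real poly \<times> real poly" where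
  "cheb 0 = (1, 0)"
| "cheb (Suc n) = (let (T, U) = cheb n in
     ([:0, 1:] * T - (1 - [:0, 1:]\<^sup>2) * U, T + [:0, 1:] * U))"

abbreviation chebT where "chebT n \<equiv> fst (cheb n)"
abbreviation chebU where "chebU n \<equiv> snd (cheb n)"

lemma cheb_Suc:
  "chebT (Suc n) = [:0, 1:] * chebT n - (1 - [:0, 1:]\<^sup>2) * chebU n"
  "chebU (Suc n) = chebT n + [:0, 1:] * chebU n"
  by (simp_all add: Let_def case_prod_unfold)

declare cheb.simps(2) [simp del]

text \<open>This is cos^2 + sin^2 = 1 in polynomial form. One step of the recursion is a rotation
  and preserves the form \<open>t\<^sup>2 + (1 - x\<^sup>2) * u\<^sup>2\<close>.\<close>

lemma cheb_pell: "(chebT n)\<^sup>2 + (1 - [:0, 1:]\<^sup>2) * (chebU n)\<^sup>2 = 1"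
proof (induction n)
  case (Suc n)
  have *: "(x * t - (1 - x\<^sup>2) * u)\<^sup>2 + (1 - x\<^sup>2) * (t + x * u)\<^sup>2 = t\<^sup>2 + (1 - x\<^sup>2) * u\<^sup>2"
    for x t u :: "real poly" by (simp add: power2_eq_square algebra_simps)
  show ?case unfolding cheb_Suc * by (rule Suc)
qed simp

lemma cheb_cos: "poly (chebT n) (cos x) = cos (n * x) \<and> poly (chebU n) (cos x) * sin x = sin (n * x)"
proof (induction n)
  case (Suc n)
  have s: "1 - (cos x)\<^sup>2 = sin x * sin x"
    by (simp add: power2_eq_square[symmetric] sin_squared_eq)
  have "poly (chebT (Suc n)) (cos x) = cos x * cos (n * x) - sin x * sin (n * x)"
    unfolding cheb_Suc using Suc by (simp add: s mult.assoc) (metis mult.commute)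
  moreover have "poly (chebU (Suc n)) (cos x) * sin x = cos (n * x) * sin x + cos x * sin (n * x)"
    unfolding cheb_Suc using Suc by (simp add: algebra_simps)
  ultimately show ?case
    by (simp add: distrib_right cos_add sin_add algebra_simps)
qed simp

text \<open>X T_j is the mean of T_(j+1) and T_(j-1), so multiplication by X raises the index needed
  by at most one. Induction on the coefficient list then reaches every polynomial.\<close>

lemma cheb_expansion: "pdeg p \<le> n \<Longrightarrow> \<exists>c. p = (\<Sum>k\<le>n. psmult (c k) (chebT k))"
proof (induction p arbitrary: n)
  case 0
  show ?case by (rule exI[of _ "\<lambda>_. 0"]) simp
next
  case (pCons a p)
  let ?X = "[:0, 1:] :: real poly"
  have add: "\<exists>c. p + q = (\<Sum>k\<le>n. psmult (c k) (chebT k))"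
    if "\<exists>c. p = (\<Sum>k\<le>n. psmult (c k) (chebT k))" "\<exists>c. q = (\<Sum>k\<le>n. psmult (c k) (chebT k))" for p q
  proof -
    from that obtain c d where "p = (\<Sum>k\<le>n. psmult (c k) (chebT k))" "q = (\<Sum>k\<le>n. psmult (d k) (chebT k))"
      by blast
    then show ?thesis
      by (intro exI[of _ "\<lambda>k. c k + d k"]) (simp add: smult_add_left sum.distrib)
  qed
  have sm: "\<exists>c. psmult a p = (\<Sum>k\<le>n. psmult (c k) (chebT k))"
    if "\<exists>c. p = (\<Sum>k\<le>n. psmult (c k) (chebT k))" for a p
  proof -
    from that obtain c where "p = (\<Sum>k\<le>n. psmult (c k) (chebT k))"
      by blast
    then show ?thesis
      by (intro exI[of _ "\<lambda>k. a * c k"]) (simp add: poly_eq_iff coeff_sum sum_distrib_left mult.assoc)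
  qed
  have T: "\<exists>c. chebT j = (\<Sum>k\<le>n. psmult (c k) (chebT k))" if "j \<le> n" for j
  proof (rule exI[of _ "\<lambda>k. if k = j then 1 else 0"])
    have "(\<Sum>k\<le>n. psmult (if k = j then 1 else 0) (chebT k)) = (\<Sum>k\<le>n. if k = j then chebT k else 0)"
      by (intro sum.cong) auto
    then show "chebT j = (\<Sum>k\<le>n. psmult (if k = j then 1 else 0) (chebT k))"
      using that by simp
  qed
  have XT: "\<exists>c. ?X * chebT j = (\<Sum>k\<le>n. psmult (c k) (chebT k))" if "Suc j \<le> n" for j
  proof (cases j)
    case 0
    then show ?thesis using T[of 1] that by (simp add: cheb_Suc one_pCons)
  next
    case (Suc i)
    \<comment> \<open>Solving the coupled recursion for the preceding T gives the three-term
      recurrence.\<close>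
    have *: "x * (x * t - (1 - x\<^sup>2) * u) + (1 - x\<^sup>2) * (t + x * u) = t" for x t u :: "real poly"
      by (simp add: power2_eq_square algebra_simps)
    have "chebT i = ?X * chebT (Suc i) + (1 - ?X\<^sup>2) * chebU (Suc i)"
      unfolding cheb_Suc * ..
    moreover have "chebT (Suc j) = ?X * chebT j - (1 - ?X\<^sup>2) * chebU j"
      by (rule cheb_Suc)
    ultimately have "chebT (Suc j) + chebT i = ?X * chebT j + ?X * chebT j"
      using Suc by (simp add: algebra_simps del: mult_pCons_left mult_pCons_right)
    then have "psmult (1/2) (chebT (Suc j) + chebT i) = ?X * chebT j"
      by (metis field_sum_of_halves smult_1_left smult_add_left smult_add_right)
    then show ?thesis
      using sm[OF add[OF T T], of "Suc j" i "1/2"] that Suc by simp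
  qed
  show ?case
  proof (cases "p = 0")
    case True
    then show ?thesis
      using sm[OF T[of 0], of a] by simp
  next
    case False
    then have "pdeg p \<le> n - 1" "n \<noteq> 0"
      using pCons.prems by auto
    then obtain c where c: "p = (\<Sum>k\<le>n - 1. psmult (c k) (chebT k))"
      using pCons.IH by blast
    have "?X * p = (\<Sum>k\<le>n - 1. psmult (c k) (?X * chebT k))"
      by (subst c) (simp add: sum_distrib_left)
    moreover have "\<exists>d. (\<Sum>k\<in>I. psmult (c k) (?X * chebT k)) = (\<Sum>k\<le>n. psmult (d k) (chebT k))"
      if "finite I" "I \<subseteq> {..n - 1}" for I
      using that
    proof (induction I rule: finite_induct)
      case empty
      show ?case by (rule exI[of _ "\<lambda>_. 0"]) simp
    next
      case (insert i I)
      have "Suc i \<le> n" using insert.prems \<open>n \<noteq> 0\<close> by auto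
      then have "\<exists>d. psmult (c i) (?X * chebT i) = (\<Sum>k\<le>n. psmult (d k) (chebT k))"
        by (intro sm XT)
      then show ?case
        unfolding sum.insert[OF insert(1,2)] using insert by (intro add) auto
    qed
    ultimately have "\<exists>d. ?X * p = (\<Sum>k\<le>n. psmult (d k) (chebT k))"
      by auto
    then have "\<exists>d. psmult a (chebT 0) + ?X * p = (\<Sum>k\<le>n. psmult (d k) (chebT k))"
      by (intro add sm T) auto
    then show ?thesis by simp
  qed
qed

lemma has_integral_cos_int:
  fixes m :: int
  shows "((\<lambda>x. cos (m * x)) has_integral (if m = 0 then 2 * pi else 0)) {-pi..pi}"
proof (cases "m = 0")
  case True
  then show ?thesis
    using has_integral_const_real[of "1::real" "-pi" pi] by simp
next
  case False
  have "((\<lambda>x. cos (m * x)) has_integral (sin (m * pi) / m - sin (m * (-pi)) / m)) {-pi..pi}"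
    using False
    by (intro fundamental_theorem_of_calculus)
       (auto simp: has_real_derivative_iff_has_vector_derivative[symmetric] intro!: derivative_eq_intros)
  moreover have "sin (m * pi) = 0"
    using sin_zero_iff_int2 by blast
  ultimately show ?thesis using False by simp
qed

text \<open>The \<open>c k\<close> are the cosine coefficients of the function p(cos x). By
  orthogonality the integral of p(cos x) cos(j x) from -pi to pi is pi times \<open>c j\<close>, or
  2 pi times \<open>c 0\<close> for \<open>j = 0\<close>; in absolute value it is at most 2 pi
  M.\<close>

lemma cheb_coeff_bound:
  assumes p: "p = (\<Sum>k\<le>n. psmult (c k) (chebT k))"
    and M: "\<And>t. \<bar>t\<bar> \<le> 1 \<Longrightarrow> \<bar>poly p t\<bar> \<le> M" and j: "j \<le> n"
  shows "\<bar>c j\<bar> \<le> 2 * M"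
proof -
  let ?f = "\<lambda>x::real. poly p (cos x) * cos (j * x)"
  have cosprod: "((\<lambda>x. cos (k * x) * cos (j * x)) has_integral
      (if k = j then (if j = 0 then 2 * pi else pi) else 0)) {-pi..pi}" for k :: nat
  proof -
    have "((\<lambda>x. (cos ((int k - int j) * x) + cos ((int k + int j) * x)) / 2) has_integral
      ((if int k - int j = 0 then 2 * pi else 0) + (if int k + int j = 0 then 2 * pi else 0)) / 2) {-pi..pi}"
      using has_integral_cos_int[of "int k - int j"] has_integral_cos_int[of "int k + int j"]
      by (intro has_integral_divide has_integral_add) auto
    moreover have "(cos ((int k - int j) * x) + cos ((int k + int j) * x)) / 2 = cos (k * x) * cos (j * x)"
      for x :: real
      using cos_minus[of "k * x - j * x"]
      by (simp add: cos_times_cos left_diff_distrib distrib_right)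
    ultimately show ?thesis
      by (rule_tac has_integral_eq_rhs) auto
  qed
  have "?f = (\<lambda>x::real. \<Sum>k\<le>n. c k * (cos (k * x) * cos (j * x)))"
    using cheb_cos by (auto simp: p poly_sum sum_distrib_right mult.assoc)
  moreover have "((\<lambda>x. \<Sum>k\<le>n. c k * (cos (k * x) * cos (j * x))) has_integral
      (\<Sum>k\<le>n. c k * (if k = j then (if j = 0 then 2 * pi else pi) else 0))) {-pi..pi}"
    by (intro has_integral_sum has_integral_mult_right cosprod) auto
  moreover have "(\<Sum>k\<le>n. c k * (if k = j then (if j = 0 then 2 * pi else pi) else 0))
      = c j * (if j = 0 then 2 * pi else pi)"
    using j by (subst sum.mono_neutral_right[of _ "{j}"]) auto
  ultimately have int: "(?f has_integral (c j * (if j = 0 then 2 * pi else pi))) (cbox (-pi) pi)"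
    by simp
  have M0: "0 \<le> M" using M[of 0] by auto
  have "norm (c j * (if j = 0 then 2 * pi else pi)) \<le> M * measure lborel (cbox (-pi) pi)"
  proof (rule has_integral_bound[OF M0 int])
    fix x :: real
    have "\<bar>poly p (cos x)\<bar> * \<bar>cos (j * x)\<bar> \<le> M * 1"
      by (intro mult_mono M M0) auto
    then show "norm (?f x) \<le> M" by (simp add: abs_mult)
  qed
  then have "\<bar>c j\<bar> * pi \<le> 2 * M * pi"
    by (auto simp: abs_mult split: if_splits)
  then show ?thesis by simp
qed

section \<open>Supremum bounds for arbitrary polynomials\<close>

context uniform_bound begin

text \<open>The Pell identity would bound T_n at once if 1 - X^2 were a square. It is replaced by
  the square of an approximate root \<open>r\<close>, and the defect of \<open>r\<close> multiplies
  \<open>(chebU n)\<^sup>2\<close>, which has some finite bound.\<close>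

lemma B_chebT:
  assumes X: "B [:0, 1:] 1"
  shows "B (chebT n) 1"
proof (rule B_closed)
  fix e :: real assume "0 < e"
  obtain b where b: "0 \<le> b" "B ((chebU n)\<^sup>2) b"
    using B_finite[OF X] by auto
  \<comment> \<open>The final error is \<open>2 * d * b\<close>, where \<open>2 * d\<close> will be
    the defect of \<open>r\<close> and \<open>b\<close> bounds
    \<open>(chebU n)\<^sup>2\<close>.\<close>
  define d where "d = e / (2 * (b + 1))"
  have d: "0 < d" "2 * d * b \<le> e"
    using \<open>0 < e\<close> b by (auto simp: d_def field_simps)
  let ?X = "[:0, 1:] :: real poly"
  \<comment> \<open>Division by \<open>1 + d\<close> provides the bound strictly below 1 that
    \<open>B_sqrt\<close> needs; undoing the scaling adds a second \<open>d\<close> to the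
    defect.\<close>
  have "B (psmult (1 / (1 + d)) (?X\<^sup>2)) (\<bar>1 / (1 + d)\<bar> * 1\<^sup>2)"
    by (intro B_smult B_power X) auto
  then obtain q where q: "B (q\<^sup>2 - (1 - psmult (1 / (1 + d)) (?X\<^sup>2))) (d / (1 + d))"
    using d by (rule_tac B_sqrt[of _ "1 / (1 + d)" "d / (1 + d)"]) auto
  define r where "r = psmult (sqrt (1 + d)) q"
  have sq: "psmult (sqrt (1 + d)) q * psmult (sqrt (1 + d)) q = psmult (1 + d) (q * q)"
    using d by (simp add: mult_smult_left mult_smult_right)
  have r: "r\<^sup>2 - (1 - ?X\<^sup>2) = psmult (1 + d) (q\<^sup>2 - (1 - psmult (1 / (1 + d)) (?X\<^sup>2))) + psmult d 1"
    unfolding r_def power2_eq_square[of "psmult _ _"] sq using d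
    by (simp add: smult_diff_right smult_add_left power2_eq_square one_pCons del: mult_pCons_left mult_pCons_right)
  have "B (r\<^sup>2 - (1 - ?X\<^sup>2)) (\<bar>1 + d\<bar> * (d / (1 + d)) + \<bar>d\<bar> * 1)"
    unfolding r by (intro B_add B_smult B_one q)
  then have r2: "B (r\<^sup>2 - (1 - ?X\<^sup>2)) (2 * d)"
    using d by (auto elim!: B_mono)
  have "B ((r\<^sup>2 - (1 - ?X\<^sup>2)) * (chebU n)\<^sup>2 + 1) (2 * d * b + 1)"
    using d b by (intro B_add B_mult r2 B_one) auto
  moreover have "(r\<^sup>2 - (1 - ?X\<^sup>2)) * (chebU n)\<^sup>2 + 1 = (chebT n)\<^sup>2 + (r * chebU n)\<^sup>2"
    using cheb_pell[of n, symmetric] by (simp add: power_mult_distrib algebra_simps)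
  ultimately have "B ((chebT n)\<^sup>2 + (r * chebU n)\<^sup>2) (1 + e)"
    using d by (auto elim!: B_mono)
  then have "B (chebT n) (sqrt (1 + e))"
    using \<open>0 < e\<close> by (intro B_square) auto
  moreover have "sqrt (1 + e) \<le> 1 + e"
    using \<open>0 < e\<close> by (intro real_le_lsqrt) (auto simp: power2_eq_square algebra_simps)
  ultimately show "B (chebT n) (1 + e)"
    using B_mono by blast
qed

text \<open>\<open>B_square\<close> extracts square roots only, so the crude bound is applied to
  powers p^m with m a power of two. Its factor is linear in m and loses against a geometric
  sequence.\<close>

lemma B_poly_unit:
  assumes X: "B [:0, 1:] 1" and M: "\<And>t. \<bar>t\<bar> \<le> 1 \<Longrightarrow> \<bar>poly p t\<bar> \<le> M"
  shows "B p M"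
proof (rule B_closed)
  fix e :: real assume "0 < e"
  have M0: "0 \<le> M" using M[of 0] by auto
  have crude: "B (p ^ m) ((real (pdeg p * m) + 1) * (2 * M ^ m))" for m
  proof -
    obtain c where c: "p ^ m = (\<Sum>k\<le>pdeg p * m. psmult (c k) (chebT k))"
      using cheb_expansion[OF degree_power_le[of p m]] by blast
    have cb: "\<bar>c j\<bar> \<le> 2 * M ^ m" if "j \<le> pdeg p * m" for j
    proof (rule cheb_coeff_bound[OF c _ that])
      fix t :: real assume "\<bar>t\<bar> \<le> 1"
      then show "\<bar>poly (p ^ m) t\<bar> \<le> M ^ m"
        by (simp add: poly_power power_abs power_mono M)
    qed
    have "B (\<Sum>k\<le>pdeg p * m. psmult (c k) (chebT k)) (\<Sum>k\<le>pdeg p * m. \<bar>c k\<bar> * 1)"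
      by (intro B_sum B_smult B_chebT X) auto
    moreover have "(\<Sum>k\<le>pdeg p * m. \<bar>c k\<bar> * 1) \<le> (\<Sum>k\<le>pdeg p * m. 2 * M ^ m)"
      using cb by (intro sum_mono) auto
    ultimately show ?thesis
      unfolding c[symmetric] by (auto elim!: B_mono simp: add.commute)
  qed
  have root: "B q b" if "B (q ^ (2 ^ n)) (b ^ (2 ^ n))" "0 \<le> b" for q b n
    using that
  proof (induction n)
    case (Suc n)
    have "B ((q ^ (2 ^ n))\<^sup>2 + 0\<^sup>2) ((b ^ (2 ^ n))\<^sup>2)"
      using Suc.prems by (simp add: power_mult[symmetric] mult.commute)
    then have "B (q ^ (2 ^ n)) (sqrt ((b ^ (2 ^ n))\<^sup>2))"
      by (rule B_square) simp
    then show ?case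
      using Suc by simp
  qed simp
  \<comment> \<open>Comparing with \<open>M + e/2\<close> instead of \<open>M\<close> keeps the
    ratio meaningful for \<open>M = 0\<close>.\<close>
  define r where "r = (M + e) / (M + e/2)"
  have r: "1 < r" using \<open>0 < e\<close> M0 by (simp add: r_def)
  have "(\<lambda>m. (real (pdeg p) * real m + 1) * 2 / r ^ m) \<longlonglongrightarrow> 0"
    using r by real_asymp
  then have "\<forall>\<^sub>F m in sequentially. (real (pdeg p) * real m + 1) * 2 / r ^ m < 1"
    by (rule order_tendstoD) simp
  then obtain m0 where m0: "\<And>m. m0 \<le> m \<Longrightarrow> (real (pdeg p) * real m + 1) * 2 / r ^ m < 1"
    by (auto simp: eventually_sequentially)
  define m where "m = (2::nat) ^ m0"
  have "m0 \<le> m" by (simp add: m_def less_imp_le)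
  from m0[OF this] have "(real (pdeg p * m) + 1) * 2 \<le> r ^ m"
    using r by (simp add: field_simps)
  then have "(real (pdeg p * m) + 1) * 2 * M ^ m \<le> r ^ m * (M + e/2) ^ m"
    using \<open>0 < e\<close> M0 r by (intro mult_mono power_mono) auto
  also have "\<dots> = (M + e) ^ m"
    using \<open>0 < e\<close> M0 by (simp add: r_def power_mult_distrib[symmetric])
  finally have "B (p ^ m) ((M + e) ^ m)"
    using B_mono[OF crude[of m], of "(M + e) ^ m"] by (simp add: mult.assoc[symmetric])
  then show "B p (M + e)"
    using root[of p m0 "M + e"] \<open>0 < e\<close> M0 by (simp add: m_def)
qed

end

text \<open>Substituting X/R into every polynomial gives another instance of the locale, in which X
  has the bound 1. The unit case is applied there to p(R X), which the substitution turns back into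
  p.\<close>

lemma (in uniform_bound) B_poly:
  assumes R: "0 < R" and X: "B [:0, 1:] R" and M: "\<And>t. \<bar>t\<bar> \<le> R \<Longrightarrow> \<bar>poly p t\<bar> \<le> M"
  shows "B p M"
proof -
  let ?s = "\<lambda>p. pcompose p [:0, 1 / R:]"
  interpret S: uniform_bound "\<lambda>p. B (?s p)"
  proof
    fix p q :: "real poly" and b c a :: real
    show "B (?s p) b \<Longrightarrow> b \<le> c \<Longrightarrow> B (?s p) c" by (rule B_mono)
    show "(\<And>e. 0 < e \<Longrightarrow> B (?s p) (b + e)) \<Longrightarrow> B (?s p) b" by (rule B_closed)
    show "B (?s 1) 1" using B_one by (simp add: pcompose_1)
    show "B (?s p) b \<Longrightarrow> B (?s q) c \<Longrightarrow> B (?s (p + q)) (b + c)"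
      by (simp add: pcompose_add B_add)
    show "B (?s p) b \<Longrightarrow> B (?s (psmult a p)) (\<bar>a\<bar> * b)"
      by (simp add: pcompose_smult B_smult)
    show "B (?s p) b \<Longrightarrow> B (?s q) c \<Longrightarrow> 0 \<le> b \<Longrightarrow> 0 \<le> c \<Longrightarrow> B (?s (p * q)) (b * c)"
      by (simp add: pcompose_mult B_mult)
    show "B (?s (p\<^sup>2 + q\<^sup>2)) b \<Longrightarrow> 0 \<le> b \<Longrightarrow> B (?s p) (sqrt b)"
      by (rule B_square[of _ "?s q"]) (simp_all add: pcompose_add power2_eq_square pcompose_mult)
  qed
  have "B (psmult (1 / R) [:0, 1:]) (\<bar>1 / R\<bar> * R)"
    by (intro B_smult X)
  then have "B (?s [:0, 1:]) 1"
    using R by (simp add: pcompose_pCons)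
  then have "B (?s (pcompose p [:0, R:])) M"
  proof (rule S.B_poly_unit)
    fix t :: real assume "\<bar>t\<bar> \<le> 1"
    then show "\<bar>poly (pcompose p [:0, R:]) t\<bar> \<le> M"
      using R by (auto simp: poly_pcompose abs_mult mult_left_le_one_le intro!: M)
  qed
  moreover have "?s (pcompose p [:0, R:]) = p"
    using R by (simp add: pcompose_assoc[symmetric] pcompose_pCons)
  ultimately show ?thesis by simp
qed

section \<open>Calculations in C*-algebras\<close>

lemma complex_ring_simps [simp]:
  "c \<in> carrier complex_ring" "add complex_ring = (+)" "mult complex_ring = (*)"
  "one complex_ring = 1" "zero complex_ring = 0"
  by (simp_all add: ring_of_type_algebra_def fun_eq_iff)

context pre_cstar_algebra
begin

declare m_closed [simp] star_closed [simp] star_star [simp]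

lemma smult_add_left: "x \<in> carrier A \<Longrightarrow> (a + b) \<odot> x = a \<odot> x \<oplus> b \<odot> x"
  using smult_l_distr[of a b x] by simp

lemma smult_add_right: "\<lbrakk>x \<in> carrier A; y \<in> carrier A\<rbrakk> \<Longrightarrow> c \<odot> (x \<oplus> y) = c \<odot> x \<oplus> c \<odot> y"
  using smult_r_distr[of c x y] by simp

lemma smult_smult [simp]: "x \<in> carrier A \<Longrightarrow> a \<odot> (b \<odot> x) = (a * b) \<odot> x"
  using smult_assoc1[of a b x] by simp

lemma smult_1 [simp]: "x \<in> carrier A \<Longrightarrow> 1 \<odot> x = x"
  using smult_one[of x] by simp

lemma smult_0 [simp]: "x \<in> carrier A \<Longrightarrow> 0 \<odot> x = \<zero>"
  using smult_l_null[of x] by simp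

lemma smult_zero [simp]: "c \<odot> \<zero> = \<zero>"
  using smult_r_null[of c] by simp

lemma smult_minus_one: "x \<in> carrier A \<Longrightarrow> (- 1) \<odot> x = \<ominus> x"
  by (rule M.minus_equality[symmetric]) (use smult_add_left[of x "- 1" 1] in simp_all)

lemma minus_zero [simp]: "\<ominus> \<zero> = \<zero>"
  using smult_minus_one[of \<zero>] by simp

lemma smult_minus_right: "x \<in> carrier A \<Longrightarrow> c \<odot> (\<ominus> x) = \<ominus> (c \<odot> x)"
  by (simp flip: smult_minus_one add: mult.commute)

lemma smult_minus_left: "x \<in> carrier A \<Longrightarrow> (- c) \<odot> x = \<ominus> (c \<odot> x)"
  by (simp flip: smult_minus_one)

lemma smult_diff_right: "\<lbrakk>x \<in> carrier A; y \<in> carrier A\<rbrakk> \<Longrightarrow> c \<odot> (x \<ominus> y) = c \<odot> x \<ominus> c \<odot> y"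
  by (simp add: a_minus_def smult_add_right smult_minus_right)

lemma mult_zero_right [simp]: "x \<in> carrier A \<Longrightarrow> x \<otimes> \<zero> = \<zero>"
  using smult_m_right[of x \<zero> 0] by simp

lemma mult_zero_left [simp]: "x \<in> carrier A \<Longrightarrow> \<zero> \<otimes> x = \<zero>"
  using smult_m_left[of \<zero> x 0] by simp

lemma mult_minus_right: "\<lbrakk>x \<in> carrier A; y \<in> carrier A\<rbrakk> \<Longrightarrow> x \<otimes> (\<ominus> y) = \<ominus> (x \<otimes> y)"
  by (simp flip: smult_minus_one add: smult_m_right)

lemma mult_minus_left: "\<lbrakk>x \<in> carrier A; y \<in> carrier A\<rbrakk> \<Longrightarrow> (\<ominus> x) \<otimes> y = \<ominus> (x \<otimes> y)"
  by (simp flip: smult_minus_one add: smult_m_left)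

lemma mult_diff_right: "\<lbrakk>x \<in> carrier A; y \<in> carrier A; z \<in> carrier A\<rbrakk>
    \<Longrightarrow> x \<otimes> (y \<ominus> z) = x \<otimes> y \<ominus> x \<otimes> z"
  by (simp add: a_minus_def r_distr mult_minus_right)

lemma mult_diff_left: "\<lbrakk>x \<in> carrier A; y \<in> carrier A; z \<in> carrier A\<rbrakk>
    \<Longrightarrow> (x \<ominus> y) \<otimes> z = x \<otimes> z \<ominus> y \<otimes> z"
  by (simp add: a_minus_def l_distr mult_minus_left)

lemma star_zero [simp]: "star A \<zero> = \<zero>"
  using star_smult[of \<zero> 0] by simp

lemma star_minus: "x \<in> carrier A \<Longrightarrow> star A (\<ominus> x) = \<ominus> (star A x)"
  by (simp flip: smult_minus_one add: star_smult)

lemma star_diff: "\<lbrakk>x \<in> carrier A; y \<in> carrier A\<rbrakk> \<Longrightarrow> star A (x \<ominus> y) = star A x \<ominus> star A y"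
  by (simp add: a_minus_def star_add star_minus)

lemma nrm_zero [simp]: "nrm A \<zero> = 0"
  by (simp add: nrm_eq_0)

lemma nrm_minus [simp]: "x \<in> carrier A \<Longrightarrow> nrm A (\<ominus> x) = nrm A x"
  by (simp flip: smult_minus_one add: nrm_smult)

lemma diff_eq_zero_iff [simp]: "\<lbrakk>x \<in> carrier A; y \<in> carrier A\<rbrakk> \<Longrightarrow> x \<ominus> y = \<zero> \<longleftrightarrow> x = y"
  using M.minus_equality[of x "\<ominus> y"] by (auto simp: a_minus_def M.r_neg)

lemma minus_diff: "\<lbrakk>x \<in> carrier A; y \<in> carrier A\<rbrakk> \<Longrightarrow> \<ominus> (x \<ominus> y) = y \<ominus> x"
  by (simp add: a_minus_def M.minus_add M.a_comm)

lemma nrm_diff_commute: "\<lbrakk>x \<in> carrier A; y \<in> carrier A\<rbrakk> \<Longrightarrow> nrm A (x \<ominus> y) = nrm A (y \<ominus> x)"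
  by (metis M.minus_closed minus_diff nrm_minus)

lemma diff_add_diff: "\<lbrakk>x \<in> carrier A; y \<in> carrier A; z \<in> carrier A\<rbrakk> \<Longrightarrow> (x \<ominus> y) \<oplus> (y \<ominus> z) = x \<ominus> z"
  by (simp add: a_minus_def M.a_assoc M.r_neg1)

lemma add_diff_add: "\<lbrakk>x \<in> carrier A; y \<in> carrier A; z \<in> carrier A; w \<in> carrier A\<rbrakk>
    \<Longrightarrow> (x \<oplus> y) \<ominus> (z \<oplus> w) = (x \<ominus> z) \<oplus> (y \<ominus> w)"
  by (simp add: a_minus_def M.minus_add M.a_ac)

lemma diff_add_cancel [simp]: "\<lbrakk>x \<in> carrier A; y \<in> carrier A\<rbrakk> \<Longrightarrow> (x \<ominus> y) \<oplus> y = x"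
  by (simp add: a_minus_def M.a_assoc M.l_neg)

lemma add_diff_cancel [simp]: "\<lbrakk>x \<in> carrier A; y \<in> carrier A\<rbrakk> \<Longrightarrow> (x \<oplus> y) \<ominus> y = x"
  by (simp add: a_minus_def M.a_assoc M.r_neg)

lemma diff_zero [simp]: "x \<in> carrier A \<Longrightarrow> x \<ominus> \<zero> = x"
  by (simp add: a_minus_def)

lemma diff_self [simp]: "x \<in> carrier A \<Longrightarrow> x \<ominus> x = \<zero>"
  by simp

lemma add_diff_cancel_left [simp]:
  "\<lbrakk>x \<in> carrier A; y \<in> carrier A\<rbrakk> \<Longrightarrow> (x \<oplus> y) \<ominus> x = y"
  using add_diff_cancel[of y x] by (simp add: M.a_comm)

lemma diff_diff_cancel: "\<lbrakk>x \<in> carrier A; y \<in> carrier A\<rbrakk> \<Longrightarrow> x \<ominus> (x \<ominus> y) = y"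
  by (simp add: a_minus_def M.minus_add M.a_assoc[symmetric] M.r_neg)

lemma nrm_triangle_diff: "\<lbrakk>x \<in> carrier A; y \<in> carrier A; z \<in> carrier A\<rbrakk>
    \<Longrightarrow> nrm A (x \<ominus> z) \<le> nrm A (x \<ominus> y) + nrm A (y \<ominus> z)"
  using nrm_triangle[of "x \<ominus> y" "y \<ominus> z"] by (simp add: diff_add_diff)

lemma nrm_diff_le: "\<lbrakk>x \<in> carrier A; y \<in> carrier A\<rbrakk> \<Longrightarrow> nrm A (x \<ominus> y) \<le> nrm A x + nrm A y"
  using nrm_triangle[of x "\<ominus> y"] by (simp add: a_minus_def)

lemma nrm_le_diff_add: "\<lbrakk>x \<in> carrier A; y \<in> carrier A\<rbrakk> \<Longrightarrow> nrm A x \<le> nrm A (x \<ominus> y) + nrm A y"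
  using nrm_triangle[of "x \<ominus> y" y] by simp

lemma nrm_pos: "\<lbrakk>x \<in> carrier A; x \<noteq> \<zero>\<rbrakk> \<Longrightarrow> 0 < nrm A x"
  using nrm_nonneg[of x] nrm_eq_0[of x] by linarith

lemma nrm_star [simp]: "x \<in> carrier A \<Longrightarrow> nrm A (star A x) = nrm A x"
proof -
  have le: "nrm A x \<le> nrm A (star A x)" if "x \<in> carrier A" for x
  proof (cases "x = \<zero>")
    case False
    have "nrm A x * nrm A x \<le> nrm A (star A x) * nrm A x"
      using cstar_identity[of x] nrm_mult[of "star A x" x] that by (simp add: power2_eq_square)
    then show ?thesis
      using nrm_pos[of x] that False by simp
  qed simp
  show "x \<in> carrier A \<Longrightarrow> nrm A (star A x) = nrm A x"
    using le[of x] le[of "star A x"] by simp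
qed

lemma star_mult_self_eq_zero: "\<lbrakk>x \<in> carrier A; star A x \<otimes> x = \<zero>\<rbrakk> \<Longrightarrow> x = \<zero>"
  using cstar_identity[of x] nrm_eq_0[of x] by simp

lemma mult_star_self_eq_zero: "\<lbrakk>x \<in> carrier A; x \<otimes> star A x = \<zero>\<rbrakk> \<Longrightarrow> x = \<zero>"
  using star_mult_self_eq_zero[of "star A x"] star_star[of x] by simp

lemma eq_zero_if_nrm_less: "\<lbrakk>x \<in> carrier A; \<And>e. 0 < e \<Longrightarrow> nrm A x < e\<rbrakk> \<Longrightarrow> x = \<zero>"
  using nrm_pos[of x] by (metis less_irrefl)

text \<open>Testing with \<open>y = star A x\<close> and using the C*-identity gives the square of
  the norm on the left. The functional calculus only yields bounds on products; this lemma returns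
  them to the element itself.\<close>

lemma nrm_le_if_left_mult:
  assumes "x \<in> carrier A" "0 \<le> b" "\<And>y. y \<in> carrier A \<Longrightarrow> nrm A (x \<otimes> y) \<le> b * nrm A y"
  shows "nrm A x \<le> b"
proof (cases "x = \<zero>")
  case False
  have "nrm A x * nrm A x \<le> b * nrm A x"
    using assms(3)[of "star A x"] cstar_identity[of "star A x"] assms(1)
    by (simp add: power2_eq_square)
  then show ?thesis using nrm_pos[of x] False assms(1) by simp
qed (use assms in simp)

section \<open>Closed sets, closures and completeness in terms of the norm\<close>

lemma closedin_iff:
  "closedin (nrm_topology A) V \<longleftrightarrow>
    V \<subseteq> carrier A \<and> (\<forall>x\<in>carrier A. (\<forall>e>0. \<exists>v\<in>V. nrm A (x \<ominus> v) < e) \<longrightarrow> x \<in> V)"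
  (is "_ \<longleftrightarrow> ?S \<and> ?C")
proof -
  interpret MS: Metric_space "carrier A" "nrm_dist A" by (rule Metric_space_nrm_dist)
  have D: "disjnt V (MS.mball x r) \<longleftrightarrow> \<not> (\<exists>v\<in>V. nrm A (x \<ominus> v) < r)"
    if "V \<subseteq> carrier A" "x \<in> carrier A" for x r
    using that by (auto simp: disjnt_iff nrm_dist_def)
  have "(\<forall>x. x \<in> carrier A - V \<longrightarrow> (\<exists>r>0. disjnt V (MS.mball x r))) \<longleftrightarrow> ?C" if ?S
  proof -
    have "(\<exists>r>0. disjnt V (MS.mball x r)) \<longleftrightarrow> \<not> (\<forall>e>0. \<exists>v\<in>V. nrm A (x \<ominus> v) < e)"
      if "x \<in> carrier A" for x
      using D[OF \<open>?S\<close> that] by blast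
    then show ?thesis by blast
  qed
  then show ?thesis
    unfolding MS.closedin_metric by (rule conj_cong[OF refl])
qed

lemma closure_of_iff:
  "x \<in> nrm_topology A closure_of S \<longleftrightarrow>
    x \<in> carrier A \<and> (\<forall>e>0. \<exists>y\<in>S. y \<in> carrier A \<and> nrm A (x \<ominus> y) < e)"
proof -
  interpret MS: Metric_space "carrier A" "nrm_dist A" by (rule Metric_space_nrm_dist)
  show ?thesis
    unfolding MS.metric_closure_of by (auto simp: nrm_dist_def) 
qed

lemma mcomplete_iff:
  "Metric_space.mcomplete (carrier A) (nrm_dist A) \<longleftrightarrow>
    (\<forall>s :: nat \<Rightarrow> 'a. range s \<subseteq> carrier A \<and> (\<forall>e>0. \<exists>N. \<forall>m\<ge>N. \<forall>n\<ge>N. nrm A (s m \<ominus> s n) < e)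
      \<longrightarrow> (\<exists>x\<in>carrier A. \<forall>e>0. \<exists>N. \<forall>n\<ge>N. nrm A (s n \<ominus> x) < e))"
proof -
  interpret MS: Metric_space "carrier A" "nrm_dist A" by (rule Metric_space_nrm_dist)
  have C: "MS.MCauchy s \<longleftrightarrow>
      range s \<subseteq> carrier A \<and> (\<forall>e>0. \<exists>N. \<forall>m\<ge>N. \<forall>n\<ge>N. nrm A (s m \<ominus> s n) < e)" for s
    unfolding MS.MCauchy_def by (intro conj_cong refl) (auto simp: nrm_dist_def image_subset_iff)
  have L: "limitin MS.mtopology s x sequentially \<longleftrightarrow>
      x \<in> carrier A \<and> (\<forall>e>0. \<exists>N. \<forall>n\<ge>N. nrm A (s n \<ominus> x) < e)" if "range s \<subseteq> carrier A" for s x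
    unfolding MS.limit_metric_sequentially
    by (intro conj_cong refl) (use that in \<open>auto simp: nrm_dist_def image_subset_iff\<close>)
  show ?thesis
    unfolding MS.mcomplete_def C
  proof (rule arg_cong[where f = All], rule ext)
    fix s :: "nat \<Rightarrow> 'a"
    have "(\<exists>x. limitin MS.mtopology s x sequentially) \<longleftrightarrow>
        (\<exists>x\<in>carrier A. \<forall>e>0. \<exists>N. \<forall>n\<ge>N. nrm A (s n \<ominus> x) < e)" (is "?l \<longleftrightarrow> ?r") if "range s \<subseteq> carrier A"
      unfolding L[OF that] Bex_def ..
    then show "(range s \<subseteq> carrier A \<and> (\<forall>e>0. \<exists>N. \<forall>m\<ge>N. \<forall>n\<ge>N. nrm A (s m \<ominus> s n) < e) \<longrightarrow>
        (\<exists>x. limitin MS.mtopology s x sequentially)) \<longleftrightarrow>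
      (range s \<subseteq> carrier A \<and> (\<forall>e>0. \<exists>N. \<forall>m\<ge>N. \<forall>n\<ge>N. nrm A (s m \<ominus> s n) < e) \<longrightarrow>
        (\<exists>x\<in>carrier A. \<forall>e>0. \<exists>N. \<forall>n\<ge>N. nrm A (s n \<ominus> x) < e))"
      by blast
  qed
qed

lemma csubspace_iff:
  "csubspace V A \<longleftrightarrow> V \<subseteq> carrier A \<and> \<zero> \<in> V \<and> (\<forall>x\<in>V. \<forall>y\<in>V. x \<oplus> y \<in> V) \<and> (\<forall>c. \<forall>x\<in>V. c \<odot> x \<in> V)"
  (is "?L \<longleftrightarrow> ?R")
proof
  assume ?L
  then interpret submodule V complex_ring A .
  show ?R
    using subset one_closed m_closed smult_closed by auto
next
  assume R: ?R
  show ?L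
  proof (rule submoduleI)
    fix a assume "a \<in> V"
    then show "\<ominus> a \<in> V" using R smult_minus_one[of a] by (metis subsetD)
  qed (use R in auto)
qed

end

lemma (in cstar_algebra) Cauchy_converges:
  fixes s :: "nat \<Rightarrow> 'a"
  assumes "\<And>n. s n \<in> carrier A"
    and "\<And>e. 0 < e \<Longrightarrow> \<exists>N. \<forall>m\<ge>N. \<forall>n\<ge>N. nrm A (s m \<ominus> s n) < e"
  obtains x where "x \<in> carrier A" "\<And>e. 0 < e \<Longrightarrow> \<exists>N. \<forall>n\<ge>N. nrm A (s n \<ominus> x) < e"
proof -
  have "\<exists>x\<in>carrier A. \<forall>e>0. \<exists>N. \<forall>n\<ge>N. nrm A (s n \<ominus> x) < e"
    by (rule mp[OF spec[OF iffD1[OF mcomplete_iff complete]]]) (use assms in auto)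
  then obtain x where "x \<in> carrier A" and x: "\<forall>e>0. \<exists>N. \<forall>n\<ge>N. nrm A (s n \<ominus> x) < e"
    by (rule bexE)
  show ?thesis
    by (rule that[OF \<open>x \<in> carrier A\<close>]) (rule x[rule_format])
qed

section \<open>Continuous functional calculus\<close>

text \<open>The interval from -R to R stands in for the spectrum of \<open>x\<close>: functions are
  compared on all of it.\<close>

locale self_adjoint_elt = cstar_algebra A
  for A :: "('a, 'm) cstar_struct_scheme" (structure) +
  fixes x :: 'a and R :: real
  assumes x_closed [simp]: "x \<in> carrier A"
    and x_star: "star A x = x"
    and R_pos: "0 < R"
    and x_nrm: "nrm A x \<le> R"
begin

text \<open>Horner evaluation of p(x) y. Acting on an element gives the constant coefficient a
  meaning without a unit.\<close>

definition pact :: "real poly \<Rightarrow> 'a \<Rightarrow> 'a"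
  where "pact p y = fold_coeffs (\<lambda>a z. complex_of_real a \<odot> y \<oplus> x \<otimes> z) p \<zero>"

lemma pact_0 [simp]: "pact 0 y = \<zero>"
  by (simp add: pact_def)

lemma pact_pCons: "y \<in> carrier A \<Longrightarrow> pact (pCons a p) y = complex_of_real a \<odot> y \<oplus> x \<otimes> pact p y"
  by (cases "a = 0 \<and> p = 0") (auto simp: pact_def)

lemma pact_closed [simp]: "y \<in> carrier A \<Longrightarrow> pact p y \<in> carrier A"
  by (induction p) (auto simp: pact_pCons)

lemma pact_1 [simp]: "y \<in> carrier A \<Longrightarrow> pact 1 y = y"
  by (simp add: one_pCons pact_pCons)

lemma pact_X: "y \<in> carrier A \<Longrightarrow> pact [:0, 1:] y = x \<otimes> y"
  by (simp add: pact_pCons)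

lemma pact_add: "y \<in> carrier A \<Longrightarrow> pact (p + q) y = pact p y \<oplus> pact q y"
  by (induction p q rule: poly_induct2)
     (auto simp: pact_pCons smult_add_left r_distr M.a_ac)

lemma pact_smult: "y \<in> carrier A \<Longrightarrow> pact (psmult c p) y = complex_of_real c \<odot> pact p y"
  by (induction p) (auto simp: pact_pCons smult_add_right smult_m_right)

lemma pact_diff: "y \<in> carrier A \<Longrightarrow> pact (p - q) y = pact p y \<ominus> pact q y"
  using pact_add[of y p "psmult (- 1) q"] pact_smult[of y "- 1" q]
  by (simp add: smult_minus_one a_minus_def)

lemma pact_mult: "y \<in> carrier A \<Longrightarrow> pact (p * q) y = pact p (pact q y)"
  by (induction p) (auto simp: pact_pCons pact_add pact_smult)

lemma pact_add_arg: "\<lbrakk>y \<in> carrier A; z \<in> carrier A\<rbrakk> \<Longrightarrow> pact p (y \<oplus> z) = pact p y \<oplus> pact p z"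
  by (induction p) (auto simp: pact_pCons smult_add_right r_distr M.a_ac)

lemma pact_minus_arg: "y \<in> carrier A \<Longrightarrow> pact p (\<ominus> y) = \<ominus> pact p y"
  by (induction p) (auto simp: pact_pCons smult_minus_right mult_minus_right M.minus_add)

lemma pact_diff_arg: "\<lbrakk>y \<in> carrier A; z \<in> carrier A\<rbrakk> \<Longrightarrow> pact p (y \<ominus> z) = pact p y \<ominus> pact p z"
  by (simp add: a_minus_def pact_add_arg pact_minus_arg)

lemma pact_mult_arg: "\<lbrakk>y \<in> carrier A; z \<in> carrier A\<rbrakk> \<Longrightarrow> pact p (y \<otimes> z) = pact p y \<otimes> z"
  by (induction p) (auto simp: pact_pCons smult_m_left l_distr m_assoc)

lemma pact_commute:
  assumes "c \<in> carrier A" "x \<otimes> c = c \<otimes> x" "z \<in> carrier A"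
  shows "pact p (c \<otimes> z) = c \<otimes> pact p z"
proof (induction p)
  case (pCons a p)
  have "x \<otimes> (c \<otimes> pact p z) = c \<otimes> (x \<otimes> pact p z)"
    using assms by (simp flip: m_assoc)
  then show ?case
    using assms pCons by (simp add: pact_pCons r_distr smult_m_right)
qed (use assms in simp)

text \<open>Real coefficients and a self-adjoint \<open>x\<close> make p(x) a self-adjoint operator,
  which is expressed here by moving it across a product.\<close>

lemma pact_star:
  assumes "y \<in> carrier A" "z \<in> carrier A"
  shows "star A (pact p y) \<otimes> z = star A y \<otimes> pact p z"
  using assms(2)
proof (induction p arbitrary: z)
  case (pCons a p)
  have "star A (x \<otimes> pact p y) \<otimes> z = star A (pact p y) \<otimes> (x \<otimes> z)"
    using assms pCons.prems by (simp add: star_mult x_star m_assoc)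
  also have "\<dots> = star A y \<otimes> (x \<otimes> pact p z)"
    using assms pCons by (simp add: pact_commute)
  finally show ?case
    using assms pCons.prems
    by (simp add: pact_pCons star_add star_smult l_distr r_distr smult_m_left smult_m_right)
qed (use assms in simp)

lemma pact_in_subspace:
  assumes "csubspace V A" "y \<in> V" "\<And>v. v \<in> V \<Longrightarrow> x \<otimes> v \<in> V"
  shows "pact p y \<in> V"
proof -
  have "y \<in> carrier A" using assms by (auto simp: csubspace_iff)
  then show ?thesis
    by (induction p) (use assms in \<open>auto simp: csubspace_iff pact_pCons\<close>)
qed

text \<open>For c equal to i or -i the cross terms cancel in the star-square of the combination,
  which leaves \<open>star A y\<close> times (p^2 + q^2)(x) y. The C*-identity then accounts for the
  square root.\<close>

lemma nrm_pact_combination: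
  assumes "y \<in> carrier A" and b: "nrm A (pact (p\<^sup>2 + q\<^sup>2) y) \<le> b * nrm A y" "0 \<le> b"
    and c: "c = \<i> \<or> c = - \<i>"
  shows "nrm A (pact p y \<oplus> c \<odot> pact q y) \<le> sqrt b * nrm A y"
proof -
  let ?P = "pact p y" and ?Q = "pact q y"
  have C [simp]: "?P \<in> carrier A" "?Q \<in> carrier A" "y \<in> carrier A" using assms by auto
  have 1: "star A ?P \<otimes> ?Q = star A ?Q \<otimes> ?P"
    by (simp add: pact_star flip: pact_mult) (simp add: mult.commute)
  have 2: "c \<odot> (star A ?P \<otimes> ?Q) \<oplus> cnj c \<odot> (star A ?P \<otimes> ?Q) = \<zero>"
    using c by (subst smult_add_left[symmetric]) auto
  have 3: "c * cnj c = 1" using c by auto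
  have "star A (?P \<oplus> c \<odot> ?Q) \<otimes> (?P \<oplus> c \<odot> ?Q) =
      star A ?P \<otimes> ?P \<oplus> (c \<odot> (star A ?P \<otimes> ?Q) \<oplus> cnj c \<odot> (star A ?Q \<otimes> ?P)) \<oplus> star A ?Q \<otimes> ?Q"
    by (simp add: star_add star_smult l_distr r_distr smult_m_left smult_m_right smult_add_right 3 M.a_ac)
  also have "\<dots> = star A ?P \<otimes> ?P \<oplus> star A ?Q \<otimes> ?Q"
    using 1 2 by simp
  also have "\<dots> = star A y \<otimes> pact (p\<^sup>2 + q\<^sup>2) y"
    by (simp add: pact_star pact_add r_distr power2_eq_square flip: pact_mult)
  finally have "(nrm A (?P \<oplus> c \<odot> ?Q))\<^sup>2 = nrm A (star A y \<otimes> pact (p\<^sup>2 + q\<^sup>2) y)"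
    by (simp flip: cstar_identity)
  also have "\<dots> \<le> nrm A y * (b * nrm A y)"
    using nrm_mult[of "star A y" "pact (p\<^sup>2 + q\<^sup>2) y"] mult_left_mono[OF b(1) nrm_nonneg[of y]] by simp
  also have "\<dots> = (sqrt b * nrm A y)\<^sup>2"
    using b by (simp add: power_mult_distrib power2_eq_square)
  finally show ?thesis
    by (rule power2_le_imp_le) (use b nrm_nonneg[of y] in simp)
qed

text \<open>\<open>b\<close> bounds the operator norm of multiplication by p(x). In this reading the
  rule for the polynomial 1 holds in an algebra without unit.\<close>

lemma uniform_bound_pact: "uniform_bound (\<lambda>p b. \<forall>y\<in>carrier A. nrm A (pact p y) \<le> b * nrm A y)"
proof
  fix p q :: "real poly" and a b c :: real
  assume "b \<le> c" "\<forall>y\<in>carrier A. nrm A (pact p y) \<le> b * nrm A y"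
  then show "\<forall>y\<in>carrier A. nrm A (pact p y) \<le> c * nrm A y"
    by (meson mult_right_mono nrm_nonneg order_trans)
next
  fix p b
  assume le: "\<And>e. 0 < e \<Longrightarrow> \<forall>y\<in>carrier A. nrm A (pact p y) \<le> (b + e) * nrm A y"
  show "\<forall>y\<in>carrier A. nrm A (pact p y) \<le> b * nrm A y"
  proof
    fix y assume y: "y \<in> carrier A"
    show "nrm A (pact p y) \<le> b * nrm A y"
    proof (rule field_le_epsilon)
      fix e :: real assume "0 < e"
      then have "0 < e / (nrm A y + 1)" "e / (nrm A y + 1) * nrm A y \<le> e"
        using nrm_nonneg[OF y] by (auto simp: field_simps)
      then show "nrm A (pact p y) \<le> b * nrm A y + e"
        using le[of "e / (nrm A y + 1)"] y by (force simp: distrib_right)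
    qed
  qed
next
  show "\<forall>y\<in>carrier A. nrm A (pact 1 y) \<le> 1 * nrm A y" by simp
next
  fix p q b c
  assume "\<forall>y\<in>carrier A. nrm A (pact p y) \<le> b * nrm A y" "\<forall>y\<in>carrier A. nrm A (pact q y) \<le> c * nrm A y"
  then show "\<forall>y\<in>carrier A. nrm A (pact (p + q) y) \<le> (b + c) * nrm A y"
    by (simp add: pact_add distrib_right) (meson add_mono nrm_triangle order_trans pact_closed)
next
  fix p a b
  assume "\<forall>y\<in>carrier A. nrm A (pact p y) \<le> b * nrm A y"
  then show "\<forall>y\<in>carrier A. nrm A (pact (psmult a p) y) \<le> \<bar>a\<bar> * b * nrm A y"
    by (simp add: pact_smult nrm_smult mult.assoc mult_left_mono)
next
  fix p q b c
  assume *: "\<forall>y\<in>carrier A. nrm A (pact p y) \<le> b * nrm A y"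
    "\<forall>y\<in>carrier A. nrm A (pact q y) \<le> c * nrm A y" "0 \<le> b" "0 \<le> c"
  show "\<forall>y\<in>carrier A. nrm A (pact (p * q) y) \<le> b * c * nrm A y"
  proof
    fix y assume y: "y \<in> carrier A"
    have "nrm A (pact (p * q) y) \<le> b * nrm A (pact q y)"
      using * y by (simp add: pact_mult)
    also have "\<dots> \<le> b * (c * nrm A y)"
      using * y by (intro mult_left_mono) auto
    finally show "nrm A (pact (p * q) y) \<le> b * c * nrm A y" by simp
  qed
next
  fix p q b
  assume *: "\<forall>y\<in>carrier A. nrm A (pact (p\<^sup>2 + q\<^sup>2) y) \<le> b * nrm A y" "0 \<le> b"
  show "\<forall>y\<in>carrier A. nrm A (pact p y) \<le> sqrt b * nrm A y"
  proof
    fix y assume y: "y \<in> carrier A"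
    \<comment> \<open>The sum of the two combinations is twice p(x) y, so their bounds pass to it.
      This replaces the order argument p^2 \<le> p^2 + q^2.\<close>
    let ?u = "pact p y \<oplus> \<i> \<odot> pact q y" and ?v = "pact p y \<oplus> (- \<i>) \<odot> pact q y"
    have "?u \<oplus> ?v = (pact p y \<oplus> pact p y) \<oplus> (\<i> \<odot> pact q y \<oplus> (- \<i>) \<odot> pact q y)"
      using y by (simp add: M.a_ac)
    also have "\<dots> = 2 \<odot> pact p y"
      using y smult_add_left[of "pact p y" 1 1] smult_add_left[of "pact q y" \<i> "- \<i>"] by simp
    finally have "2 * nrm A (pact p y) = nrm A (?u \<oplus> ?v)"
      using y by (simp add: nrm_smult)
    also have "\<dots> \<le> nrm A ?u + nrm A ?v"
      using y by (intro nrm_triangle) auto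
    also have "\<dots> \<le> sqrt b * nrm A y + sqrt b * nrm A y"
      using * y by (intro add_mono nrm_pact_combination) auto
    finally show "nrm A (pact p y) \<le> sqrt b * nrm A y" by simp
  qed
qed

lemma nrm_pact_le:
  assumes "\<And>t. \<bar>t\<bar> \<le> R \<Longrightarrow> \<bar>poly p t\<bar> \<le> b" "y \<in> carrier A"
  shows "nrm A (pact p y) \<le> b * nrm A y"
proof -
  interpret uniform_bound "\<lambda>p b. \<forall>y\<in>carrier A. nrm A (pact p y) \<le> b * nrm A y"
    by (rule uniform_bound_pact)
  have "nrm A (pact [:0, 1:] y) \<le> R * nrm A y" if "y \<in> carrier A" for y
    using nrm_mult[of x y] mult_right_mono[OF x_nrm nrm_nonneg[OF that]] that by (simp add: pact_X)
  then show ?thesis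
    using B_poly[OF R_pos _ assms(1)] assms(2) by blast
qed

lemma poly_approx:
  assumes "continuous_on {-R..R} f" "0 < e"
  shows "\<exists>p. \<forall>t. \<bar>t\<bar> \<le> R \<longrightarrow> \<bar>poly p t - f t\<bar> \<le> e"
proof -
  obtain g where g: "real_polynomial_function g" "\<And>t. t \<in> {-R..R} \<Longrightarrow> \<bar>f t - g t\<bar> < e"
    using Stone_Weierstrass_real_polynomial_function[OF _ assms] by blast
  then obtain a n where "g = (\<lambda>t. \<Sum>i\<le>n. a i * t ^ i)"
    unfolding real_polynomial_function_iff_sum by blast
  then have eq: "poly (\<Sum>i\<le>n. Polynomial.monom (a i) i) t = g t" for t
    by (simp add: poly_sum poly_monom)
  show ?thesis
  proof (intro exI allI impI)
    fix t assume "\<bar>t\<bar> \<le> R"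
    then have "\<bar>f t - g t\<bar> < e" by (intro g(2)) auto
    then show "\<bar>poly (\<Sum>i\<le>n. Polynomial.monom (a i) i) t - f t\<bar> \<le> e"
      unfolding eq by linarith
  qed
qed

text \<open>
  Instead of adjoining a unit, \<open>cfc f y\<close> is the product \<open>f(x) y\<close>; it makes sense in \<open>A\<close> even if
  \<open>f 0 \<noteq> 0\<close>.
\<close>

definition cfc :: "(real \<Rightarrow> real) \<Rightarrow> 'a \<Rightarrow> 'a"
  where "cfc f y = (SOME z. z \<in> carrier A \<and>
    (\<forall>p e. (\<forall>t. \<bar>t\<bar> \<le> R \<longrightarrow> \<bar>poly p t - f t\<bar> \<le> e) \<longrightarrow> nrm A (z \<ominus> pact p y) \<le> e * nrm A y))"

lemma nrm_pact_diff:
  assumes "\<And>t. \<bar>t\<bar> \<le> R \<Longrightarrow> \<bar>poly p t - f t\<bar> \<le> d" "\<And>t. \<bar>t\<bar> \<le> R \<Longrightarrow> \<bar>poly q t - f t\<bar> \<le> e"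
    and "y \<in> carrier A"
  shows "nrm A (pact p y \<ominus> pact q y) \<le> (d + e) * nrm A y"
proof -
  have "nrm A (pact (p - q) y) \<le> (d + e) * nrm A y"
    using assms(3)
  proof (rule nrm_pact_le[rotated])
    fix t assume "\<bar>t\<bar> \<le> R"
    from assms(1,2)[OF this] show "\<bar>poly (p - q) t\<bar> \<le> d + e" by simp
  qed
  then show ?thesis using assms(3) by (simp add: pact_diff)
qed

text \<open>Polynomials within 1/(n+1) of \<open>f\<close> give a Cauchy sequence, and the estimate
  for an arbitrary \<open>p\<close> passes through a late member of it. Quantifying over all
  \<open>p\<close> and \<open>e\<close> frees the description of the value from the chosen
  sequence.\<close>

lemma cfc_exists:
  assumes f: "continuous_on {-R..R} f" and y: "y \<in> carrier A"
  shows "\<exists>z. z \<in> carrier A \<and>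
    (\<forall>p e. (\<forall>t. \<bar>t\<bar> \<le> R \<longrightarrow> \<bar>poly p t - f t\<bar> \<le> e) \<longrightarrow> nrm A (z \<ominus> pact p y) \<le> e * nrm A y)"
proof -
  define r where "r n = 1 / real (Suc n)" for n
  obtain P where P: "\<And>n t. \<bar>t\<bar> \<le> R \<Longrightarrow> \<bar>poly (P n) t - f t\<bar> \<le> r n"
  proof -
    have "\<forall>n. \<exists>p. \<forall>t. \<bar>t\<bar> \<le> R \<longrightarrow> \<bar>poly p t - f t\<bar> \<le> r n"
      using poly_approx[OF f] by (simp add: r_def)
    from choice[OF this] show ?thesis using that by blast
  qed
  have r: "\<exists>N. \<forall>n\<ge>N. r n * nrm A y < e" if "0 < e" for e
  proof -
    have "(\<lambda>n. r n * nrm A y) \<longlonglongrightarrow> 0 * nrm A y"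
      unfolding r_def by (intro tendsto_intros LIMSEQ_Suc[OF lim_1_over_n])
    from order_tendstoD(2)[OF this, of e] that show ?thesis
      by (auto simp: eventually_sequentially)
  qed
  have PP: "nrm A (pact (P m) y \<ominus> pact (P n) y) \<le> (r m + r n) * nrm A y" for m n
    by (rule nrm_pact_diff[OF P P y])
  obtain z where z: "z \<in> carrier A" "\<And>e. 0 < e \<Longrightarrow> \<exists>N. \<forall>n\<ge>N. nrm A (pact (P n) y \<ominus> z) < e"
  proof (rule Cauchy_converges[of "\<lambda>n. pact (P n) y"])
    fix e :: real assume "0 < e"
    then obtain N where N: "\<And>n. n \<ge> N \<Longrightarrow> r n * nrm A y < e / 2"
      using r[of "e / 2"] by auto
    show "\<exists>N. \<forall>m\<ge>N. \<forall>n\<ge>N. nrm A (pact (P m) y \<ominus> pact (P n) y) < e"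
    proof (intro exI[of _ N] allI impI)
      fix m n assume "N \<le> m" "N \<le> n"
      with N[of m] N[of n] have "(r m + r n) * nrm A y < e"
        unfolding distrib_right by linarith
      with PP[of m n] show "nrm A (pact (P m) y \<ominus> pact (P n) y) < e"
        by linarith
    qed
  qed (use y in auto)
  show ?thesis
  proof (intro exI[of _ z] conjI allI impI)
    fix p e assume p: "\<forall>t. \<bar>t\<bar> \<le> R \<longrightarrow> \<bar>poly p t - f t\<bar> \<le> e"
    show "nrm A (z \<ominus> pact p y) \<le> e * nrm A y"
    proof (rule field_le_epsilon)
      fix d :: real assume "0 < d"
      then obtain N1 N2 where N: "\<And>n. n \<ge> N1 \<Longrightarrow> nrm A (pact (P n) y \<ominus> z) < d / 2"
        "\<And>n. n \<ge> N2 \<Longrightarrow> r n * nrm A y < d / 2"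
        using r[of "d/2"] z(2)[of "d/2"] by auto
      let ?n = "max N1 N2"
      have "nrm A (z \<ominus> pact p y) \<le> nrm A (z \<ominus> pact (P ?n) y) + nrm A (pact (P ?n) y \<ominus> pact p y)"
        using z y by (intro nrm_triangle_diff) auto
      moreover have "nrm A (pact (P ?n) y \<ominus> pact p y) \<le> (r ?n + e) * nrm A y"
        using p by (intro nrm_pact_diff[OF P _ y]) auto
      ultimately show "nrm A (z \<ominus> pact p y) \<le> e * nrm A y + d"
        using N(1)[of ?n] N(2)[of ?n] nrm_diff_commute[of z "pact (P ?n) y"] z y by (simp add: distrib_right)
    qed
  qed (rule z)
qed

lemma
  assumes "continuous_on {-R..R} f" "y \<in> carrier A"
  shows cfc_closed [simp]: "cfc f y \<in> carrier A"
    and cfc_approx: "(\<And>t. \<bar>t\<bar> \<le> R \<Longrightarrow> \<bar>poly p t - f t\<bar> \<le> e) \<Longrightarrow> nrm A (cfc f y \<ominus> pact p y) \<le> e * nrm A y"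
  using someI_ex[OF cfc_exists[OF assms]] unfolding cfc_def[symmetric] by auto

text \<open>Uniqueness principle for proving the rules of the calculus: one good polynomial for each
  accuracy determines the value. The constant \<open>C\<close> leaves room for errors that are not
  multiples of \<open>nrm A y\<close>.\<close>

lemma cfc_eqI:
  assumes f: "continuous_on {-R..R} f" and y: "y \<in> carrier A" and z: "z \<in> carrier A"
    and *: "\<And>e. 0 < e \<Longrightarrow> \<exists>p. (\<forall>t. \<bar>t\<bar> \<le> R \<longrightarrow> \<bar>poly p t - f t\<bar> \<le> e) \<and> nrm A (z \<ominus> pact p y) \<le> e * C"
  shows "cfc f y = z"
proof -
  have C: "0 \<le> C"
  proof -
    obtain p where "nrm A (z \<ominus> pact p y) \<le> 1 * C"
      using *[of 1] by auto
    with nrm_nonneg[of "z \<ominus> pact p y"] z y show ?thesis by simp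
  qed
  have "cfc f y \<ominus> z = \<zero>"
  proof (rule eq_zero_if_nrm_less)
    fix d :: real assume "0 < d"
    define e where "e = d / (nrm A y + C + 1)"
    have e: "0 < e" "e * (nrm A y + C) < d"
      using \<open>0 < d\<close> C nrm_nonneg[OF y] by (auto simp: e_def field_simps intro!: add_nonneg_pos)
    from *[OF e(1)] obtain p where p: "\<forall>t. \<bar>t\<bar> \<le> R \<longrightarrow> \<bar>poly p t - f t\<bar> \<le> e" "nrm A (z \<ominus> pact p y) \<le> e * C"
      by blast
    have "nrm A (cfc f y \<ominus> z) \<le> nrm A (cfc f y \<ominus> pact p y) + nrm A (pact p y \<ominus> z)"
      using f y z by (intro nrm_triangle_diff) auto
    also have "\<dots> \<le> e * nrm A y + e * C"
      using p z y by (intro add_mono cfc_approx f) (auto simp: nrm_diff_commute)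
    finally show "nrm A (cfc f y \<ominus> z) < d"
      using e by (simp add: distrib_left)
  qed (use f y z in auto)
  then show ?thesis using f y z by simp
qed

lemma cfc_poly: "y \<in> carrier A \<Longrightarrow> cfc (poly p) y = pact p y"
  by (rule cfc_eqI[where C = 0]) (auto intro!: continuous_intros exI[of _ p])

lemma cfc_cong: "(\<And>t. \<bar>t\<bar> \<le> R \<Longrightarrow> f t = g t) \<Longrightarrow> cfc f y = cfc g y"
  unfolding cfc_def by (simp cong: imp_cong)

lemma cfc_one: "y \<in> carrier A \<Longrightarrow> (\<And>t. \<bar>t\<bar> \<le> R \<Longrightarrow> f t = 1) \<Longrightarrow> cfc f y = y"
  using cfc_poly[of y 1] cfc_cong[of f "poly 1"] by simp

lemma cfc_zero: "y \<in> carrier A \<Longrightarrow> (\<And>t. \<bar>t\<bar> \<le> R \<Longrightarrow> f t = 0) \<Longrightarrow> cfc f y = \<zero>"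
  using cfc_poly[of y 0] cfc_cong[of f "poly 0"] by simp

lemma cfc_id: "y \<in> carrier A \<Longrightarrow> cfc (\<lambda>t. t) y = x \<otimes> y"
  using cfc_poly[of y "[:0, 1:]"] cfc_cong[of "\<lambda>t. t" "poly [:0, 1:]"] by (simp add: pact_X)

lemma cfc_const: "y \<in> carrier A \<Longrightarrow> cfc (\<lambda>t. c) y = complex_of_real c \<odot> y"
  using cfc_poly[of y "[:c:]"] cfc_cong[of "\<lambda>t. c" "poly [:c:]"] by (simp add: pact_pCons)

lemma nrm_cfc_le:
  assumes f: "continuous_on {-R..R} f" and b: "\<And>t. \<bar>t\<bar> \<le> R \<Longrightarrow> \<bar>f t\<bar> \<le> b" and y: "y \<in> carrier A"
  shows "nrm A (cfc f y) \<le> b * nrm A y"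
proof (rule field_le_epsilon)
  fix d :: real assume "0 < d"
  define e where "e = d / (2 * (nrm A y + 1))"
  have e: "0 < e" "2 * e * nrm A y \<le> d"
    using \<open>0 < d\<close> nrm_nonneg[OF y] by (auto simp: e_def field_simps)
  from poly_approx[OF f e(1)] obtain p where p: "\<And>t. \<bar>t\<bar> \<le> R \<Longrightarrow> \<bar>poly p t - f t\<bar> \<le> e"
    by blast
  have pb: "\<bar>poly p t\<bar> \<le> b + e" if "\<bar>t\<bar> \<le> R" for t
    using p[OF that] b[OF that] by linarith
  have "nrm A (cfc f y) \<le> nrm A (cfc f y \<ominus> pact p y) + nrm A (pact p y)"
    using f y by (intro nrm_le_diff_add) auto
  also have "\<dots> \<le> e * nrm A y + (b + e) * nrm A y"
    by (intro add_mono cfc_approx nrm_pact_le f p pb y)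
  finally show "nrm A (cfc f y) \<le> b * nrm A y + d"
    using e by (simp add: algebra_simps)
qed

lemma cfc_add:
  assumes f: "continuous_on {-R..R} f" and g: "continuous_on {-R..R} g" and y: "y \<in> carrier A"
  shows "cfc (\<lambda>t. f t + g t) y = cfc f y \<oplus> cfc g y"
proof (rule cfc_eqI[where C = "nrm A y"])
  fix e :: real assume "0 < e"
  then have e: "0 < e / 2" by simp
  from poly_approx[OF f e] poly_approx[OF g e] obtain p q
    where p: "\<And>t. \<bar>t\<bar> \<le> R \<Longrightarrow> \<bar>poly p t - f t\<bar> \<le> e / 2"
      and q: "\<And>t. \<bar>t\<bar> \<le> R \<Longrightarrow> \<bar>poly q t - g t\<bar> \<le> e / 2"
    by blast
  have "\<bar>poly (p + q) t - (f t + g t)\<bar> \<le> e" if "\<bar>t\<bar> \<le> R" for t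
    using p[OF that] q[OF that] unfolding poly_add by linarith
  moreover have "nrm A (cfc f y \<oplus> cfc g y \<ominus> pact (p + q) y) \<le> e * nrm A y"
  proof -
    have "cfc f y \<oplus> cfc g y \<ominus> pact (p + q) y = (cfc f y \<ominus> pact p y) \<oplus> (cfc g y \<ominus> pact q y)"
      using f g y by (simp add: pact_add add_diff_add)
    then have "nrm A (cfc f y \<oplus> cfc g y \<ominus> pact (p + q) y) \<le> nrm A (cfc f y \<ominus> pact p y) + nrm A (cfc g y \<ominus> pact q y)"
      using f g y by (simp add: nrm_triangle)
    also have "\<dots> \<le> e / 2 * nrm A y + e / 2 * nrm A y"
      by (intro add_mono cfc_approx f g p q y)
    finally show ?thesis by simp
  qed
  ultimately show "\<exists>p. (\<forall>t. \<bar>t\<bar> \<le> R \<longrightarrow> \<bar>poly p t - (f t + g t)\<bar> \<le> e) \<and>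
      nrm A (cfc f y \<oplus> cfc g y \<ominus> pact p y) \<le> e * nrm A y"
    by blast
qed (use f g y in \<open>auto intro: continuous_intros\<close>)

lemma cfc_mult:
  assumes f: "continuous_on {-R..R} f" and g: "continuous_on {-R..R} g" and y: "y \<in> carrier A"
  shows "cfc (\<lambda>t. f t * g t) y = cfc f (cfc g y)"
proof -
  have bdd: "\<exists>b\<ge>0. \<forall>t. \<bar>t\<bar> \<le> R \<longrightarrow> \<bar>h t\<bar> \<le> b" if "continuous_on {-R..R} h" for h :: "real \<Rightarrow> real"
  proof -
    have "bounded (h ` {-R..R})"
      by (intro compact_imp_bounded compact_continuous_image that) simp
    then obtain b where "\<forall>z\<in>h ` {-R..R}. norm z \<le> b"
      unfolding bounded_iff by blast
    then have b: "\<forall>t\<in>{-R..R}. \<bar>h t\<bar> \<le> b"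
      unfolding real_norm_def by blast
    have "\<bar>h t\<bar> \<le> max b 0" if "\<bar>t\<bar> \<le> R" for t
    proof -
      have "t \<in> {-R..R}" using that by auto
      then show ?thesis using b by fastforce
    qed
    then show ?thesis
      by (intro exI[of _ "max b 0"]) simp
  qed
  obtain bf bg where bf: "0 \<le> bf" "\<And>t. \<bar>t\<bar> \<le> R \<Longrightarrow> \<bar>f t\<bar> \<le> bf"
    and bg: "0 \<le> bg" "\<And>t. \<bar>t\<bar> \<le> R \<Longrightarrow> \<bar>g t\<bar> \<le> bg"
    using bdd[OF f] bdd[OF g] by blast
  let ?Y = "cfc g y"
  have Y: "?Y \<in> carrier A" using g y by simp
  show ?thesis
  proof (rule cfc_eqI[where C = "nrm A ?Y + (bf + 1) * nrm A y"])
    fix e :: real assume "0 < e"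
    \<comment> \<open>\<open>d \<le> 1\<close> bounds the polynomial \<open>p\<close> by
      \<open>bf + 1\<close>; the error of p q against f g is then at most
      \<open>(bf + 1) * d + d * bg\<close>.\<close>
    define d where "d = min 1 (e / (bf + bg + 1))"
    have K: "0 < bf + bg + 1" using bf bg by simp
    have "d \<le> e / (bf + bg + 1)" by (simp add: d_def)
    then have "d * (bf + bg + 1) \<le> e"
      using K by (simp only: pos_le_divide_eq)
    moreover have "0 < d" "d \<le> 1"
      using \<open>0 < e\<close> K by (auto simp: d_def)
    ultimately have d: "0 < d" "d \<le> 1" "d * (bf + bg + 1) \<le> e"
      by auto
    have "d * 1 \<le> d * (bf + bg + 1)"
      using d bf bg by (intro mult_left_mono) auto
    then have de: "d \<le> e" using d by linarith
    from poly_approx[OF f d(1)] poly_approx[OF g d(1)] obtain p q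
      where p: "\<And>t. \<bar>t\<bar> \<le> R \<Longrightarrow> \<bar>poly p t - f t\<bar> \<le> d"
        and q: "\<And>t. \<bar>t\<bar> \<le> R \<Longrightarrow> \<bar>poly q t - g t\<bar> \<le> d"
      by blast
    have pb: "\<bar>poly p t\<bar> \<le> bf + 1" if "\<bar>t\<bar> \<le> R" for t
      using p[OF that] bf(2)[OF that] d by linarith
    have "\<bar>poly (p * q) t - f t * g t\<bar> \<le> e" if "\<bar>t\<bar> \<le> R" for t
    proof -
      have "poly (p * q) t - f t * g t = poly p t * (poly q t - g t) + (poly p t - f t) * g t"
        by (simp add: algebra_simps)
      also have "\<bar>\<dots>\<bar> \<le> \<bar>poly p t\<bar> * \<bar>poly q t - g t\<bar> + \<bar>poly p t - f t\<bar> * \<bar>g t\<bar>"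
        by (metis abs_mult abs_triangle_ineq)
      also have "\<dots> \<le> (bf + 1) * d + d * bg"
        using bf d by (intro add_mono mult_mono pb p q bg that) auto
      finally show ?thesis using d by (simp add: algebra_simps)
    qed
    moreover have "nrm A (cfc f ?Y \<ominus> pact (p * q) y) \<le> e * (nrm A ?Y + (bf + 1) * nrm A y)"
    proof -
      have "nrm A (cfc f ?Y \<ominus> pact p (pact q y))
          \<le> nrm A (cfc f ?Y \<ominus> pact p ?Y) + nrm A (pact p ?Y \<ominus> pact p (pact q y))"
        using f g y by (intro nrm_triangle_diff) auto
      also have "pact p ?Y \<ominus> pact p (pact q y) = pact p (?Y \<ominus> pact q y)"
        using y Y by (simp add: pact_diff_arg)
      also have "nrm A (cfc f ?Y \<ominus> pact p ?Y) + nrm A (pact p (?Y \<ominus> pact q y))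
          \<le> d * nrm A ?Y + (bf + 1) * (d * nrm A y)"
        using y Y bf
        by (intro add_mono cfc_approx f p order_trans[OF nrm_pact_le[OF pb]] mult_left_mono g q) auto
      also have "\<dots> = d * (nrm A ?Y + (bf + 1) * nrm A y)"
        by (simp add: algebra_simps)
      also have "\<dots> \<le> e * (nrm A ?Y + (bf + 1) * nrm A y)"
        using bf nrm_nonneg[OF y] nrm_nonneg[OF Y] de by (intro mult_right_mono) auto
      finally show ?thesis using y by (simp add: pact_mult)
    qed
    ultimately show "\<exists>p. (\<forall>t. \<bar>t\<bar> \<le> R \<longrightarrow> \<bar>poly p t - f t * g t\<bar> \<le> e) \<and>
        nrm A (cfc f ?Y \<ominus> pact p y) \<le> e * (nrm A ?Y + (bf + 1) * nrm A y)"
      by blast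
  qed (use f g y in \<open>auto intro: continuous_intros\<close>)
qed

text \<open>What commutes with the polynomials in \<open>x\<close> commutes with their limits, as
  long as it is bounded and respects differences. The instances are right multiplication and left
  multiplication by an element commuting with \<open>x\<close>.\<close>

lemma cfc_intertwine:
  assumes f: "continuous_on {-R..R} f" and y: "y \<in> carrier A"
    and T: "\<And>u. u \<in> carrier A \<Longrightarrow> T u \<in> carrier A"
      "\<And>u v. \<lbrakk>u \<in> carrier A; v \<in> carrier A\<rbrakk> \<Longrightarrow> T (u \<ominus> v) = T u \<ominus> T v"
      "\<And>u. u \<in> carrier A \<Longrightarrow> nrm A (T u) \<le> C * nrm A u" "0 \<le> C"
    and Tp: "\<And>p. pact p (T y) = T (pact p y)"
  shows "cfc f (T y) = T (cfc f y)"
proof (rule cfc_eqI[where C = "C * nrm A y"])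
  fix e :: real assume "0 < e"
  from poly_approx[OF f this] obtain p where p: "\<And>t. \<bar>t\<bar> \<le> R \<Longrightarrow> \<bar>poly p t - f t\<bar> \<le> e"
    by blast
  have "nrm A (T (cfc f y) \<ominus> pact p (T y)) = nrm A (T (cfc f y \<ominus> pact p y))"
    using f y by (simp add: Tp T)
  also have "\<dots> \<le> C * nrm A (cfc f y \<ominus> pact p y)"
    using f y by (intro T) simp
  also have "\<dots> \<le> C * (e * nrm A y)"
    by (intro mult_left_mono cfc_approx f p y T)
  finally show "\<exists>p. (\<forall>t. \<bar>t\<bar> \<le> R \<longrightarrow> \<bar>poly p t - f t\<bar> \<le> e) \<and>
      nrm A (T (cfc f y) \<ominus> pact p (T y)) \<le> e * (C * nrm A y)"
    using p by (auto simp: mult_ac)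
qed (use f y T in auto)

lemma cfc_mult_arg:
  assumes "continuous_on {-R..R} f" "y \<in> carrier A" "z \<in> carrier A"
  shows "cfc f (y \<otimes> z) = cfc f y \<otimes> z"
  by (rule cfc_intertwine[where T = "\<lambda>y. y \<otimes> z" and C = "nrm A z"])
     (use assms nrm_mult[of _ z] in \<open>simp_all add: pact_mult_arg mult_diff_left nrm_nonneg mult.commute\<close>)

lemma cfc_commute:
  assumes "continuous_on {-R..R} f" "c \<in> carrier A" "x \<otimes> c = c \<otimes> x" "z \<in> carrier A"
  shows "cfc f (c \<otimes> z) = c \<otimes> cfc f z"
  by (rule cfc_intertwine[where T = "\<lambda>y. c \<otimes> y" and C = "nrm A c"])
     (use assms in \<open>simp_all add: pact_commute mult_diff_right nrm_nonneg nrm_mult\<close>)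

lemma cfc_zero_arg: "continuous_on {-R..R} f \<Longrightarrow> cfc f \<zero> = \<zero>"
  using cfc_mult_arg[of f \<zero> \<zero>] by simp

lemma cfc_diff_arg:
  assumes f: "continuous_on {-R..R} f" and y: "y \<in> carrier A" and z: "z \<in> carrier A"
  shows "cfc f (y \<ominus> z) = cfc f y \<ominus> cfc f z"
proof (rule cfc_eqI[where C = "nrm A y + nrm A z"])
  fix e :: real assume "0 < e"
  from poly_approx[OF f this] obtain p where p: "\<And>t. \<bar>t\<bar> \<le> R \<Longrightarrow> \<bar>poly p t - f t\<bar> \<le> e"
    by blast
  have "(cfc f y \<ominus> cfc f z) \<ominus> pact p (y \<ominus> z) = (cfc f y \<ominus> pact p y) \<ominus> (cfc f z \<ominus> pact p z)"
    using f y z by (simp add: pact_add_arg pact_minus_arg a_minus_def M.minus_add M.a_ac)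
  then have "nrm A ((cfc f y \<ominus> cfc f z) \<ominus> pact p (y \<ominus> z))
      \<le> nrm A (cfc f y \<ominus> pact p y) + nrm A (cfc f z \<ominus> pact p z)"
    using f y z by (simp add: nrm_diff_le)
  also have "\<dots> \<le> e * nrm A y + e * nrm A z"
    by (intro add_mono cfc_approx f p y z)
  finally show "\<exists>p. (\<forall>t. \<bar>t\<bar> \<le> R \<longrightarrow> \<bar>poly p t - f t\<bar> \<le> e) \<and>
      nrm A ((cfc f y \<ominus> cfc f z) \<ominus> pact p (y \<ominus> z)) \<le> e * (nrm A y + nrm A z)"
    using p by (auto simp: distrib_left)
qed (use f y z in auto)

text \<open>As \<open>f\<close> is real, f(x) is a self-adjoint operator. Both sides contain a value
  of \<open>cfc\<close>; one polynomial approximates the two values, and for it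
  \<open>pact_star\<close> holds.\<close>

lemma cfc_star:
  assumes f: "continuous_on {-R..R} f" and y: "y \<in> carrier A" and z: "z \<in> carrier A"
  shows "star A (cfc f y) \<otimes> z = star A y \<otimes> cfc f z"
proof -
  have "star A (cfc f y) \<otimes> z \<ominus> star A y \<otimes> cfc f z = \<zero>"
  proof (rule eq_zero_if_nrm_less)
    fix d :: real assume "0 < d"
    define e where "e = d / (2 * (nrm A y * nrm A z + 1))"
    have yz: "0 \<le> nrm A y * nrm A z" using y z by (simp add: nrm_nonneg)
    then have e: "0 < e" "2 * (e * (nrm A y * nrm A z)) < d"
      using \<open>0 < d\<close> by (auto simp: e_def field_simps intro!: add_nonneg_pos)
    from poly_approx[OF f e(1)] obtain p where p: "\<And>t. \<bar>t\<bar> \<le> R \<Longrightarrow> \<bar>poly p t - f t\<bar> \<le> e"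
      by blast
    have "star A (cfc f y) \<otimes> z \<ominus> star A y \<otimes> cfc f z =
      (star A (cfc f y) \<otimes> z \<ominus> star A (pact p y) \<otimes> z) \<oplus> (star A y \<otimes> pact p z \<ominus> star A y \<otimes> cfc f z)"
      using f y z by (simp add: pact_star diff_add_diff)
    also have "\<dots> = star A (cfc f y \<ominus> pact p y) \<otimes> z \<oplus> star A y \<otimes> (pact p z \<ominus> cfc f z)"
      using f y z by (simp add: mult_diff_left mult_diff_right star_diff)
    finally have "nrm A (star A (cfc f y) \<otimes> z \<ominus> star A y \<otimes> cfc f z) =
      nrm A (star A (cfc f y \<ominus> pact p y) \<otimes> z \<oplus> star A y \<otimes> (pact p z \<ominus> cfc f z))"
      by (rule arg_cong)
    also have "\<dots> \<le> nrm A (star A (cfc f y \<ominus> pact p y) \<otimes> z) + nrm A (star A y \<otimes> (pact p z \<ominus> cfc f z))"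
      using f y z by (intro nrm_triangle) auto
    also have "\<dots> \<le> nrm A (cfc f y \<ominus> pact p y) * nrm A z + nrm A y * nrm A (cfc f z \<ominus> pact p z)"
    proof (rule add_mono)
      show "nrm A (star A (cfc f y \<ominus> pact p y) \<otimes> z) \<le> nrm A (cfc f y \<ominus> pact p y) * nrm A z"
        using f y z nrm_mult[of "star A (cfc f y \<ominus> pact p y)" z] by simp
      have "nrm A (pact p z \<ominus> cfc f z) = nrm A (cfc f z \<ominus> pact p z)"
        using f z by (intro nrm_diff_commute) auto
      then show "nrm A (star A y \<otimes> (pact p z \<ominus> cfc f z)) \<le> nrm A y * nrm A (cfc f z \<ominus> pact p z)"
        using f y z nrm_mult[of "star A y" "pact p z \<ominus> cfc f z"] by simp
    qed
    also have "\<dots> \<le> (e * nrm A y) * nrm A z + nrm A y * (e * nrm A z)"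
      by (intro add_mono mult_right_mono mult_left_mono cfc_approx f p y z nrm_nonneg)
    also have "\<dots> < d" using e by (simp add: mult_ac)
    finally show "nrm A (star A (cfc f y) \<otimes> z \<ominus> star A y \<otimes> cfc f z) < d" .
  qed (use f y z in auto)
  then show ?thesis using f y z by simp
qed

text \<open>Multiplication by \<open>x\<close> preserves \<open>V\<close>, and the constant term of
  a polynomial contributes a multiple of \<open>y\<close> itself, so a value f(0) other than 0 does
  no harm. Closedness covers the limit.\<close>

lemma cfc_in_closed_subspace:
  assumes f: "continuous_on {-R..R} f"
    and V: "csubspace V A" "closedin (nrm_topology A) V" "\<And>v. v \<in> V \<Longrightarrow> x \<otimes> v \<in> V" and y: "y \<in> V"
  shows "cfc f y \<in> V"
proof -
  have yA: "y \<in> carrier A" using V y by (auto simp: csubspace_iff)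
  have "\<exists>v\<in>V. nrm A (cfc f y \<ominus> v) < d" if "0 < d" for d
  proof -
    define e where "e = d / (nrm A y + 1)"
    have e: "0 < e" "e * nrm A y < d"
      using that nrm_nonneg[OF yA] by (auto simp: e_def field_simps)
    from poly_approx[OF f e(1)] obtain p where p: "\<And>t. \<bar>t\<bar> \<le> R \<Longrightarrow> \<bar>poly p t - f t\<bar> \<le> e"
      by blast
    show ?thesis
      using cfc_approx[OF f yA p] e(2) pact_in_subspace[OF V(1) y V(3), of p] by force
  qed
  then show ?thesis
    using V(2) f yA unfolding closedin_iff by simp
qed

end

context pre_cstar_algebra
begin

lemma
  assumes "csubspace V A"
  shows csubspace_closed: "x \<in> V \<Longrightarrow> x \<in> carrier A"
    and csubspace_zero: "\<zero> \<in> V"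
    and csubspace_add: "\<lbrakk>x \<in> V; y \<in> V\<rbrakk> \<Longrightarrow> x \<oplus> y \<in> V"
    and csubspace_smult: "x \<in> V \<Longrightarrow> c \<odot> x \<in> V"
    and csubspace_minus: "x \<in> V \<Longrightarrow> \<ominus> x \<in> V"
    and csubspace_diff: "\<lbrakk>x \<in> V; y \<in> V\<rbrakk> \<Longrightarrow> x \<ominus> y \<in> V"
proof -
  note V = assms[unfolded csubspace_iff]
  show c: "x \<in> carrier A" if "x \<in> V" for x using V that by blast
  show "\<zero> \<in> V" using V by blast
  show a: "x \<oplus> y \<in> V" if "x \<in> V" "y \<in> V" for x y using V that by blast
  show s: "c \<odot> x \<in> V" if "x \<in> V" for c x using V that by blast
  show m: "\<ominus> x \<in> V" if "x \<in> V" for x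
    using s[OF that, of "- 1"] smult_minus_one[OF c[OF that]] by simp
  show "x \<ominus> y \<in> V" if "x \<in> V" "y \<in> V" for x y
    unfolding a_minus_def by (intro a m that)
qed

lemma
  assumes "cstar_subalgebra D A"
  shows cstar_subalgebra_csubspace: "csubspace D A"
    and cstar_subalgebra_mult: "\<lbrakk>x \<in> D; y \<in> D\<rbrakk> \<Longrightarrow> x \<otimes> y \<in> D"
    and cstar_subalgebra_star: "x \<in> D \<Longrightarrow> star A x \<in> D"
    and cstar_subalgebra_closedin: "closedin (nrm_topology A) D"
  using assms by (auto simp: cstar_subalgebra_def)

lemma closedin_limit:
  "\<lbrakk>closedin (nrm_topology A) V; x \<in> carrier A; \<And>e. 0 < e \<Longrightarrow> \<exists>v\<in>V. nrm A (x \<ominus> v) < e\<rbrakk> \<Longrightarrow> x \<in> V"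
  unfolding closedin_iff by blast

end

text \<open>
  With \<open>r = \<parallel>h\<parallel>\<close> and \<open>k t = 1 / max t\<^sup>2 (r\<^sup>2/4)\<close> one takes \<open>w = k(h) h\<close> and
  \<open>g = f(h) h\<close> for \<open>f = 1 - r\<^sup>2 k / 4\<close>, since \<open>f\<close> vanishes where \<open>t\<^sup>2 k t \<noteq> 1\<close>.
\<close>

lemma (in cstar_algebra) local_unit:
  assumes D: "cstar_subalgebra D A" and h: "h \<in> D" "star A h = h" "h \<noteq> \<zero>"
  obtains w g where "w \<in> D" "g \<in> D" "nrm A (h \<otimes> w) \<le> 1" "h \<otimes> w \<otimes> g = g" "g \<noteq> \<zero>"
proof -
  have hA [simp]: "h \<in> carrier A"
    using D h by (auto intro: csubspace_closed cstar_subalgebra_csubspace)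
  define r where "r = nrm A h"
  have r: "0 < r" unfolding r_def using h by (simp add: nrm_pos)
  interpret h: self_adjoint_elt A h r
    by unfold_locales (use h r in \<open>auto simp: r_def\<close>)
  define k where "k t = inverse (max (t\<^sup>2) (r\<^sup>2 / 4))" for t
  define f where "f t = 1 - r\<^sup>2 / 4 * k t" for t
  have pos: "0 < max (t\<^sup>2) (r\<^sup>2 / 4)" for t
    using r by (simp add: less_max_iff_disj)
  have kc [simp, continuous_intros]: "continuous_on S k" for S
    unfolding k_def by (intro continuous_intros) (use pos in \<open>metis less_irrefl\<close>)
  have fc [simp, continuous_intros]: "continuous_on S f" for S
    unfolding f_def by (intro continuous_intros)
  have small: "r\<^sup>2 / 4 * k t = 1" if "\<bar>t\<bar> \<le> r / 2" for t
  proof -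
    have "t\<^sup>2 \<le> (r / 2)\<^sup>2" using that r by (simp add: power2_le_iff_abs_le)
    then have "max (t\<^sup>2) (r\<^sup>2 / 4) = r\<^sup>2 / 4" by (simp add: power_divide max_absorb2)
    then show ?thesis using r by (simp add: k_def)
  qed
  have large: "t\<^sup>2 * k t = 1" if "r / 2 < \<bar>t\<bar>" for t
  proof -
    have "(r / 2)\<^sup>2 \<le> t\<^sup>2" using that r by (simp add: abs_le_square_iff[symmetric])
    then have "max (t\<^sup>2) (r\<^sup>2 / 4) = t\<^sup>2" by (simp add: power_divide max_absorb1)
    then show ?thesis using that r by (auto simp: k_def)
  qed
  have "\<bar>t * inverse m * t\<bar> \<le> 1" if "t\<^sup>2 \<le> m" "0 < m" for m t :: real
    using that by (simp add: abs_mult power2_eq_square field_simps)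
  from this[OF max.cobounded1 pos] have le1: "\<bar>t * k t * t\<bar> \<le> 1" for t
    by (simp only: k_def)
  have tf: "t * k t * t * f t = f t" for t
  proof (cases "\<bar>t\<bar> \<le> r / 2")
    case True
    then show ?thesis using small by (simp add: f_def)
  next
    case False
    then have "t * k t * t = 1" using large[of t] by (simp add: power2_eq_square mult_ac)
    then show ?thesis by simp
  qed
  \<comment> \<open>Up to r/2 the left side is the absolute value of t; beyond r/2 it is r^2/4
    divided by that value.\<close>
  have half: "\<bar>r\<^sup>2 / 4 * k t * t\<bar> \<le> r / 2" for t
  proof (cases "\<bar>t\<bar> \<le> r / 2")
    case True
    then show ?thesis using small by simp
  next
    case False
    then have t: "r / 2 < \<bar>t\<bar>" by simp
    have t0: "0 < \<bar>t\<bar>" using t r by linarith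
    have eq: "r\<^sup>2 / 4 * k t * t = r\<^sup>2 / 4 / t"
      using large[OF t] t r by (auto simp: field_simps power2_eq_square)
    have "r * r \<le> r * (2 * \<bar>t\<bar>)"
      using t r by (intro mult_left_mono) auto
    then show ?thesis
      unfolding eq abs_divide using t0 r by (simp add: field_simps power2_eq_square)
  qed
  define w g where "w = h.cfc k h" and "g = h.cfc f h"
  have inD: "h.cfc F h \<in> D" if "continuous_on {-r..r} F" for F
    by (rule h.cfc_in_closed_subspace[OF that])
      (use D h in \<open>auto intro: cstar_subalgebra_csubspace cstar_subalgebra_closedin cstar_subalgebra_mult\<close>)
  have wD: "w \<in> D" and gD: "g \<in> D"
    unfolding w_def g_def by (intro inD continuous_intros)+
  have [simp]: "w \<in> carrier A" "g \<in> carrier A"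
    unfolding w_def g_def by (intro h.cfc_closed continuous_intros hA)+
  have hw: "(h \<otimes> w) \<otimes> y = h.cfc (\<lambda>t. t * k t * t) y" if "y \<in> carrier A" for y
  proof -
    have "h \<otimes> w = h.cfc (\<lambda>t. t * k t) h"
      unfolding w_def by (subst h.cfc_mult) (auto intro!: continuous_intros simp: h.cfc_id)
    then have "(h \<otimes> w) \<otimes> y = h.cfc (\<lambda>t. t * k t) (h.cfc (\<lambda>t. t) y)"
      using that by (simp add: h.cfc_id) (intro h.cfc_mult_arg[symmetric] continuous_intros that hA)
    then show ?thesis
      using that by (simp add: h.cfc_mult[symmetric] continuous_intros)
  qed
  have 1: "nrm A (h \<otimes> w) \<le> 1"
  proof (rule nrm_le_if_left_mult)
    fix y assume y: "y \<in> carrier A"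
    show "nrm A (h \<otimes> w \<otimes> y) \<le> 1 * nrm A y"
      unfolding hw[OF y] by (intro h.nrm_cfc_le le1 y continuous_intros)
  qed auto
  have "h \<otimes> w \<otimes> g = h.cfc (\<lambda>t. t * k t * t) (h.cfc f h)"
    using hw[of g] by (simp add: g_def)
  also have "\<dots> = h.cfc (\<lambda>t. t * k t * t * f t) h"
    by (intro h.cfc_mult[symmetric] continuous_intros hA)
  also have "\<dots> = g" by (simp add: tf g_def)
  finally have 2: "h \<otimes> w \<otimes> g = g" .
  \<comment> \<open>If \<open>g\<close> vanished, then \<open>h\<close> would equal (r^2/4) k(h) h,
    and by \<open>half\<close> its norm would be at most r/2.\<close>
  have 3: "g \<noteq> \<zero>"
  proof
    assume g0: "g = \<zero>"
    have "h = h.cfc (\<lambda>t. f t + r\<^sup>2 / 4 * k t) h"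
      by (rule h.cfc_one[symmetric]) (simp_all add: f_def)
    also have "\<dots> = g \<oplus> h.cfc (\<lambda>t. r\<^sup>2 / 4 * k t) h"
      unfolding g_def by (intro h.cfc_add continuous_intros hA)
    also have "\<dots> = h.cfc (\<lambda>t. r\<^sup>2 / 4 * k t) h"
      using g0 by (simp add: continuous_intros)
    finally have hh: "h = h.cfc (\<lambda>t. r\<^sup>2 / 4 * k t) h" .
    have "nrm A h \<le> r / 2"
    proof (rule nrm_le_if_left_mult)
      fix y assume y: "y \<in> carrier A"
      have "h \<otimes> y = h.cfc (\<lambda>t. r\<^sup>2 / 4 * k t) (h \<otimes> y)"
        by (subst (1) hh) (intro h.cfc_mult_arg[symmetric] continuous_intros hA y)
      also have "\<dots> = h.cfc (\<lambda>t. r\<^sup>2 / 4 * k t) (h.cfc (\<lambda>t. t) y)"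
        using y by (simp add: h.cfc_id)
      also have "\<dots> = h.cfc (\<lambda>t. r\<^sup>2 / 4 * k t * t) y"
        by (intro h.cfc_mult[symmetric] continuous_intros y)
      finally have eq: "h \<otimes> y = h.cfc (\<lambda>t. r\<^sup>2 / 4 * k t * t) y" .
      show "nrm A (h \<otimes> y) \<le> r / 2 * nrm A y"
        unfolding eq by (intro h.nrm_cfc_le half y continuous_intros)
    qed (use r in auto)
    then show False using r by (simp add: r_def)
  qed
  show ?thesis by (rule that[OF wD gD 1 2 3])
qed

section \<open>Quotients\<close>

text \<open>Self-adjointness of the ideal is a locale assumption; for a regular ideal it is supplied
  by \<open>annihilator_star\<close>.\<close>

locale star_ideal = cstar_algebra A
  for A :: "('a, 'm) cstar_struct_scheme" (structure) +
  fixes J :: "'a set"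
  assumes ideal: "cstar_ideal J A"
    and J_star: "x \<in> J \<Longrightarrow> star A x \<in> J"
begin

abbreviation "Q \<equiv> cstar_quotient A J"
abbreviation "q \<equiv> \<lambda>x. J +> x"

lemma J_csubspace: "csubspace J A"
  using ideal by (simp add: cstar_ideal_def)

lemmas J_closed [simp] = csubspace_closed[OF J_csubspace]
lemmas J_zero [simp] = csubspace_zero[OF J_csubspace]
lemmas J_add = csubspace_add[OF J_csubspace]
lemmas J_smult = csubspace_smult[OF J_csubspace]
lemmas J_minus = csubspace_minus[OF J_csubspace]
lemmas J_diff = csubspace_diff[OF J_csubspace]

lemma J_mult_left: "\<lbrakk>a \<in> carrier A; x \<in> J\<rbrakk> \<Longrightarrow> a \<otimes> x \<in> J"
  and J_mult_right: "\<lbrakk>a \<in> carrier A; x \<in> J\<rbrakk> \<Longrightarrow> x \<otimes> a \<in> J"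
  and J_closedin: "closedin (nrm_topology A) J"
  using ideal by (auto simp: cstar_ideal_def)

lemma mem_q: "x \<in> carrier A \<Longrightarrow> y \<in> q x \<longleftrightarrow> y \<in> carrier A \<and> y \<ominus> x \<in> J"
proof
  assume x: "x \<in> carrier A"
  show "y \<in> carrier A \<and> y \<ominus> x \<in> J" if "y \<in> q x"
    using that x by (auto simp: a_r_coset_def')
  show "y \<in> q x" if "y \<in> carrier A \<and> y \<ominus> x \<in> J"
    unfolding a_r_coset_def' using that x by (intro UN_I[of "y \<ominus> x"]) auto
qed

lemma q_self: "x \<in> carrier A \<Longrightarrow> x \<in> q x"
  by (simp add: mem_q)

lemma q_eq_iff: "\<lbrakk>x \<in> carrier A; y \<in> carrier A\<rbrakk> \<Longrightarrow> q x = q y \<longleftrightarrow> x \<ominus> y \<in> J"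
proof
  assume x: "x \<in> carrier A" and y: "y \<in> carrier A"
  show "x \<ominus> y \<in> J" if "q x = q y"
  proof -
    have "x \<in> q x" using x by (rule q_self)
    then show ?thesis using that x y by (simp add: mem_q)
  qed
  show "q x = q y" if xy: "x \<ominus> y \<in> J"
  proof (rule Set.set_eqI)
    fix z
    have "z \<ominus> x \<in> J \<longleftrightarrow> z \<ominus> y \<in> J" if z: "z \<in> carrier A"
    proof
      assume "z \<ominus> x \<in> J"
      from J_add[OF this xy] show "z \<ominus> y \<in> J" using x y z by (simp add: diff_add_diff)
    next
      assume "z \<ominus> y \<in> J"
      moreover have "y \<ominus> x \<in> J" using J_minus[OF xy] x y by (simp add: minus_diff)
      ultimately have "(z \<ominus> y) \<oplus> (y \<ominus> x) \<in> J" by (rule J_add)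
      then show "z \<ominus> x \<in> J" using x y z by (simp add: diff_add_diff)
    qed
    then show "z \<in> q x \<longleftrightarrow> z \<in> q y" using x y by (auto simp: mem_q)
  qed
qed

lemma q_eq_zero_iff: "x \<in> carrier A \<Longrightarrow> q x = q \<zero> \<longleftrightarrow> x \<in> J"
  by (simp add: q_eq_iff)

lemma q_zero: "q \<zero> = J"
  by (auto simp: mem_q)

text \<open>Operations on cosets are unions over representatives; independence of the representative
  makes such a union a single coset.\<close>

lemma UN_q:
  assumes x: "x \<in> carrier A" and *: "\<And>y. \<lbrakk>y \<in> carrier A; y \<ominus> x \<in> J\<rbrakk> \<Longrightarrow> F y = C"
  shows "(\<Union>y\<in>q x. F y) = C"
proof -
  have "x \<in> q x" using x by (rule q_self)
  moreover have "F y = C" if "y \<in> q x" for y using that x by (intro *) (simp_all add: mem_q)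
  ultimately show ?thesis by auto
qed

lemma Q_carrier: "carrier Q = q ` carrier A"
  by (auto simp: cstar_quotient_def FactRing_def A_RCOSETS_def')

lemma q_closed [simp]: "x \<in> carrier A \<Longrightarrow> q x \<in> carrier Q"
  by (simp add: Q_carrier)

lemma Q_E: "C \<in> carrier Q \<Longrightarrow> (\<And>x. x \<in> carrier A \<Longrightarrow> C = q x \<Longrightarrow> P) \<Longrightarrow> P"
  by (auto simp: Q_carrier)

lemma Q_zero: "\<zero>\<^bsub>Q\<^esub> = q \<zero>"
  by (simp add: cstar_quotient_def FactRing_def q_zero)

lemma q_add: 
  assumes x: "x \<in> carrier A" and y: "y \<in> carrier A"
  shows "q x \<oplus>\<^bsub>Q\<^esub> q y = q (x \<oplus> y)"
proof -
  have "q x <+> q y = q (x \<oplus> y)"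
  proof
    show "q x <+> q y \<subseteq> q (x \<oplus> y)"
      using x y by (auto simp: set_add_def' mem_q add_diff_add intro: J_add)
    show "q (x \<oplus> y) \<subseteq> q x <+> q y"
    proof
      fix z assume "z \<in> q (x \<oplus> y)"
      then have z: "z \<in> carrier A" "z \<ominus> (x \<oplus> y) \<in> J" using x y by (auto simp: mem_q)
      have "(z \<ominus> y) \<ominus> x = z \<ominus> (x \<oplus> y)"
        using x y z by (simp add: a_minus_def M.minus_add M.a_ac)
      then have "z \<ominus> y \<in> q x" "y \<in> q y" "z = (z \<ominus> y) \<oplus> y"
        using x y z by (simp_all add: mem_q)
      then show "z \<in> q x <+> q y" unfolding set_add_def' by blast
    qed
  qed
  then show ?thesis by (simp add: cstar_quotient_def FactRing_def)
qed

lemma q_mult: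
  assumes x: "x \<in> carrier A" and y: "y \<in> carrier A"
  shows "q x \<otimes>\<^bsub>Q\<^esub> q y = q (x \<otimes> y)"
proof -
  have "(\<Union>a\<in>q x. \<Union>b\<in>q y. q (a \<otimes> b)) = q (x \<otimes> y)"
  proof (intro UN_q x y)
    fix a b assume a: "a \<in> carrier A" "a \<ominus> x \<in> J" and b: "b \<in> carrier A" "b \<ominus> y \<in> J"
    have "a \<otimes> b \<ominus> x \<otimes> y = (a \<ominus> x) \<otimes> b \<oplus> x \<otimes> (b \<ominus> y)"
      using a b x y by (simp add: mult_diff_left mult_diff_right diff_add_diff)
    also have "\<dots> \<in> J" using a b x by (intro J_add J_mult_left J_mult_right)
    finally show "q (a \<otimes> b) = q (x \<otimes> y)" using a b x y by (simp add: q_eq_iff)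
  qed
  then show ?thesis by (simp add: cstar_quotient_def FactRing_def rcoset_mult_def)
qed

lemma q_smult:
  assumes x: "x \<in> carrier A"
  shows "c \<odot>\<^bsub>Q\<^esub> q x = q (c \<odot> x)"
proof -
  have "(\<Union>a\<in>q x. q (c \<odot> a)) = q (c \<odot> x)"
  proof (intro UN_q x)
    fix a assume a: "a \<in> carrier A" "a \<ominus> x \<in> J"
    then show "q (c \<odot> a) = q (c \<odot> x)"
      using J_smult[OF a(2), of c] x by (simp add: q_eq_iff smult_diff_right)
  qed
  then show ?thesis by (simp add: cstar_quotient_def)
qed

lemma q_star:
  assumes x: "x \<in> carrier A"
  shows "star Q (q x) = q (star A x)"
proof -
  have "(\<Union>a\<in>q x. q (star A a)) = q (star A x)"
  proof (intro UN_q x)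
    fix a assume a: "a \<in> carrier A" "a \<ominus> x \<in> J"
    then show "q (star A a) = q (star A x)"
      using J_star[OF a(2)] x by (simp add: q_eq_iff star_diff)
  qed
  then show ?thesis by (simp add: cstar_quotient_def)
qed

lemmas q_simps = q_add q_mult q_smult q_star

lemma abelian_group_Q: "abelian_group Q"
proof (rule abelian_groupI)
  show "\<zero>\<^bsub>Q\<^esub> \<in> carrier Q" by (simp add: Q_zero)
  show "x \<oplus>\<^bsub>Q\<^esub> y \<in> carrier Q" if "x \<in> carrier Q" "y \<in> carrier Q" for x y
    using that by (auto elim!: Q_E simp: q_simps)
  show "x \<oplus>\<^bsub>Q\<^esub> y \<oplus>\<^bsub>Q\<^esub> z = x \<oplus>\<^bsub>Q\<^esub> (y \<oplus>\<^bsub>Q\<^esub> z)"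
    if "x \<in> carrier Q" "y \<in> carrier Q" "z \<in> carrier Q" for x y z
    using that by (auto elim!: Q_E simp: q_simps M.a_assoc)
  show "x \<oplus>\<^bsub>Q\<^esub> y = y \<oplus>\<^bsub>Q\<^esub> x" if "x \<in> carrier Q" "y \<in> carrier Q" for x y
    using that by (auto elim!: Q_E simp: q_simps M.a_comm)
  show "\<zero>\<^bsub>Q\<^esub> \<oplus>\<^bsub>Q\<^esub> x = x" if "x \<in> carrier Q" for x
    using that by (auto elim!: Q_E simp: q_simps Q_zero)
  show "\<exists>y\<in>carrier Q. y \<oplus>\<^bsub>Q\<^esub> x = \<zero>\<^bsub>Q\<^esub>" if "x \<in> carrier Q" for x
  proof -
    from that obtain a where a: "a \<in> carrier A" "x = q a" by (rule Q_E)
    then have "q (\<ominus> a) \<oplus>\<^bsub>Q\<^esub> x = \<zero>\<^bsub>Q\<^esub>" by (simp add: q_simps Q_zero M.l_neg)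
    then show ?thesis using a by (intro bexI[of _ "q (\<ominus> a)"]) simp_all
  qed
qed

lemma module_Q: "module complex_ring Q"
proof (rule moduleI[OF cring_from_type_algebra abelian_group_Q])
  fix a b :: complex and x y assume "x \<in> carrier Q"
  then obtain u where u: "u \<in> carrier A" "x = q u" by (rule Q_E)
  show "a \<odot>\<^bsub>Q\<^esub> x \<in> carrier Q"
    "\<one>\<^bsub>complex_ring\<^esub> \<odot>\<^bsub>Q\<^esub> x = x"
    "(a \<otimes>\<^bsub>complex_ring\<^esub> b) \<odot>\<^bsub>Q\<^esub> x = a \<odot>\<^bsub>Q\<^esub> (b \<odot>\<^bsub>Q\<^esub> x)"
    "(a \<oplus>\<^bsub>complex_ring\<^esub> b) \<odot>\<^bsub>Q\<^esub> x = a \<odot>\<^bsub>Q\<^esub> x \<oplus>\<^bsub>Q\<^esub> b \<odot>\<^bsub>Q\<^esub> x"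
    using u by (auto simp: q_simps smult_add_left)
  assume "y \<in> carrier Q"
  then obtain v where "v \<in> carrier A" "y = q v" by (rule Q_E)
  then show "a \<odot>\<^bsub>Q\<^esub> (x \<oplus>\<^bsub>Q\<^esub> y) = a \<odot>\<^bsub>Q\<^esub> x \<oplus>\<^bsub>Q\<^esub> a \<odot>\<^bsub>Q\<^esub> y"
    using u by (auto simp: q_simps smult_add_right)
qed

lemma q_minus: "x \<in> carrier A \<Longrightarrow> \<ominus>\<^bsub>Q\<^esub> q x = q (\<ominus> x)"
proof -
  interpret Q: abelian_group Q by (rule abelian_group_Q)
  show "x \<in> carrier A \<Longrightarrow> \<ominus>\<^bsub>Q\<^esub> q x = q (\<ominus> x)"
    by (rule Q.minus_equality) (simp_all add: q_simps Q_zero M.l_neg)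
qed

lemma q_diff: "\<lbrakk>x \<in> carrier A; y \<in> carrier A\<rbrakk> \<Longrightarrow> q x \<ominus>\<^bsub>Q\<^esub> q y = q (x \<ominus> y)"
  by (simp add: a_minus_def q_minus q_add)

section \<open>The quotient norm\<close>

lemma nrm_Q: "nrm Q (q x) = (INF y\<in>q x. nrm A y)"
  by (simp add: cstar_quotient_def)

lemma bdd_below_nrm_q: "x \<in> carrier A \<Longrightarrow> bdd_below (nrm A ` q x)"
  by (rule bdd_belowI[of _ 0]) (auto simp: mem_q nrm_nonneg)

lemma nrm_q_le_mem: "\<lbrakk>x \<in> carrier A; y \<in> q x\<rbrakk> \<Longrightarrow> nrm Q (q x) \<le> nrm A y"
  unfolding nrm_Q by (intro cINF_lower bdd_below_nrm_q)

lemma nrm_q_le [simp]: "x \<in> carrier A \<Longrightarrow> nrm Q (q x) \<le> nrm A x"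
  by (rule nrm_q_le_mem) (simp_all add: mem_q)

lemma nrm_q_nonneg: "x \<in> carrier A \<Longrightarrow> 0 \<le> nrm Q (q x)"
  unfolding nrm_Q by (rule cINF_greatest) (auto simp: mem_q nrm_nonneg dest: q_self)

lemma nrm_q_approx:
  assumes x: "x \<in> carrier A" and e: "0 < e"
  obtains y where "y \<in> carrier A" "q y = q x" "nrm A y < nrm Q (q x) + e"
proof -
  have "nrm A ` q x \<noteq> {}" using q_self[OF x] by auto
  then obtain y where "y \<in> q x" "nrm A y < nrm Q (q x) + e"
    using cINF_less_iff[OF _ bdd_below_nrm_q[OF x], of "nrm Q (q x) + e"] e
    unfolding nrm_Q by auto
  then show ?thesis using x by (intro that) (auto simp: mem_q q_eq_iff)
qed

lemma nrm_q_star_le: "x \<in> carrier A \<Longrightarrow> nrm Q (q (star A x)) \<le> nrm Q (q x)"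
proof (rule field_le_epsilon)
  fix e :: real assume x: "x \<in> carrier A" and "0 < e"
  then obtain y where y: "y \<in> carrier A" "q y = q x" "nrm A y < nrm Q (q x) + e"
    by (rule nrm_q_approx)
  have "q (star A x) = q (star A y)" using x y by (simp flip: q_star)
  then show "nrm Q (q (star A x)) \<le> nrm Q (q x) + e"
    using nrm_q_le[of "star A y"] y by simp
qed

lemma nrm_q_mult_le:
  assumes x: "x \<in> carrier A" and y: "y \<in> carrier A"
  shows "nrm Q (q (x \<otimes> y)) \<le> nrm Q (q x) * nrm Q (q y)"
proof -
  let ?a = "nrm Q (q x)" and ?b = "nrm Q (q y)"
  have le: "nrm Q (q (x \<otimes> y)) \<le> (?a + e) * (?b + e)" if e: "0 < e" for e
  proof -
    obtain u where u: "u \<in> carrier A" "q u = q x" "nrm A u < ?a + e" using nrm_q_approx[OF x e] .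
    obtain v where v: "v \<in> carrier A" "q v = q y" "nrm A v < ?b + e" using nrm_q_approx[OF y e] .
    have "q (x \<otimes> y) = q (u \<otimes> v)" using x y u v by (simp flip: q_mult)
    then have "nrm Q (q (x \<otimes> y)) \<le> nrm A (u \<otimes> v)" using u v by simp
    also have "\<dots> \<le> nrm A u * nrm A v" using u v by (intro nrm_mult)
    also have "\<dots> \<le> (?a + e) * (?b + e)"
      using u v e nrm_q_nonneg[OF x] by (intro mult_mono) (auto simp: nrm_nonneg)
    finally show ?thesis .
  qed
  \<comment> \<open>The error is quadratic in \<open>e\<close>, so the bound is taken as a limit for
    \<open>e\<close> tending to 0 from the right.\<close>
  have "((\<lambda>e. (?a + e) * (?b + e)) \<longlongrightarrow> (?a + 0) * (?b + 0)) (at_right 0)"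
    by (intro tendsto_intros)
  moreover have "\<forall>\<^sub>F e in at_right 0. nrm Q (q (x \<otimes> y)) \<le> (?a + e) * (?b + e)"
    using le by (auto simp: eventually_at_right[of 0 1] intro!: exI[of _ 1])
  ultimately have "nrm Q (q (x \<otimes> y)) \<le> (?a + 0) * (?b + 0)"
    by (rule tendsto_lowerbound) simp
  then show ?thesis by simp
qed

lemma nrm_q_triangle:
  assumes x: "x \<in> carrier A" and y: "y \<in> carrier A"
  shows "nrm Q (q (x \<oplus> y)) \<le> nrm Q (q x) + nrm Q (q y)"
proof (rule field_le_epsilon)
  fix e :: real assume "0 < e"
  then have e: "0 < e / 2" by simp
  obtain u where u: "u \<in> carrier A" "q u = q x" "nrm A u < nrm Q (q x) + e / 2" using nrm_q_approx[OF x e] .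
  obtain v where v: "v \<in> carrier A" "q v = q y" "nrm A v < nrm Q (q y) + e / 2" using nrm_q_approx[OF y e] .
  have "q (x \<oplus> y) = q (u \<oplus> v)" using x y u v by (simp flip: q_add)
  then have "nrm Q (q (x \<oplus> y)) \<le> nrm A (u \<oplus> v)" using u v by simp
  also have "\<dots> \<le> nrm A u + nrm A v" using u v by (intro nrm_triangle)
  finally show "nrm Q (q (x \<oplus> y)) \<le> nrm Q (q x) + nrm Q (q y) + e" using u v by linarith
qed

lemma nrm_q_smult:
  assumes x: "x \<in> carrier A"
  shows "nrm Q (q (c \<odot> x)) = cmod c * nrm Q (q x)"
proof -
  have le: "nrm Q (q (c \<odot> x)) \<le> cmod c * nrm Q (q x)" if x: "x \<in> carrier A" for c x
  proof (rule field_le_epsilon)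
    fix e :: real assume "0 < e"
    have c1: "0 < cmod c + 1" by (simp add: add_nonneg_pos)
    then have "e * (cmod c / (cmod c + 1)) \<le> e * 1"
      using \<open>0 < e\<close> by (intro mult_left_mono) auto
    then have e: "0 < e / (cmod c + 1)" "cmod c * (e / (cmod c + 1)) \<le> e"
      using c1 \<open>0 < e\<close> by (simp_all add: mult.commute)
    obtain u where u: "u \<in> carrier A" "q u = q x" "nrm A u < nrm Q (q x) + e / (cmod c + 1)"
      using nrm_q_approx[OF x e(1)] .
    have "q (c \<odot> x) = q (c \<odot> u)" using x u by (simp flip: q_smult)
    then have "nrm Q (q (c \<odot> x)) \<le> nrm A (c \<odot> u)" using u by simp
    also have "\<dots> \<le> cmod c * (nrm Q (q x) + e / (cmod c + 1))"
      using u by (simp add: nrm_smult mult_left_mono)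
    finally show "nrm Q (q (c \<odot> x)) \<le> cmod c * nrm Q (q x) + e"
      using e by (simp add: distrib_left)
  qed
  show ?thesis
  proof (cases "c = 0")
    case True
    then show ?thesis using x nrm_q_le[of \<zero>] nrm_q_nonneg[of \<zero>] by simp
  next
    case False
    have "nrm Q (q x) \<le> cmod (1 / c) * nrm Q (q (c \<odot> x))"
      using le[of "c \<odot> x" "1 / c"] x False by simp
    then have "cmod c * nrm Q (q x) \<le> nrm Q (q (c \<odot> x))"
      using False by (simp add: norm_divide field_simps)
    then show ?thesis using le[OF x, of c] by simp
  qed
qed

text \<open>Closedness of \<open>J\<close> enters here: a representative \<open>y\<close> of small
  norm makes \<open>x \<ominus> y\<close> an element of \<open>J\<close> close to
  \<open>x\<close>.\<close>

lemma nrm_q_eq_0: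
  assumes x: "x \<in> carrier A"
  shows "nrm Q (q x) = 0 \<longleftrightarrow> x \<in> J"
proof
  assume "x \<in> J"
  then have "q x = q \<zero>" using x by (simp add: q_eq_zero_iff)
  then show "nrm Q (q x) = 0" using nrm_q_le[of \<zero>] nrm_q_nonneg[of \<zero>] by simp
next
  assume 0: "nrm Q (q x) = 0"
  show "x \<in> J"
  proof (rule closedin_limit[OF J_closedin x])
    fix e :: real assume "0 < e"
    then obtain y where y: "y \<in> carrier A" "q y = q x" "nrm A y < nrm Q (q x) + e"
      using nrm_q_approx[OF x] by blast
    have "x \<ominus> y \<in> J" using x y by (simp flip: q_eq_iff)
    moreover have "x \<ominus> (x \<ominus> y) = y" using x y by (simp add: a_minus_def M.minus_add M.r_neg1 M.a_assoc[symmetric] M.r_neg)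
    ultimately show "\<exists>v\<in>J. nrm A (x \<ominus> v) < e" using y 0 by (intro bexI[of _ "x \<ominus> y"]) auto
  qed
qed

text \<open>
  For self-adjoint \<open>j \<in> J\<close> the operators \<open>(1 - j\<^sup>2/r\<^sup>2)\<^sup>n\<close> with \<open>r = \<parallel>j\<parallel>\<close> take the place of
  \<open>1 - e\<close> for an approximate unit \<open>e\<close> of \<open>J\<close>: they are contractions, differ from \<open>1\<close> by elements of
  \<open>J\<close>, and annihilate \<open>j\<close> in the limit.
\<close>

lemma nrm_q_sq_le_self_adjoint:
  assumes x: "x \<in> carrier A" and j: "j \<in> J" "star A j = j"
  shows "(nrm Q (q x))\<^sup>2 \<le> nrm A (star A x \<otimes> x \<oplus> j)"
proof (cases "j = \<zero>")
  case True
  then show ?thesis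
    using x power_mono[OF nrm_q_le[OF x] nrm_q_nonneg[OF x]] by (simp add: cstar_identity)
next
  case False
  have jA [simp]: "j \<in> carrier A" using j by simp
  define r where "r = nrm A j"
  have r: "0 < r" using False by (simp add: r_def nrm_pos)
  interpret j: self_adjoint_elt A j r
    by unfold_locales (use j r in \<open>auto simp: r_def\<close>)
  show ?thesis
  proof (rule field_le_epsilon)
    fix e :: real assume e: "0 < e"
    define e' where "e' = min e r"
    have e': "0 < e'" "e' \<le> e" "e' \<le> r" using e r by (auto simp: e'_def)
    have "0 < e'\<^sup>2 / r\<^sup>2" using e' r by simp
    then have "1 - e'\<^sup>2 / r\<^sup>2 < 1" by linarith
    moreover have "0 < e / r" using e r by simp
    ultimately obtain n where n: "(1 - e'\<^sup>2 / r\<^sup>2) ^ n < e / r"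
      using real_arch_pow_inv by blast
    define s where "s t = 1 - t\<^sup>2 / r\<^sup>2" for t :: real
    define f where "f = (1 - psmult (1 / r\<^sup>2) ([:0, 1:]\<^sup>2)) ^ n"
    have pf: "poly f t = s t ^ n" for t
      by (simp add: f_def s_def poly_power power2_eq_square)
    have s: "0 \<le> s t" "s t \<le> 1" if "\<bar>t\<bar> \<le> r" for t
      using that r power_mono[OF that, of 2] by (auto simp: s_def field_simps)
    have f1: "\<bar>poly f t\<bar> \<le> 1" if "\<bar>t\<bar> \<le> r" for t
      unfolding pf using s[OF that] by (simp add: power_abs power_le_one)
    \<comment> \<open>Near 0 the factor t is small; away from 0 the choice of \<open>n\<close> makes
      the power of \<open>s t\<close> small.\<close>
    have f2: "\<bar>poly (f * [:0, 1:]) t\<bar> \<le> e" if t: "\<bar>t\<bar> \<le> r" for t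
    proof (cases "\<bar>t\<bar> \<le> e'")
      case True
      have "\<bar>poly f t\<bar> * \<bar>t\<bar> \<le> 1 * e'" using f1[OF t] True e' by (intro mult_mono) auto
      then show ?thesis using e' by (simp add: abs_mult mult.commute)
    next
      case False
      then have "e'\<^sup>2 \<le> t\<^sup>2" using e' power_mono[of e' "\<bar>t\<bar>" 2] by simp
      then have "s t \<le> 1 - e'\<^sup>2 / r\<^sup>2" using r by (simp add: s_def divide_right_mono)
      then have "s t ^ n \<le> e / r" using s[OF t] n power_mono[of "s t" "1 - e'\<^sup>2 / r\<^sup>2" n] by linarith
      then have "s t ^ n * \<bar>t\<bar> \<le> e / r * r"
        using s[OF t] t e r by (intro mult_mono) auto
      then show ?thesis using s[OF t] r by (simp add: abs_mult pf mult.commute)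
    qed
    \<comment> \<open>All terms of p(j) y but the constant one contain the factor \<open>j\<close>.
      Since f(0) = 1, applying f(j) does not change the coset.\<close>
    have inJ: "j.pact p y \<ominus> complex_of_real (poly p 0) \<odot> y \<in> J" if "y \<in> carrier A" for p y
    proof (cases p)
      case (pCons a p')
      have "j \<otimes> j.pact p' y \<in> J" using that j by (intro J_mult_right) auto
      then show ?thesis using that pCons by (simp add: j.pact_pCons)
    qed
    \<comment> \<open>\<open>?T\<close> acts from the left only, so the right product of
      \<open>x\<close> with f(j) is written as the star of \<open>?T ?y\<close>. Its star-square
      f(j) x* x f(j) then becomes \<open>?T (star A (?T ?z))\<close>.\<close>
    let ?T = "j.pact f" and ?y = "star A x" and ?z = "star A x \<otimes> x"
    have "?y \<otimes> star A (?T ?y) = star A (?T ?y \<otimes> x)"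
      using x by (simp add: star_mult)
    also have "\<dots> = star A (?T ?z)"
      using x by (simp add: j.pact_mult_arg)
    finally have "?y \<otimes> star A (?T ?y) = star A (?T ?z)" .
    then have eq: "star A (star A (?T ?y)) \<otimes> star A (?T ?y) = ?T (star A (?T ?z))"
      using x j.pact_mult_arg[of ?y "star A (?T ?y)" f] by simp
    have "?T ?y \<ominus> ?y \<in> J" using inJ[of ?y f] x by (simp add: pf s_def)
    then have "star A (?T ?y) \<ominus> x \<in> J" using J_star[of "?T ?y \<ominus> ?y"] x by (simp add: star_diff)
    then have "nrm Q (q x) \<le> nrm A (star A (?T ?y))"
      using x by (intro nrm_q_le_mem) (simp_all add: mem_q)
    then have "(nrm Q (q x))\<^sup>2 \<le> (nrm A (star A (?T ?y)))\<^sup>2"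
      using nrm_q_nonneg[OF x] by (rule power_mono)
    also have "\<dots> = nrm A (star A (star A (?T ?y)) \<otimes> star A (?T ?y))"
      using x by (intro cstar_identity[symmetric]) auto
    also have "\<dots> = nrm A (?T (star A (?T ?z)))"
      unfolding eq ..
    also have "\<dots> \<le> 1 * nrm A (star A (?T ?z))"
      using x by (intro j.nrm_pact_le f1) auto
    also have "\<dots> = nrm A (?T (?z \<oplus> j) \<ominus> ?T j)"
      using x by (simp add: j.pact_add_arg)
    also have "\<dots> \<le> nrm A (?T (?z \<oplus> j)) + nrm A (?T j)"
      using x by (intro nrm_diff_le) auto
    also have "\<dots> \<le> 1 * nrm A (?z \<oplus> j) + e"
    proof (rule add_mono)
      show "nrm A (?T (?z \<oplus> j)) \<le> 1 * nrm A (?z \<oplus> j)"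
        using x by (intro j.nrm_pact_le f1) auto
      show "nrm A (?T j) \<le> e"
      proof (rule nrm_le_if_left_mult)
        fix y assume y: "y \<in> carrier A"
        have "?T j \<otimes> y = j.pact (f * [:0, 1:]) y"
          using y by (simp only: j.pact_mult j.pact_X j.pact_mult_arg jA)
        then show "nrm A (?T j \<otimes> y) \<le> e * nrm A y"
          using j.nrm_pact_le[OF f2 y] by simp
      qed (use e in auto)
    qed
    finally show "(nrm Q (q x))\<^sup>2 \<le> nrm A (star A x \<otimes> x \<oplus> j) + e" by simp
  qed
qed

text \<open>As x* x is self-adjoint, replacing \<open>j\<close> by its self-adjoint part replaces
  the sum by its self-adjoint part, which does not increase the norm.\<close>

lemma nrm_q_sq_le:
  assumes x: "x \<in> carrier A" and j: "j \<in> J"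
  shows "(nrm Q (q x))\<^sup>2 \<le> nrm A (star A x \<otimes> x \<oplus> j)"
proof -
  let ?z = "star A x \<otimes> x"
  define k where "k = (1/2) \<odot> (j \<oplus> star A j)"
  have jA [simp]: "j \<in> carrier A" using j by simp
  have z: "?z \<in> carrier A" "star A ?z = ?z" using x by (simp_all add: star_mult)
  have "k \<in> J" unfolding k_def using j by (intro J_smult J_add J_star)
  moreover have "star A k = k" by (simp add: k_def star_smult star_add M.a_comm)
  ultimately have "(nrm Q (q x))\<^sup>2 \<le> nrm A (?z \<oplus> k)" using x by (intro nrm_q_sq_le_self_adjoint)
  also have "?z \<oplus> k = (1/2) \<odot> ((?z \<oplus> j) \<oplus> star A (?z \<oplus> j))"
  proof -
    have "(1/2) \<odot> ?z \<oplus> (1/2) \<odot> ?z = ?z"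
      using z(1) smult_add_left[of ?z "1/2" "1/2"] by simp
    then have "(1/2) \<odot> ?z \<oplus> (1/2) \<odot> ?z \<oplus> k = ?z \<oplus> k" by simp
    then show ?thesis using z(1) by (simp add: star_add z(2) k_def smult_add_right M.a_ac)
  qed
  also have "nrm A \<dots> = (1/2) * nrm A ((?z \<oplus> j) \<oplus> star A (?z \<oplus> j))"
    using z(1) by (simp add: nrm_smult)
  also have "\<dots> \<le> (1/2) * (nrm A (?z \<oplus> j) + nrm A (star A (?z \<oplus> j)))"
    using z(1) by (intro mult_left_mono nrm_triangle) auto
  also have "\<dots> = nrm A (?z \<oplus> j)" using z(1) by simp
  finally show ?thesis .
qed

text \<open>The representatives of the class of x* x are the elements x* x + j, so
  \<open>nrm_q_sq_le\<close> bounds all of them from below.\<close>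

lemma nrm_q_cstar:
  assumes x: "x \<in> carrier A"
  shows "nrm Q (q (star A x \<otimes> x)) = (nrm Q (q x))\<^sup>2"
proof (rule antisym)
  have "nrm Q (q (star A x \<otimes> x)) \<le> nrm Q (q (star A x)) * nrm Q (q x)"
    using x by (intro nrm_q_mult_le) auto
  also have "\<dots> \<le> nrm Q (q x) * nrm Q (q x)"
    using x by (intro mult_right_mono nrm_q_star_le nrm_q_nonneg)
  finally show "nrm Q (q (star A x \<otimes> x)) \<le> (nrm Q (q x))\<^sup>2" by (simp add: power2_eq_square)
  show "(nrm Q (q x))\<^sup>2 \<le> nrm Q (q (star A x \<otimes> x))"
  proof (rule field_le_epsilon)
    fix e :: real assume "0 < e"
    then obtain y where y: "y \<in> carrier A" "q y = q (star A x \<otimes> x)" "nrm A y < nrm Q (q (star A x \<otimes> x)) + e"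
      using nrm_q_approx[of "star A x \<otimes> x"] x by auto
    have "y \<ominus> star A x \<otimes> x \<in> J" using x y by (simp flip: q_eq_iff)
    from nrm_q_sq_le[OF x this] have "(nrm Q (q x))\<^sup>2 \<le> nrm A y"
      using x y by (simp add: M.a_comm[of "star A x \<otimes> x"])
    then show "(nrm Q (q x))\<^sup>2 \<le> nrm Q (q (star A x \<otimes> x)) + e" using y by linarith
  qed
qed

lemma nrm_Q_eq_0: "C \<in> carrier Q \<Longrightarrow> nrm Q C = 0 \<longleftrightarrow> C = \<zero>\<^bsub>Q\<^esub>"
  by (elim Q_E) (simp add: Q_zero nrm_q_eq_0 q_eq_zero_iff)

lemma pre_cstar_algebra_Q: "pre_cstar_algebra Q"
proof (rule pre_cstar_algebra.intro[OF module_Q], unfold_locales)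
qed (auto elim!: Q_E simp: q_simps m_assoc l_distr r_distr smult_m_left smult_m_right star_add
    star_smult star_mult nrm_q_nonneg nrm_Q_eq_0 nrm_q_smult nrm_q_triangle nrm_q_mult_le
    nrm_q_cstar)

text \<open>A Cauchy sequence of classes is thinned until its steps are below 2^-k; such a sequence
  lifts step by step to a Cauchy sequence in \<open>A\<close>.\<close>

lemma complete_Q: "Metric_space.mcomplete (carrier Q) (nrm_dist Q)"
  unfolding pre_cstar_algebra.mcomplete_iff[OF pre_cstar_algebra_Q]
proof (intro allI impI)
  fix s :: "nat \<Rightarrow> 'a set"
  assume *: "range s \<subseteq> carrier Q \<and> (\<forall>e>0. \<exists>N. \<forall>m\<ge>N. \<forall>n\<ge>N. nrm Q (s m \<ominus>\<^bsub>Q\<^esub> s n) < e)"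
  then have "s n \<in> carrier Q" for n by blast
  then have "\<forall>n. \<exists>a. a \<in> carrier A \<and> s n = q a" by (meson Q_E)
  from choice[OF this] obtain x where x: "\<And>n. x n \<in> carrier A" "\<And>n. s n = q (x n)"
    by blast
  have C: "\<exists>N. \<forall>m\<ge>N. \<forall>n\<ge>N. nrm Q (q (x m \<ominus> x n)) < e" if "0 < e" for e
    using * that by (simp add: x q_diff)
  have "\<forall>k. \<exists>N. \<forall>m\<ge>N. \<forall>n\<ge>N. nrm Q (q (x m \<ominus> x n)) < (1/2) ^ k"
    using C by simp
  from choice[OF this] obtain N
    where N: "\<And>k m n. \<lbrakk>N k \<le> m; N k \<le> n\<rbrakk> \<Longrightarrow> nrm Q (q (x m \<ominus> x n)) < (1/2) ^ k"
    by blast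
  \<comment> \<open>Adding up the thresholds gives nondecreasing indices with
    \<open>N k \<le> M k\<close>.\<close>
  define M where "M k = (\<Sum>i\<le>k. N i)" for k
  have NM: "N k \<le> M l" if "k \<le> l" for k l
    unfolding M_def using that by (intro member_le_sum) auto
  have "\<exists>y. \<forall>k. (y k \<in> carrier A \<and> q (y k) = q (x (M k))) \<and> nrm A (y (Suc k) \<ominus> y k) < (1/2) ^ k"
  proof (rule dependent_nat_choice[where P = "\<lambda>k y. y \<in> carrier A \<and> q y = q (x (M k))"
        and Q = "\<lambda>k y z. nrm A (z \<ominus> y) < (1/2) ^ k"])
    show "\<exists>y. y \<in> carrier A \<and> q y = q (x (M 0))" using x by blast
    fix y k assume y: "y \<in> carrier A \<and> q y = q (x (M k))"
    \<comment> \<open>The lift is corrected by a representative of the next difference with norm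
      still below 2^-k.\<close>
    define d where "d = x (M (Suc k)) \<ominus> x (M k)"
    have d: "d \<in> carrier A" using x by (simp add: d_def)
    have "nrm Q (q d) < (1/2) ^ k"
      unfolding d_def by (intro N NM) auto
    then have "0 < (1/2) ^ k - nrm Q (q d)" by simp
    from nrm_q_approx[OF d this] obtain z where z: "z \<in> carrier A" "q z = q d" "nrm A z < (1/2) ^ k"
      by auto
    have "q (y \<oplus> z) = q y \<oplus>\<^bsub>Q\<^esub> q z" using y z by (intro q_add[symmetric]) auto
    also have "\<dots> = q (x (M k)) \<oplus>\<^bsub>Q\<^esub> q d" using y z by simp
    also have "\<dots> = q (x (M k) \<oplus> d)" using x d by (simp add: q_add)
    also have "x (M k) \<oplus> d = x (M (Suc k))"
      using x M.a_comm[of "x (M k)" d] d by (simp add: d_def)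
    finally have "q (y \<oplus> z) = q (x (M (Suc k)))" .
    moreover have "(y \<oplus> z) \<ominus> y = z" using y z by simp
    ultimately show "\<exists>w. (w \<in> carrier A \<and> q w = q (x (M (Suc k)))) \<and> nrm A (w \<ominus> y) < (1/2) ^ k"
      using y z by (intro exI[of _ "y \<oplus> z"]) auto
  qed
  then obtain y where y: "\<And>k. y k \<in> carrier A" "\<And>k. q (y k) = q (x (M k))"
    and step: "\<And>k. nrm A (y (Suc k) \<ominus> y k) < (1/2) ^ k"
    by blast
  have tail: "nrm A (y (n + k) \<ominus> y n) \<le> 2 * (1/2) ^ n - 2 * (1/2) ^ (n + k)" for n k
  proof (induction k)
    case (Suc k)
    have "nrm A (y (Suc (n + k)) \<ominus> y n) \<le> nrm A (y (Suc (n + k)) \<ominus> y (n + k)) + nrm A (y (n + k) \<ominus> y n)"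
      using y by (intro nrm_triangle_diff)
    then show ?case using Suc step[of "n + k"] by simp
  qed (use y in simp)
  have tail': "nrm A (y m \<ominus> y n) \<le> 2 * (1/2) ^ n" if "n \<le> m" for m n
  proof -
    have "nrm A (y m \<ominus> y n) \<le> 2 * (1/2) ^ n - 2 * (1/2) ^ m" using tail[of n "m - n"] that by simp
    moreover have "0 < (1/2 :: real) ^ m" by simp
    ultimately show ?thesis by linarith
  qed
  have half: "\<exists>n. 2 * (1/2) ^ n < e" if "0 < e" for e :: real
    using real_arch_pow_inv[of "e/2" "1/2"] that by (auto simp: field_simps)
  obtain a where a: "a \<in> carrier A" "\<And>e. 0 < e \<Longrightarrow> \<exists>N. \<forall>n\<ge>N. nrm A (y n \<ominus> a) < e"
  proof (rule Cauchy_converges[of y])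
    fix e :: real assume "0 < e"
    then obtain K where K: "2 * (1/2) ^ K < e / 2" using half[of "e/2"] by auto
    show "\<exists>N. \<forall>m\<ge>N. \<forall>n\<ge>N. nrm A (y m \<ominus> y n) < e"
    proof (intro exI[of _ K] allI impI)
      fix m n assume "K \<le> m" "K \<le> n"
      have "nrm A (y m \<ominus> y n) \<le> nrm A (y m \<ominus> y K) + nrm A (y K \<ominus> y n)"
        using y by (intro nrm_triangle_diff)
      also have "nrm A (y K \<ominus> y n) = nrm A (y n \<ominus> y K)" using y by (intro nrm_diff_commute)
      finally show "nrm A (y m \<ominus> y n) < e"
        using tail'[OF \<open>K \<le> m\<close>] tail'[OF \<open>K \<le> n\<close>] K by linarith
    qed
  qed (use y in auto)
  show "\<exists>x\<in>carrier Q. \<forall>e>0. \<exists>N. \<forall>n\<ge>N. nrm Q (s n \<ominus>\<^bsub>Q\<^esub> x) < e"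
  proof (intro bexI[of _ "q a"] allI impI)
    fix e :: real assume "0 < e"
    then obtain n1 n2 where n1: "\<And>n. n1 \<le> n \<Longrightarrow> nrm A (y n \<ominus> a) < e / 2" and n2: "2 * (1/2) ^ n2 < e"
      using a(2)[of "e/2"] half[of e] by auto
    define k where "k = max n1 (Suc n2)"
    have "(1/2 :: real) ^ k \<le> (1/2) ^ Suc n2" by (intro power_decreasing) (auto simp: k_def)
    then have "2 * (1/2 :: real) ^ k \<le> (1/2) ^ n2" by simp
    moreover have "0 < (1/2 :: real) ^ n2" by simp
    ultimately have k: "(1/2 :: real) ^ k < e / 2" using n2 by linarith
    show "\<exists>N. \<forall>n\<ge>N. nrm Q (s n \<ominus>\<^bsub>Q\<^esub> q a) < e"
    proof (intro exI[of _ "M k"] allI impI)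
      fix n assume n: "M k \<le> n"
      have "N k \<le> n" using NM[of k k] n by simp
      then have 1: "nrm Q (q (x n \<ominus> x (M k))) < (1/2) ^ k" by (intro N NM) auto
      have "nrm Q (q (y k \<ominus> a)) \<le> nrm A (y k \<ominus> a)" using y a by simp
      also have "\<dots> < e / 2" by (rule n1) (simp add: k_def)
      finally have 2: "nrm Q (q (y k \<ominus> a)) < e / 2" .
      have "q (y k \<ominus> a) = q (x (M k) \<ominus> a)" using x y a by (simp flip: q_diff)
      moreover have "q (x n \<ominus> a) = q ((x n \<ominus> x (M k)) \<oplus> (x (M k) \<ominus> a))"
        using x a by (simp add: diff_add_diff)
      ultimately have "nrm Q (q (x n \<ominus> a)) \<le> nrm Q (q (x n \<ominus> x (M k))) + nrm Q (q (y k \<ominus> a))"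
        using x a nrm_q_triangle[of "x n \<ominus> x (M k)" "x (M k) \<ominus> a"] by simp
      then show "nrm Q (s n \<ominus>\<^bsub>Q\<^esub> q a) < e"
        using 1 2 k x a by (simp add: q_diff)
    qed
  qed (use a in simp)
qed

lemma cstar_algebra_Q: "cstar_algebra Q"
  by (intro cstar_algebra.intro pre_cstar_algebra_Q cstar_algebra_axioms.intro complete_Q)

end

section \<open>Cartan subalgebras\<close>

context pre_cstar_algebra
begin

lemma cstar_subalgebraI:
  assumes "V \<subseteq> carrier A" "\<zero> \<in> V"
    and "\<And>x y. \<lbrakk>x \<in> V; y \<in> V\<rbrakk> \<Longrightarrow> x \<oplus> y \<in> V" "\<And>c x. x \<in> V \<Longrightarrow> c \<odot> x \<in> V"
    and "\<And>x y. \<lbrakk>x \<in> V; y \<in> V\<rbrakk> \<Longrightarrow> x \<otimes> y \<in> V" "\<And>x. x \<in> V \<Longrightarrow> star A x \<in> V"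
    and "\<And>x. \<lbrakk>x \<in> carrier A; \<And>e. 0 < e \<Longrightarrow> \<exists>v\<in>V. nrm A (x \<ominus> v) < e\<rbrakk> \<Longrightarrow> x \<in> V"
  shows "cstar_subalgebra V A"
  unfolding cstar_subalgebra_def csubspace_iff closedin_iff using assms by auto

text \<open>This makes commuting with \<open>s\<close> a closed condition: near an element that
  commutes with \<open>s\<close> the commutator is small.\<close>

lemma nrm_commutator_le:
  assumes "x \<in> carrier A" "v \<in> carrier A" "s \<in> carrier A" "v \<otimes> s = s \<otimes> v"
  shows "nrm A (x \<otimes> s \<ominus> s \<otimes> x) \<le> nrm A (x \<ominus> v) * (2 * nrm A s)"
proof -
  have "x \<otimes> s \<ominus> s \<otimes> x = (x \<otimes> s \<ominus> v \<otimes> s) \<oplus> (s \<otimes> v \<ominus> s \<otimes> x)"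
    using assms by (simp add: diff_add_diff)
  also have "\<dots> = (x \<ominus> v) \<otimes> s \<oplus> s \<otimes> (v \<ominus> x)"
    using assms by (simp add: mult_diff_left mult_diff_right)
  finally have "nrm A (x \<otimes> s \<ominus> s \<otimes> x) = nrm A ((x \<ominus> v) \<otimes> s \<oplus> s \<otimes> (v \<ominus> x))" by simp
  also have "\<dots> \<le> nrm A ((x \<ominus> v) \<otimes> s) + nrm A (s \<otimes> (v \<ominus> x))"
    using assms by (intro nrm_triangle) auto
  also have "\<dots> \<le> nrm A (x \<ominus> v) * nrm A s + nrm A s * nrm A (v \<ominus> x)"
    using assms by (intro add_mono nrm_mult) auto
  also have "nrm A (v \<ominus> x) = nrm A (x \<ominus> v)" using assms by (intro nrm_diff_commute)
  finally show ?thesis by (simp add: algebra_simps)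
qed

lemma commutant_subalgebra:
  assumes S: "S \<subseteq> carrier A" "\<And>s. s \<in> S \<Longrightarrow> star A s \<in> S"
  shows "cstar_subalgebra {x \<in> carrier A. \<forall>s\<in>S. x \<otimes> s = s \<otimes> x} A"
proof (rule cstar_subalgebraI)
  have SA: "s \<in> carrier A" if "s \<in> S" for s using S that by blast
  let ?C = "{x \<in> carrier A. \<forall>s\<in>S. x \<otimes> s = s \<otimes> x}"
  show "?C \<subseteq> carrier A" "\<zero> \<in> ?C" using SA by auto
  show "x \<oplus> y \<in> ?C" if "x \<in> ?C" "y \<in> ?C" for x y using that SA by (auto simp: l_distr r_distr)
  show "c \<odot> x \<in> ?C" if "x \<in> ?C" for c x using that SA by (auto simp: smult_m_left smult_m_right)
  show "x \<otimes> y \<in> ?C" if x: "x \<in> ?C" and y: "y \<in> ?C" for x y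
  proof -
    have "x \<otimes> y \<otimes> s = s \<otimes> (x \<otimes> y)" if "s \<in> S" for s
    proof -
      have A: "x \<in> carrier A" "y \<in> carrier A" "s \<in> carrier A"
        and xs: "x \<otimes> s = s \<otimes> x" and ys: "y \<otimes> s = s \<otimes> y"
        using x y that SA by blast+
      have "x \<otimes> y \<otimes> s = x \<otimes> (y \<otimes> s)" using A by (simp add: m_assoc)
      also have "\<dots> = (x \<otimes> s) \<otimes> y" unfolding ys using A by (simp add: m_assoc)
      also have "\<dots> = s \<otimes> (x \<otimes> y)" unfolding xs using A by (simp add: m_assoc)
      finally show ?thesis .
    qed
    then show ?thesis using x y by simp
  qed
  show "star A x \<in> ?C" if x: "x \<in> ?C" for x
  proof -
    have "star A x \<otimes> s = s \<otimes> star A x" if s: "s \<in> S" for s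
    proof -
      have "star A (star A s \<otimes> x) = star A (x \<otimes> star A s)" using x S(2)[OF s] by simp
      then show ?thesis using x s SA by (simp add: star_mult)
    qed
    then show ?thesis using x by simp
  qed
  show "x \<in> ?C" if x: "x \<in> carrier A" and lim: "\<And>e. 0 < e \<Longrightarrow> \<exists>v\<in>?C. nrm A (x \<ominus> v) < e" for x
  proof -
    have "x \<otimes> s \<ominus> s \<otimes> x = \<zero>" if s: "s \<in> S" for s
    proof (rule eq_zero_if_nrm_less)
      fix e :: real assume "0 < e"
      have p: "0 < 2 * nrm A s + 1" using nrm_nonneg[OF SA[OF s]] by simp
      then obtain v where v: "v \<in> ?C" "nrm A (x \<ominus> v) < e / (2 * nrm A s + 1)"
        using lim[of "e / (2 * nrm A s + 1)"] \<open>0 < e\<close> by auto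
      have vA: "v \<in> carrier A" using v by simp
      have "nrm A (x \<otimes> s \<ominus> s \<otimes> x) \<le> nrm A (x \<ominus> v) * (2 * nrm A s)"
        using v s x SA by (intro nrm_commutator_le) auto
      also have "\<dots> \<le> nrm A (x \<ominus> v) * (2 * nrm A s + 1)"
        using x vA by (intro mult_left_mono) (auto simp: nrm_nonneg)
      also have "\<dots> < e" using v(2) p by (simp only: pos_less_divide_eq)
      finally show "nrm A (x \<otimes> s \<ominus> s \<otimes> x) < e" .
    qed (use x s SA in auto)
    then show ?thesis using x SA by auto
  qed
qed

lemma cartesian_decomposition:
  assumes y: "y \<in> carrier A"
  defines "a \<equiv> (1/2) \<odot> (y \<oplus> star A y)" and "b \<equiv> (- \<i> / 2) \<odot> (y \<ominus> star A y)"
  shows "a \<in> carrier A" "b \<in> carrier A" "star A a = a" "star A b = b" "y = a \<oplus> \<i> \<odot> b"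
proof -
  show "a \<in> carrier A" "b \<in> carrier A" using y by (simp_all add: a_def b_def)
  show "star A a = a" using y by (simp add: a_def star_smult star_add M.a_comm)
  have "star A b = (\<i> / 2) \<odot> (\<ominus> (y \<ominus> star A y))"
    using y by (simp add: b_def star_smult star_diff minus_diff)
  also have "\<dots> = b"
    using y smult_minus_left[of "y \<ominus> star A y" "\<i> / 2"] by (simp add: b_def smult_minus_right)
  finally show "star A b = b" .
  have "a \<oplus> \<i> \<odot> b = (1/2) \<odot> ((y \<oplus> star A y) \<oplus> (y \<ominus> star A y))"
    using y by (simp add: a_def b_def smult_add_right)
  also have "(y \<oplus> star A y) \<oplus> (y \<ominus> star A y) = y \<oplus> y"
  proof -
    have "(y \<oplus> star A y) \<oplus> (y \<ominus> star A y) = y \<oplus> ((y \<ominus> star A y) \<oplus> star A y)"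
      using y M.a_comm[of "star A y" "y \<ominus> star A y"] by (simp add: M.a_assoc del: diff_add_cancel)
    then show ?thesis using y by simp
  qed
  also have "(1/2) \<odot> (y \<oplus> y) = y"
    using y smult_add_left[of y "1/2" "1/2"] by (simp add: smult_add_right)
  finally show "y = a \<oplus> \<i> \<odot> b" by simp
qed

end

locale cartan = cstar_algebra A
  for A :: "('a, 'm) cstar_struct_scheme" (structure) +
  fixes D :: "'a set" and E :: "'a \<Rightarrow> 'a"
  assumes regular: "regular_inclusion D A"
    and expectation: "conditional_expectation E D A"
    and faithful: "faithful_map E A"
    and maximal: "maximal_abelian D A"
begin

lemma D_subalgebra: "cstar_subalgebra D A"
  using regular by (simp add: regular_inclusion_def cstar_inclusion_def)

lemmas D_csubspace = cstar_subalgebra_csubspace[OF D_subalgebra]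
lemmas D_closed [simp] = csubspace_closed[OF D_csubspace]
lemmas D_zero [simp] = csubspace_zero[OF D_csubspace]
lemmas D_add = csubspace_add[OF D_csubspace]
lemmas D_smult = csubspace_smult[OF D_csubspace]
lemmas D_diff = csubspace_diff[OF D_csubspace]
lemmas D_mult = cstar_subalgebra_mult[OF D_subalgebra]
lemmas D_star = cstar_subalgebra_star[OF D_subalgebra]
lemmas D_limit = closedin_limit[OF cstar_subalgebra_closedin[OF D_subalgebra]]

lemma D_commute: "\<lbrakk>x \<in> D; y \<in> D\<rbrakk> \<Longrightarrow> x \<otimes> y = y \<otimes> x"
  using maximal by (simp add: maximal_abelian_def abelian_subalgebra_def)

lemma
  assumes x: "x \<in> carrier A"
  shows E_in: "E x \<in> D"
    and E_add: "y \<in> carrier A \<Longrightarrow> E (x \<oplus> y) = E x \<oplus> E y"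
    and E_smult: "E (c \<odot> x) = c \<odot> E x"
    and E_mult_left: "d \<in> D \<Longrightarrow> E (d \<otimes> x) = d \<otimes> E x"
    and E_mult_right: "d \<in> D \<Longrightarrow> E (x \<otimes> d) = E x \<otimes> d"
    and E_nrm: "nrm A (E x) \<le> nrm A x"
    and E_faithful: "E (star A x \<otimes> x) = \<zero> \<Longrightarrow> x = \<zero>"
  using x expectation faithful by (auto simp: conditional_expectation_def faithful_map_def)

lemma E_D: "d \<in> D \<Longrightarrow> E d = d"
  using expectation by (simp add: conditional_expectation_def)

lemma E_positive: "x \<in> cstar_positive A \<Longrightarrow> E x \<in> cstar_positive A"
  using expectation by (simp add: conditional_expectation_def)

lemma E_closed [simp]: "x \<in> carrier A \<Longrightarrow> E x \<in> carrier A"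
  using E_in by simp

lemma E_diff: "\<lbrakk>x \<in> carrier A; y \<in> carrier A\<rbrakk> \<Longrightarrow> E (x \<ominus> y) = E x \<ominus> E y"
  using E_add[of x "\<ominus> y"] E_smult[of y "- 1"] by (simp add: a_minus_def smult_minus_one)

lemma approx_unit:
  assumes x: "x \<in> carrier A" and e: "0 < e"
  obtains u where "u \<in> D" "nrm A u \<le> 1" "nrm A (x \<ominus> u \<otimes> x) < e" "nrm A (x \<ominus> x \<otimes> u) < e"
proof -
  obtain F where F: "approximate_unit A F" "\<forall>\<^sub>F u in F. u \<in> D"
    using regular by (auto simp: regular_inclusion_def cstar_inclusion_def)
  then have lim: "((\<lambda>u. nrm A (u \<otimes> x \<ominus> x)) \<longlongrightarrow> 0) F" "((\<lambda>u. nrm A (x \<otimes> u \<ominus> x)) \<longlongrightarrow> 0) F"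
    and ne: "F \<noteq> bot" and 1: "\<forall>\<^sub>F u in F. u \<in> cstar_positive A \<and> nrm A u \<le> 1"
    using x unfolding approximate_unit_def by blast+
  have "\<forall>\<^sub>F u in F. nrm A (u \<otimes> x \<ominus> x) < e" "\<forall>\<^sub>F u in F. nrm A (x \<otimes> u \<ominus> x) < e"
    using order_tendstoD(2)[OF lim(1) e] order_tendstoD(2)[OF lim(2) e] by auto
  with F(2) 1 have "\<forall>\<^sub>F u in F. u \<in> D \<and> nrm A u \<le> 1 \<and> nrm A (u \<otimes> x \<ominus> x) < e \<and> nrm A (x \<otimes> u \<ominus> x) < e"
    by eventually_elim blast
  then obtain u where u: "u \<in> D" "nrm A u \<le> 1" "nrm A (u \<otimes> x \<ominus> x) < e" "nrm A (x \<otimes> u \<ominus> x) < e"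
    using eventually_happens'[OF ne] by blast
  have "nrm A (x \<ominus> u \<otimes> x) = nrm A (u \<otimes> x \<ominus> x)" "nrm A (x \<ominus> x \<otimes> u) = nrm A (x \<otimes> u \<ominus> x)"
    using x u(1) by (intro nrm_diff_commute; simp)+
  with u show ?thesis by (intro that[of u]) auto
qed

lemma span_approx:
  assumes "x \<in> carrier A" "0 < e"
  obtains s where "s \<in> clinear_span (normalizers D A) A" "s \<in> carrier A" "nrm A (x \<ominus> s) < e"
proof -
  have "x \<in> nrm_topology A closure_of clinear_span (normalizers D A) A"
    using regular assms(1) by (simp add: regular_inclusion_def)
  then show ?thesis
    using assms(2) that unfolding closure_of_iff by blast
qed

text \<open>The algebra generated by \<open>D\<close> and \<open>h\<close> is replaced by the bicommutant of \<open>D \<union> {h}\<close>.\<close>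

lemma masa_self_adjoint:
  assumes h: "h \<in> carrier A" "star A h = h" and comm: "\<And>d. d \<in> D \<Longrightarrow> h \<otimes> d = d \<otimes> h"
  shows "h \<in> D"
proof -
  let ?S = "insert h D"
  define C where "C = {x \<in> carrier A. \<forall>s\<in>?S. x \<otimes> s = s \<otimes> x}"
  define B where "B = {x \<in> carrier A. \<forall>s\<in>C. x \<otimes> s = s \<otimes> x}"
  have C: "cstar_subalgebra C A"
    unfolding C_def by (rule commutant_subalgebra) (use h D_star in auto)
  have CA: "C \<subseteq> carrier A" by (auto simp: C_def)
  have B: "cstar_subalgebra B A"
    unfolding B_def by (rule commutant_subalgebra[OF CA]) (rule cstar_subalgebra_star[OF C])
  have SC: "?S \<subseteq> C"
    unfolding C_def using h comm D_commute by auto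
  have SB: "?S \<subseteq> B"
    using SC CA unfolding B_def C_def by force
  have "x \<otimes> y = y \<otimes> x" if "x \<in> B" "y \<in> B" for x y
  proof -
    \<comment> \<open>\<open>?S\<close> is commutative, so it lies in \<open>C\<close>; what
      commutes with \<open>C\<close> therefore commutes with \<open>?S\<close>.\<close>
    have "y \<in> C" using that(2) SC unfolding B_def C_def by blast
    then show ?thesis using that(1) unfolding B_def by blast
  qed
  then have "abelian_subalgebra B A" using B by (simp add: abelian_subalgebra_def)
  then have "B = D" using maximal SB by (simp add: maximal_abelian_def)
  then show ?thesis using SB by blast
qed

text \<open>Maximality, which speaks of abelian subalgebras, in the form used later:
  \<open>D\<close> contains its commutant. Real and imaginary parts reduce this to the self-adjoint
  case.\<close>

lemma masa:
  assumes y: "y \<in> carrier A" and comm: "\<And>d. d \<in> D \<Longrightarrow> y \<otimes> d = d \<otimes> y"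
  shows "y \<in> D"
proof -
  note dec = cartesian_decomposition[OF y]
  have comm': "star A y \<otimes> d = d \<otimes> star A y" if d: "d \<in> D" for d
  proof -
    have "star A (star A d \<otimes> y) = star A (y \<otimes> star A d)" using comm[OF D_star[OF d]] by simp
    then show ?thesis using y d by (simp add: star_mult)
  qed
  have 1: "(1/2) \<odot> (y \<oplus> star A y) \<in> D"
    by (rule masa_self_adjoint[OF dec(1,3)])
       (use y comm comm' in \<open>simp add: smult_m_left smult_m_right l_distr r_distr\<close>)
  have 2: "(- \<i> / 2) \<odot> (y \<ominus> star A y) \<in> D"
    by (rule masa_self_adjoint[OF dec(2,4)])
       (use y comm comm' in \<open>simp add: smult_m_left smult_m_right mult_diff_left mult_diff_right\<close>)
  show ?thesis
    by (subst dec(5)) (rule D_add[OF 1 D_smult[OF 2]])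
qed

section \<open>Normalizers\<close>

lemma
  assumes "n \<in> normalizers D A"
  shows normalizer_closed [simp]: "n \<in> carrier A"
    and normalizer_conj: "d \<in> D \<Longrightarrow> n \<otimes> d \<otimes> star A n \<in> D"
    and normalizer_conj_star: "d \<in> D \<Longrightarrow> star A n \<otimes> d \<otimes> n \<in> D"
  using assms by (auto simp: normalizers_def)

lemma normalizer_mult:
  assumes n: "n \<in> normalizers D A" and g: "g \<in> D" "h \<in> D"
  shows "g \<otimes> n \<otimes> h \<in> normalizers D A"
proof -
  have nA: "n \<in> carrier A" using n by simp
  have e1: "(g \<otimes> n \<otimes> h) \<otimes> d \<otimes> star A (g \<otimes> n \<otimes> h) = g \<otimes> (n \<otimes> (h \<otimes> d \<otimes> star A h) \<otimes> star A n) \<otimes> star A g"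
    if "d \<in> D" for d
    using nA g that by (simp add: star_mult m_assoc)
  have e2: "star A (g \<otimes> n \<otimes> h) \<otimes> d \<otimes> (g \<otimes> n \<otimes> h) = star A h \<otimes> (star A n \<otimes> (star A g \<otimes> d \<otimes> g) \<otimes> n) \<otimes> h"
    if "d \<in> D" for d
    using nA g that by (simp add: star_mult m_assoc)
  show ?thesis
    unfolding normalizers_def
  proof (rule CollectI, intro conjI ballI)
    show "g \<otimes> n \<otimes> h \<in> carrier A" using nA g by simp
    fix d assume d: "d \<in> D"
    show "(g \<otimes> n \<otimes> h) \<otimes> d \<otimes> star A (g \<otimes> n \<otimes> h) \<in> D"
      unfolding e1[OF d]
      by (rule D_mult[OF D_mult[OF g(1) normalizer_conj[OF n D_mult[OF D_mult[OF g(2) d] D_star[OF g(2)]]]]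
            D_star[OF g(1)]])
    show "star A (g \<otimes> n \<otimes> h) \<otimes> d \<otimes> (g \<otimes> n \<otimes> h) \<in> D"
      unfolding e2[OF d]
      by (rule D_mult[OF D_mult[OF D_star[OF g(2)]
              normalizer_conj_star[OF n D_mult[OF D_mult[OF D_star[OF g(1)] d] g(1)]]] g(2)])
  qed
qed

text \<open>\<open>T\<close> models multiplication by f(d), which need not be an element of
  \<open>D\<close> when f(0) is not 0. For an approximate unit \<open>u\<close> in \<open>D\<close>
  the elements \<open>star A n \<otimes> T u \<otimes> n\<close> lie in \<open>D\<close> and
  converge to \<open>star A n \<otimes> T n\<close>.\<close>

lemma normalizer_sandwich:
  assumes n: "n \<in> normalizers D A" and TD: "\<And>u. u \<in> D \<Longrightarrow> T u \<in> D"
    and T: "\<And>y. y \<in> carrier A \<Longrightarrow> T y \<in> carrier A"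
      "\<And>y z. \<lbrakk>y \<in> carrier A; z \<in> carrier A\<rbrakk> \<Longrightarrow> T (y \<ominus> z) = T y \<ominus> T z"
      "\<And>y z. \<lbrakk>y \<in> carrier A; z \<in> carrier A\<rbrakk> \<Longrightarrow> T (y \<otimes> z) = T y \<otimes> z"
      "\<And>y. y \<in> carrier A \<Longrightarrow> nrm A (T y) \<le> nrm A y"
  shows "star A n \<otimes> T n \<in> D"
proof (rule D_limit)
  have nA: "n \<in> carrier A" using n by simp
  fix e :: real assume "0 < e"
  have p: "0 < nrm A n + 1" using nrm_nonneg[OF nA] by simp
  obtain u where u: "u \<in> D" "nrm A (n \<ominus> u \<otimes> n) < e / (nrm A n + 1)"
    using approx_unit[OF nA, of "e / (nrm A n + 1)"] p \<open>0 < e\<close> by auto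
  have uA: "u \<in> carrier A" using u by simp
  have "star A n \<otimes> T n \<ominus> star A n \<otimes> T u \<otimes> n = star A n \<otimes> T (n \<ominus> u \<otimes> n)"
    using nA uA by (simp add: T mult_diff_right m_assoc)
  then have "nrm A (star A n \<otimes> T n \<ominus> star A n \<otimes> T u \<otimes> n) \<le> nrm A n * nrm A (T (n \<ominus> u \<otimes> n))"
    using nA uA T(1) nrm_mult[of "star A n" "T (n \<ominus> u \<otimes> n)"] by simp
  also have "\<dots> \<le> (nrm A n + 1) * nrm A (n \<ominus> u \<otimes> n)"
    using nA uA T(1) by (intro mult_mono T(4)) (auto simp: nrm_nonneg)
  also have "\<dots> < e" using u(2) p by (simp only: pos_less_divide_eq mult.commute)
  finally show "\<exists>v\<in>D. nrm A (star A n \<otimes> T n \<ominus> v) < e"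
    using normalizer_conj_star[OF n TD[OF u(1)]] by blast
qed (use n T(1) in simp)

lemma normalizer_star_self: "n \<in> normalizers D A \<Longrightarrow> star A n \<otimes> n \<in> D"
  by (rule normalizer_sandwich[where T = "\<lambda>y. y"]) auto

end

locale cartan_elt = cartan A D E + d: self_adjoint_elt A d R
  for A :: "('a, 'm) cstar_struct_scheme" (structure) and D E d R +
  assumes d_in: "d \<in> D"
begin

lemma cfc_in_D: "\<lbrakk>continuous_on {-R..R} f; y \<in> D\<rbrakk> \<Longrightarrow> d.cfc f y \<in> D"
  by (rule d.cfc_in_closed_subspace[OF _ D_csubspace cstar_subalgebra_closedin[OF D_subalgebra]])
     (auto intro: D_mult d_in)

lemma normalizer_cfc:
  assumes "n \<in> normalizers D A" "continuous_on {-R..R} f" "\<And>t. \<bar>t\<bar> \<le> R \<Longrightarrow> \<bar>f t\<bar> \<le> 1"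
  shows "star A n \<otimes> d.cfc f n \<in> D"
  using d.nrm_cfc_le[OF assms(2,3)] assms(1,2)
  by (intro normalizer_sandwich) (simp_all add: cfc_in_D d.cfc_diff_arg d.cfc_mult_arg)

end

section \<open>Displacement by normalizers\<close>

context cartan_elt
begin

text \<open>The hats \<open>G i t - G (Suc i) t\<close> telescope to 1 on the interval, so they
  cannot all kill \<open>v0\<close>.\<close>

lemma hat_partition:
  assumes v0: "v0 \<in> carrier A" "v0 \<noteq> \<zero>" and e: "0 < e"
  obtains f l where "continuous_on {-R..R} f" "\<And>t. f t \<noteq> 0 \<Longrightarrow> \<bar>t - l\<bar> \<le> e" "d.cfc f v0 \<noteq> \<zero>"
proof -
  define F where "F s = min 1 (max 0 s)" for s :: real
  \<comment> \<open>With this shift the ramp \<open>G 0\<close> equals 1 on the whole interval;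
    \<open>N\<close> is large enough for \<open>G N\<close> to vanish there.\<close>
  define K where "K = R / e + 1"
  define G where "G i t = F (t / e + K - real i)" for i t
  have Gc [simp, continuous_intros]: "continuous_on S (G i)" for S i
    unfolding G_def F_def using e by (intro continuous_intros) auto
  obtain N where N: "K + R / e \<le> real N"
    using real_arch_simple by blast
  have "\<exists>i<N. d.cfc (\<lambda>t. G i t - G (Suc i) t) v0 \<noteq> \<zero>"
  proof (rule ccontr)
    assume "\<not> ?thesis"
    then have 0: "d.cfc (\<lambda>t. G i t - G (Suc i) t) v0 = \<zero>" if "i < N" for i
      using that by blast
    have "d.cfc (\<lambda>t. G 0 t - G n t) v0 = \<zero>" if "n \<le> N" for n
      using that
    proof (induction n)
      case 0
      show ?case using v0 by (simp add: d.cfc_zero)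
    next
      case (Suc n)
      have "d.cfc (\<lambda>t. G 0 t - G (Suc n) t) v0 = d.cfc (\<lambda>t. (G 0 t - G n t) + (G n t - G (Suc n) t)) v0"
        by simp
      also have "\<dots> = d.cfc (\<lambda>t. G 0 t - G n t) v0 \<oplus> d.cfc (\<lambda>t. G n t - G (Suc n) t) v0"
        by (intro d.cfc_add continuous_intros v0)
      also have "\<dots> = \<zero>" using Suc 0[of n] by simp
      finally show ?case .
    qed
    from this[of N] have "d.cfc (\<lambda>t. G 0 t - G N t) v0 = \<zero>" by simp
    moreover have "d.cfc (\<lambda>t. G 0 t - G N t) v0 = v0"
    proof (rule d.cfc_one[OF v0(1)])
      fix t assume t: "\<bar>t\<bar> \<le> R"
      have "- (R / e) \<le> t / e" "t / e \<le> R / e"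
        using t e divide_right_mono[of "- R" t e] divide_right_mono[of t R e] by auto
      then show "G 0 t - G N t = 1"
        using N by (simp add: G_def F_def K_def)
    qed
    ultimately show False using v0 by simp
  qed
  then obtain i where i: "d.cfc (\<lambda>t. G i t - G (Suc i) t) v0 \<noteq> \<zero>" by blast
  show ?thesis
  \<comment> \<open>A hat is nonzero only where \<open>t / e + K - real i\<close> lies between 0 and
    2; \<open>l\<close> is the point where it equals 1.\<close>
  proof (rule that[of "\<lambda>t. G i t - G (Suc i) t" "e * (1 + real i - K)"])
    show "continuous_on {-R..R} (\<lambda>t. G i t - G (Suc i) t)" by (intro continuous_intros)
    fix t assume "G i t - G (Suc i) t \<noteq> 0"
    then have "\<bar>t / e - (1 + real i - K)\<bar> \<le> 1"
      by (auto simp: G_def F_def min_def max_def split: if_splits)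
    then have "e * \<bar>t / e - (1 + real i - K)\<bar> \<le> e * 1"
      using e by (intro mult_left_mono) auto
    moreover have "e * \<bar>t / e - (1 + real i - K)\<bar> = \<bar>e * (t / e - (1 + real i - K))\<bar>"
      using e by (simp add: abs_mult)
    moreover have "e * (t / e - (1 + real i - K)) = t - e * (1 + real i - K)"
      using e by (simp add: right_diff_distrib)
    ultimately show "\<bar>t - e * (1 + real i - K)\<bar> \<le> e" by simp
  qed (rule i)
qed

text \<open>
  If the off-diagonal part \<open>m = f(d) n v\<close> with \<open>f\<close> vanishing on the support of \<open>v\<close> is nonzero, then the
  partial homeomorphism of \<open>n\<close> moves the support of \<open>m m*\<close> off itself.
\<close>

lemma normalizer_displacement:
  assumes n: "n \<in> normalizers D A" and v0: "v0 \<in> D"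
    and f: "continuous_on {-R..R} f" "\<And>t. \<bar>t\<bar> \<le> R \<Longrightarrow> \<bar>f t\<bar> \<le> 1"
    and p: "continuous_on {-R..R} p" and pf: "\<And>t. p t * f t = 0"
    and ne: "d.cfc f (n \<otimes> d.cfc p v0) \<noteq> \<zero>"
  shows "\<exists>k\<in>D. k \<noteq> \<zero> \<and> star A k = k \<and> k \<otimes> n \<otimes> k = \<zero> \<and> (\<forall>c\<in>D. c \<otimes> n = \<zero> \<longrightarrow> c \<otimes> k = \<zero>)"
proof -
  have nA [simp]: "n \<in> carrier A" using n by simp
  define v where "v = d.cfc p v0"
  have v: "v \<in> D" unfolding v_def by (rule cfc_in_D[OF p v0])
  have [simp]: "v \<in> carrier A" "v0 \<in> carrier A" using v v0 by auto
  define m where "m = d.cfc f (n \<otimes> v)"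
  have m [simp]: "m \<in> carrier A" using f by (simp add: m_def)
  define k where "k = m \<otimes> star A m"
  have kA [simp]: "k \<in> carrier A" by (simp add: k_def)
  have k0: "k \<noteq> \<zero>"
    using ne mult_star_self_eq_zero[OF m] by (auto simp: k_def m_def v_def)
  have ks: "star A k = k" by (simp add: k_def star_mult)
  \<comment> \<open>\<open>k\<close> is f(d) n v v* n* f(d). Functional calculus acts from the left
    only, so the right factor is produced by taking stars and applying it once more.\<close>
  have "n \<otimes> v \<otimes> star A (n \<otimes> v) = n \<otimes> (v \<otimes> star A v) \<otimes> star A n"
    by (simp add: star_mult m_assoc)
  then have "n \<otimes> v \<otimes> star A (n \<otimes> v) \<in> D"
    using normalizer_conj[OF n D_mult[OF v D_star[OF v]]] by simp
  then have "d.cfc f (n \<otimes> v \<otimes> star A (n \<otimes> v)) \<in> D" by (rule cfc_in_D[OF f(1)])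
  then have "m \<otimes> star A (n \<otimes> v) \<in> D" using f(1) by (simp add: m_def d.cfc_mult_arg)
  then have "star A (m \<otimes> star A (n \<otimes> v)) \<in> D" by (rule D_star)
  then have "n \<otimes> v \<otimes> star A m \<in> D" by (simp add: star_mult[of m] del: star_star) (simp)
  then have "d.cfc f (n \<otimes> v \<otimes> star A m) \<in> D" by (rule cfc_in_D[OF f(1)])
  then have kD: "k \<in> D" using f(1) by (simp add: k_def m_def d.cfc_mult_arg)
  \<comment> \<open>\<open>Y = n* f(d) n\<close> lies in \<open>D\<close> and so commutes with v*.
    Thus m* n m = Y v* m, and v* m = 0 because p f = 0.\<close>
  define Y where "Y = star A n \<otimes> d.cfc f n"
  have Y: "Y \<in> D" unfolding Y_def by (rule normalizer_cfc[OF n f])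
  have "star A m \<otimes> n = star A (n \<otimes> v) \<otimes> d.cfc f n"
    unfolding m_def by (rule d.cfc_star) (use f in auto)
  also have "\<dots> = star A v \<otimes> Y"
    using f(1) by (simp add: star_mult Y_def m_assoc)
  also have "\<dots> = Y \<otimes> star A v" by (rule D_commute[OF D_star[OF v] Y])
  finally have mn: "star A m \<otimes> n = Y \<otimes> star A v" .
  have "star A v \<otimes> m = star A v0 \<otimes> d.cfc p m"
    unfolding v_def by (rule d.cfc_star[OF p]) simp_all
  also have "d.cfc p m = d.cfc (\<lambda>t. p t * f t) (n \<otimes> v)"
    unfolding m_def by (rule d.cfc_mult[symmetric, OF p f(1)]) simp
  also have "\<dots> = \<zero>" by (rule d.cfc_zero) (simp_all add: pf)
  finally have vm: "star A v \<otimes> m = \<zero>" by simp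
  have "k \<otimes> n \<otimes> k = m \<otimes> ((star A m \<otimes> n) \<otimes> m) \<otimes> star A m"
    by (simp add: k_def m_assoc)
  also have "(star A m \<otimes> n) \<otimes> m = Y \<otimes> (star A v \<otimes> m)"
    unfolding mn using Y by (simp add: m_assoc)
  also have "\<dots> = \<zero>" using Y by (simp add: vm)
  finally have knk: "k \<otimes> n \<otimes> k = \<zero>" by simp
  have "c \<otimes> k = \<zero>" if c: "c \<in> D" "c \<otimes> n = \<zero>" for c
  proof -
    have cA: "c \<in> carrier A" using c by simp
    have "c \<otimes> m = d.cfc f (c \<otimes> (n \<otimes> v))"
      unfolding m_def using cA D_commute[OF d_in c(1)] by (intro d.cfc_commute[symmetric, OF f(1)]) auto
    also have "c \<otimes> (n \<otimes> v) = \<zero>" using c cA by (simp flip: m_assoc)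
    also have "d.cfc f \<zero> = \<zero>" by (rule d.cfc_zero_arg[OF f(1)])
    finally have "c \<otimes> m = \<zero>" .
    then show ?thesis using cA by (simp add: k_def flip: m_assoc)
  qed
  then show ?thesis using kD k0 ks knk by blast
qed

end

context cartan
begin

text \<open>In the expansion each factor of \<open>n\<close> meets a star of \<open>n\<close> around
  an element of \<open>D\<close> or around nothing, so all four terms lie in \<open>D\<close>. The
  result is an element of \<open>D\<close> that detects where \<open>n\<close> fails to commute with
  \<open>d\<close>.\<close>

lemma normalizer_commutator_sq:
  assumes n: "n \<in> normalizers D A" and d: "d \<in> D" "star A d = d"
  shows "star A (d \<otimes> n \<ominus> n \<otimes> d) \<otimes> (d \<otimes> n \<ominus> n \<otimes> d) \<in> D"
proof -
  have [simp]: "n \<in> carrier A" "d \<in> carrier A" using n d by auto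
  let ?a = "star A n \<otimes> (d \<otimes> d) \<otimes> n" and ?b = "star A n \<otimes> d \<otimes> n \<otimes> d"
    and ?c = "d \<otimes> (star A n \<otimes> d \<otimes> n)" and ?e = "d \<otimes> (star A n \<otimes> n) \<otimes> d"
  have "star A (d \<otimes> n \<ominus> n \<otimes> d) = star A n \<otimes> d \<ominus> d \<otimes> star A n"
    by (simp add: star_diff star_mult d)
  then have "star A (d \<otimes> n \<ominus> n \<otimes> d) \<otimes> (d \<otimes> n \<ominus> n \<otimes> d)
      = (star A n \<otimes> d \<ominus> d \<otimes> star A n) \<otimes> (d \<otimes> n) \<ominus> (star A n \<otimes> d \<ominus> d \<otimes> star A n) \<otimes> (n \<otimes> d)"
    by (simp add: mult_diff_right del: mult_diff_left)
  also have "\<dots> = (?a \<ominus> ?c) \<ominus> (?b \<ominus> ?e)"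
    by (simp add: mult_diff_left m_assoc)
  also have "\<dots> \<in> D"
    by (intro D_diff D_mult normalizer_conj_star[OF n] normalizer_star_self[OF n] d)
  finally show ?thesis .
qed

text \<open>Let \<delta> be the commutator with a self-adjoint \<open>d\<close>, and
  \<open>v\<close> a piece of \<open>D\<close> on which \<open>d\<close> is nearly a number
  \<open>l\<close>. If \<open>n v\<close> stayed where \<open>d\<close> is near \<open>l\<close>,
  then \<delta> v would be too small for a \<open>v\<close> on which \<delta>* \<delta> is
  invertible. So part of \<open>n v\<close> moves away and \<open>normalizer_displacement\<close>
  applies. The clause on \<open>c\<close> places \<open>k\<close> under the range of
  \<open>n\<close>; \<open>local_normalizer\<close> needs it to see that a product is
  nonzero.\<close>

lemma noncommuting_normalizer:
  assumes n: "n \<in> normalizers D A" and nc: "\<not> (\<forall>d\<in>D. n \<otimes> d = d \<otimes> n)"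
  shows "\<exists>k\<in>D. k \<noteq> \<zero> \<and> star A k = k \<and> k \<otimes> n \<otimes> k = \<zero> \<and> (\<forall>c\<in>D. c \<otimes> n = \<zero> \<longrightarrow> c \<otimes> k = \<zero>)"
proof -
  have nA [simp]: "n \<in> carrier A" using n by simp
  have "\<exists>d\<in>D. star A d = d \<and> n \<otimes> d \<noteq> d \<otimes> n"
  proof (rule ccontr)
    assume "\<not> ?thesis"
    then have comm: "n \<otimes> d = d \<otimes> n" if "d \<in> D" "star A d = d" for d
      using that by blast
    have "n \<otimes> y = y \<otimes> n" if y: "y \<in> D" for y
    proof -
      have yA: "y \<in> carrier A" using y by simp
      note dec = cartesian_decomposition[OF yA]
      let ?a = "(1/2) \<odot> (y \<oplus> star A y)" and ?b = "(- \<i> / 2) \<odot> (y \<ominus> star A y)"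
      have "?a \<in> D" "?b \<in> D" using y by (intro D_smult D_add D_diff D_star; assumption)+
      then have "n \<otimes> (?a \<oplus> \<i> \<odot> ?b) = (?a \<oplus> \<i> \<odot> ?b) \<otimes> n"
        using comm[OF _ dec(3)] comm[OF _ dec(4)]
        by (simp only: r_distr[OF dec(1) smult_closed[OF _ dec(2)] nA] l_distr[OF dec(1) smult_closed[OF _ dec(2)] nA]
            smult_m_left[OF dec(2) nA] smult_m_right[OF nA dec(2)] complex_ring_simps)
      then show ?thesis using dec(5) by simp
    qed
    then show False using nc by blast
  qed
  then obtain d where d: "d \<in> D" "star A d = d" "n \<otimes> d \<noteq> d \<otimes> n" by blast
  have dA [simp]: "d \<in> carrier A" using d by simp
  define R where "R = nrm A d"
  have "d \<noteq> \<zero>" using d by auto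
  then have R: "0 < R" by (simp add: R_def nrm_pos)
  interpret cartan_elt A D E d R
    by unfold_locales (use d R in \<open>auto simp: R_def\<close>)
  define \<delta> where "\<delta> = d \<otimes> n \<ominus> n \<otimes> d"
  have dn: "d \<otimes> n \<noteq> n \<otimes> d" using d(3) by (rule not_sym)
  have \<delta> [simp]: "\<delta> \<in> carrier A" "\<delta> \<noteq> \<zero>" by (simp_all add: \<delta>_def dn)
  define w where "w = star A \<delta> \<otimes> \<delta>"
  have "w \<in> D"
    unfolding w_def \<delta>_def by (rule normalizer_commutator_sq[OF n d(1,2)])
  moreover have "star A w = w" "w \<noteq> \<zero>"
    using star_mult_self_eq_zero[of \<delta>] by (auto simp: w_def star_mult)
  ultimately have w: "w \<in> D" "star A w = w" "w \<noteq> \<zero>" by auto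
  obtain u v0 where u: "u \<in> D" and v0: "v0 \<in> D" "w \<otimes> u \<otimes> v0 = v0" "v0 \<noteq> \<zero>"
    using local_unit[OF D_subalgebra w] by metis
  have [simp]: "u \<in> carrier A" "v0 \<in> carrier A" "w \<in> carrier A" using u v0 w by auto
  define C where "C = nrm A u * nrm A \<delta> * nrm A n"
  have C: "0 \<le> C" by (simp add: C_def nrm_nonneg)
  \<comment> \<open>The contradiction will be that the norm of \<open>v\<close> is at most
    \<open>4 * e * C\<close> times itself.\<close>
  define e where "e = 1 / (4 * (C + 1))"
  have e: "0 < e" "4 * e * C < 1" using C by (auto simp: e_def field_simps)
  obtain p l where p: "continuous_on {-R..R} p" "\<And>t. p t \<noteq> 0 \<Longrightarrow> \<bar>t - l\<bar> \<le> e" "d.cfc p v0 \<noteq> \<zero>"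
    using hat_partition[of v0 e] v0 e by auto
  \<comment> \<open>A plateau: 1 within distance \<open>e\<close> of \<open>l\<close>, hence on the
    support of \<open>p\<close>, and 0 beyond distance \<open>2 * e\<close>. So 1 - s and p have
    product 0.\<close>
  define s where "s t = min 1 (max 0 (2 - \<bar>t - l\<bar> / e))" for t
  have sc: "continuous_on S s" for S
    unfolding s_def using e by (intro continuous_intros) auto
  have sp: "p t * s t = p t" for t
    using p(2)[of t] e by (cases "p t = 0") (auto simp: s_def field_simps)
  have s01: "0 \<le> s t" "s t \<le> 1" for t by (auto simp: s_def)
  have s2: "\<bar>(t - l) * s t\<bar> \<le> 2 * e" for t
  proof (cases "\<bar>t - l\<bar> \<le> 2 * e")
    case True
    have "\<bar>t - l\<bar> * \<bar>s t\<bar> \<le> 2 * e * 1" using True s01[of t] e by (intro mult_mono) auto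
    then show ?thesis by (simp add: abs_mult)
  next
    case False
    then have "s t = 0" using e by (simp add: s_def field_simps)
    then show ?thesis using e by simp
  qed
  define v where "v = d.cfc p v0"
  have v: "v \<in> D" "v \<noteq> \<zero>" unfolding v_def using p cfc_in_D[OF p(1) v0(1)] by auto
  have [simp]: "v \<in> carrier A" using v by simp
  have "d.cfc (\<lambda>t. 1 - s t) (n \<otimes> v) \<noteq> \<zero>"
  proof
    assume 0: "d.cfc (\<lambda>t. 1 - s t) (n \<otimes> v) = \<zero>"
    have mu: "d.cfc (\<lambda>t. t - l) y = d \<otimes> y \<ominus> complex_of_real l \<odot> y" if y: "y \<in> carrier A" for y
    proof -
      have "d.cfc (\<lambda>t. t - l) y = d.cfc (\<lambda>t. t + - l) y" by simp
      also have "\<dots> = d.cfc (\<lambda>t. t) y \<oplus> d.cfc (\<lambda>t. - l) y"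
        by (intro d.cfc_add continuous_intros y)
      also have "\<dots> = d \<otimes> y \<ominus> complex_of_real l \<odot> y"
        using y by (simp add: d.cfc_id d.cfc_const smult_minus_left a_minus_def)
      finally show ?thesis .
    qed
    have small: "nrm A (d.cfc (\<lambda>t. t - l) y) \<le> 2 * e * nrm A y"
      if y: "y \<in> carrier A" "d.cfc s y = y" for y
    proof -
      have "d.cfc (\<lambda>t. t - l) y = d.cfc (\<lambda>t. t - l) (d.cfc s y)" using y by simp
      also have "\<dots> = d.cfc (\<lambda>t. (t - l) * s t) y"
        by (intro d.cfc_mult[symmetric] continuous_intros sc y)
      finally have "nrm A (d.cfc (\<lambda>t. t - l) y) = nrm A (d.cfc (\<lambda>t. (t - l) * s t) y)" by simp
      also have "\<dots> \<le> 2 * e * nrm A y"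
        by (intro d.nrm_cfc_le s2 y continuous_intros sc)
      finally show ?thesis .
    qed
    have "n \<otimes> v = d.cfc (\<lambda>t. (1 - s t) + s t) (n \<otimes> v)"
      by (rule d.cfc_one[symmetric]) auto
    also have "\<dots> = d.cfc (\<lambda>t. 1 - s t) (n \<otimes> v) \<oplus> d.cfc s (n \<otimes> v)"
      by (intro d.cfc_add continuous_intros sc) auto
    finally have snv: "d.cfc s (n \<otimes> v) = n \<otimes> v" using 0 sc by simp
    have "d.cfc s v = d.cfc (\<lambda>t. s t * p t) v0"
      unfolding v_def by (intro d.cfc_mult[symmetric] sc p(1)) simp
    also have "\<dots> = v" by (simp add: v_def mult.commute[of "s _"] sp)
    finally have sv: "d.cfc s v = v" .
    \<comment> \<open>Subtracting the scalar \<open>l\<close> from \<open>d\<close> does not change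
      the commutator, and d - l is small on both \<open>n v\<close> and \<open>v\<close>.\<close>
    have "\<delta> \<otimes> v = (d \<otimes> (n \<otimes> v) \<ominus> complex_of_real l \<odot> (n \<otimes> v)) \<ominus> n \<otimes> (d \<otimes> v \<ominus> complex_of_real l \<odot> v)"
    proof -
      let ?x = "d \<otimes> (n \<otimes> v)" and ?y = "n \<otimes> (d \<otimes> v)" and ?z = "complex_of_real l \<odot> (n \<otimes> v)"
      have "(?x \<ominus> ?z) \<ominus> (?y \<ominus> ?z) = (?x \<ominus> ?z) \<oplus> (?z \<ominus> ?y)"
        unfolding a_minus_def[of A "?x \<ominus> ?z"] by (simp add: minus_diff)
      also have "\<dots> = ?x \<ominus> ?y" by (simp add: diff_add_diff)
      finally show ?thesis
        by (simp add: \<delta>_def mult_diff_left mult_diff_right smult_m_right m_assoc)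
    qed
    also have "\<dots> = d.cfc (\<lambda>t. t - l) (n \<otimes> v) \<ominus> n \<otimes> d.cfc (\<lambda>t. t - l) v"
      by (simp add: mu)
    finally have "nrm A (\<delta> \<otimes> v) = nrm A (d.cfc (\<lambda>t. t - l) (n \<otimes> v) \<ominus> n \<otimes> d.cfc (\<lambda>t. t - l) v)"
      by simp
    also have "\<dots> \<le> nrm A (d.cfc (\<lambda>t. t - l) (n \<otimes> v)) + nrm A (n \<otimes> d.cfc (\<lambda>t. t - l) v)"
      by (intro nrm_diff_le) (simp_all add: mu)
    also have "\<dots> \<le> 2 * e * nrm A (n \<otimes> v) + nrm A n * nrm A (d.cfc (\<lambda>t. t - l) v)"
      by (intro add_mono small snv nrm_mult) (simp_all add: mu)
    also have "\<dots> \<le> 2 * e * (nrm A n * nrm A v) + nrm A n * (2 * e * nrm A v)"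
      using e by (intro add_mono mult_left_mono small sv nrm_mult) (simp_all add: nrm_nonneg)
    finally have dv: "nrm A (\<delta> \<otimes> v) \<le> 4 * e * nrm A n * nrm A v" by simp
    have wu: "w \<otimes> u \<in> D" using w u by (intro D_mult)
    \<comment> \<open>The identity \<open>w \<otimes> u \<otimes> v0 = v0\<close> passes to
      \<open>v\<close>: written with right multiplication, it is untouched by p(d).\<close>
    have "v0 = v0 \<otimes> (w \<otimes> u)" using v0(2) D_commute[OF v0(1) wu] by simp
    then have "d.cfc p v0 = d.cfc p v0 \<otimes> (w \<otimes> u)"
      using d.cfc_mult_arg[OF p(1), of v0 "w \<otimes> u"] by simp
    then have "v = v \<otimes> (w \<otimes> u)" by (simp only: v_def)
    also have "\<dots> = (w \<otimes> u) \<otimes> v" by (rule D_commute[OF v(1) wu])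
    also have "\<dots> = u \<otimes> (star A \<delta> \<otimes> (\<delta> \<otimes> v))"
      using D_commute[OF w(1) u] by (simp add: w_def m_assoc)
    finally have "nrm A v = nrm A (u \<otimes> (star A \<delta> \<otimes> (\<delta> \<otimes> v)))" by simp
    also have "\<dots> \<le> nrm A u * nrm A (star A \<delta> \<otimes> (\<delta> \<otimes> v))"
      by (intro nrm_mult) auto
    also have "\<dots> \<le> nrm A u * (nrm A \<delta> * nrm A (\<delta> \<otimes> v))"
      using nrm_mult[of "star A \<delta>" "\<delta> \<otimes> v"] by (intro mult_left_mono) (auto simp: nrm_nonneg)
    also have "\<dots> \<le> nrm A u * (nrm A \<delta> * (4 * e * nrm A n * nrm A v))"
      by (intro mult_left_mono dv) (auto simp: nrm_nonneg)
    also have "\<dots> = (4 * e * C) * nrm A v" by (simp add: C_def)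
    also have "\<dots> < 1 * nrm A v" using e(2) v by (intro mult_strict_right_mono nrm_pos) auto
    finally show False by simp
  qed
  then show ?thesis
    unfolding v_def
    by (intro normalizer_displacement[OF n v0(1) _ _ p(1)])
       (use s01 sp in \<open>auto intro!: continuous_intros sc simp: right_diff_distrib\<close>)
qed

text \<open>For \<open>h = g g*\<close> either h n h commutes with \<open>D\<close> and lies in
  \<open>D\<close> by \<open>masa\<close>, or a further cut by some \<open>k\<close> reduces it to
  zero. In both cases the compression lies in \<open>D\<close>.\<close>

lemma local_normalizer:
  assumes n: "n \<in> normalizers D A" and g: "g \<in> D" "g \<noteq> \<zero>"
  shows "\<exists>k\<in>D. g \<otimes> k \<noteq> \<zero> \<and> (g \<otimes> k) \<otimes> n \<otimes> (g \<otimes> k) \<in> D"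
proof -
  have [simp]: "n \<in> carrier A" "g \<in> carrier A" using n g by auto
  define h where "h = g \<otimes> star A g"
  have h: "h \<in> D" "star A h = h" "h \<noteq> \<zero>"
    unfolding h_def using g mult_star_self_eq_zero[of g] by (auto simp: star_mult intro: D_mult D_star)
  have [simp]: "h \<in> carrier A" using h by simp
  have hnh: "h \<otimes> n \<otimes> h \<in> normalizers D A" by (rule normalizer_mult[OF n h(1) h(1)])
  show ?thesis
  proof (cases "\<forall>d\<in>D. (h \<otimes> n \<otimes> h) \<otimes> d = d \<otimes> (h \<otimes> n \<otimes> h)")
    case True
    then have "h \<otimes> n \<otimes> h \<in> D" by (intro masa) auto
    then show ?thesis using h g by (intro bexI[of _ "star A g"]) (auto simp: h_def D_star)
  next
    case False
    from noncommuting_normalizer[OF hnh this] obtain k where k: "k \<in> D" "k \<noteq> \<zero>" "star A k = k"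
      "k \<otimes> (h \<otimes> n \<otimes> h) \<otimes> k = \<zero>" and kc: "\<And>c. c \<in> D \<Longrightarrow> c \<otimes> (h \<otimes> n \<otimes> h) = \<zero> \<Longrightarrow> c \<otimes> k = \<zero>"
      by blast
    have [simp]: "k \<in> carrier A" using k by simp
    have hk: "h \<otimes> k = k \<otimes> h" using h k by (intro D_commute)
    \<comment> \<open>Otherwise \<open>k\<close> would annihilate h n h, hence also itself by the
      clause on \<open>c\<close>.\<close>
    have "h \<otimes> k \<noteq> \<zero>"
    proof
      assume "h \<otimes> k = \<zero>"
      then have "k \<otimes> (h \<otimes> n \<otimes> h) = \<zero>" unfolding hk by (simp flip: m_assoc)
      then have "k \<otimes> k = \<zero>" by (rule kc[OF k(1)])
      then show False using k star_mult_self_eq_zero[of k] by simp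
    qed
    moreover have "(h \<otimes> k) \<otimes> n \<otimes> (h \<otimes> k) = k \<otimes> (h \<otimes> n \<otimes> h) \<otimes> k"
      by (subst hk) (simp add: m_assoc)
    ultimately show ?thesis
      using k g by (intro bexI[of _ "star A g \<otimes> k"]) (auto simp: h_def D_star m_assoc intro: D_mult)
  qed
qed

text \<open>Quantifying over every nonzero \<open>g\<close> makes the property additive: the cut
  found for one summand is the starting point for the next.\<close>

lemma local_span:
  assumes s: "s \<in> clinear_span (normalizers D A) A" and g: "g \<in> D" "g \<noteq> \<zero>"
  shows "\<exists>k\<in>D. g \<otimes> k \<noteq> \<zero> \<and> (g \<otimes> k) \<otimes> s \<otimes> (g \<otimes> k) \<in> D"
proof -
  let ?V = "{s \<in> carrier A. \<forall>g\<in>D. g \<noteq> \<zero> \<longrightarrow> (\<exists>k\<in>D. g \<otimes> k \<noteq> \<zero> \<and> (g \<otimes> k) \<otimes> s \<otimes> (g \<otimes> k) \<in> D)}"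
  have "csubspace ?V A"
    unfolding csubspace_iff
  proof (intro conjI ballI allI)
    show "?V \<subseteq> carrier A" by blast
    have "g \<otimes> star A g \<noteq> \<zero>" "star A g \<in> D" if "g \<in> D" "g \<noteq> \<zero>" for g
      using that mult_star_self_eq_zero[of g] D_star by auto
    then show "\<zero> \<in> ?V" by fastforce
  next
    fix s t assume s: "s \<in> ?V" and t: "t \<in> ?V"
    have "\<exists>k\<in>D. g \<otimes> k \<noteq> \<zero> \<and> (g \<otimes> k) \<otimes> (s \<oplus> t) \<otimes> (g \<otimes> k) \<in> D" if g: "g \<in> D" "g \<noteq> \<zero>" for g
    proof -
      obtain k where k: "k \<in> D" "g \<otimes> k \<noteq> \<zero>" "(g \<otimes> k) \<otimes> s \<otimes> (g \<otimes> k) \<in> D" using s g by blast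
      have gk: "g \<otimes> k \<in> D" using g k by (intro D_mult)
      then obtain l where l: "l \<in> D" "g \<otimes> k \<otimes> l \<noteq> \<zero>" "(g \<otimes> k \<otimes> l) \<otimes> t \<otimes> (g \<otimes> k \<otimes> l) \<in> D"
        using t k by blast
      have sA: "s \<in> carrier A" "t \<in> carrier A" using s t by auto
      \<comment> \<open>The second cut \<open>l\<close> commutes with the first, so it only
        multiplies an element already in \<open>D\<close> on both sides.\<close>
      have "(g \<otimes> k \<otimes> l) \<otimes> s \<otimes> (g \<otimes> k \<otimes> l) = (l \<otimes> (g \<otimes> k)) \<otimes> s \<otimes> (g \<otimes> k \<otimes> l)"
        using D_commute[OF gk l(1)] by simp
      also have "\<dots> = l \<otimes> ((g \<otimes> k) \<otimes> s \<otimes> (g \<otimes> k)) \<otimes> l"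
        using g k l sA by (simp add: m_assoc)
      also have "\<dots> \<in> D" by (rule D_mult[OF D_mult[OF l(1) k(3)] l(1)])
      finally have "(g \<otimes> k \<otimes> l) \<otimes> s \<otimes> (g \<otimes> k \<otimes> l) \<oplus> (g \<otimes> k \<otimes> l) \<otimes> t \<otimes> (g \<otimes> k \<otimes> l) \<in> D"
        using l by (intro D_add)
      then show ?thesis
        using g k l sA by (intro bexI[of _ "k \<otimes> l"] conjI) (auto simp: l_distr r_distr m_assoc intro: D_mult)
    qed
    then show "s \<oplus> t \<in> ?V" using s t by auto
  next
    fix c s assume s: "s \<in> ?V"
    have "\<exists>k\<in>D. g \<otimes> k \<noteq> \<zero> \<and> (g \<otimes> k) \<otimes> (c \<odot> s) \<otimes> (g \<otimes> k) \<in> D" if g: "g \<in> D" "g \<noteq> \<zero>" for g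
    proof -
      obtain k where k: "k \<in> D" "g \<otimes> k \<noteq> \<zero>" "(g \<otimes> k) \<otimes> s \<otimes> (g \<otimes> k) \<in> D" using s g by blast
      have "(g \<otimes> k) \<otimes> (c \<odot> s) \<otimes> (g \<otimes> k) = c \<odot> ((g \<otimes> k) \<otimes> s \<otimes> (g \<otimes> k))"
        using g k s by (simp add: smult_m_left smult_m_right)
      then show ?thesis using k D_smult[OF k(3), of c] by (intro bexI[of _ k]) auto
    qed
    then show "c \<odot> s \<in> ?V" using s by auto
  qed
  moreover have "normalizers D A \<subseteq> ?V"
    using local_normalizer by auto
  ultimately have "clinear_span (normalizers D A) A \<subseteq> ?V"
    unfolding clinear_span_def by (intro hull_minimal)
  then show ?thesis using s g by blast
qed

end

section \<open>The ideal intersection property\<close>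

context cartan
begin

text \<open>A one-sided form of the ideal intersection property of Cartan inclusions.\<close>

lemma annihilating_zero:
  assumes x: "x \<in> carrier A"
    and P: "P \<subseteq> carrier A" "\<And>a y. \<lbrakk>a \<in> carrier A; y \<in> P\<rbrakk> \<Longrightarrow> a \<otimes> y \<in> P"
    and xP: "\<And>y. y \<in> P \<Longrightarrow> x \<otimes> y = \<zero>"
    and DP: "\<And>d. \<lbrakk>d \<in> D; \<And>y. y \<in> P \<Longrightarrow> d \<otimes> y = \<zero>\<rbrakk> \<Longrightarrow> d = \<zero>"
  shows "x = \<zero>"
proof (rule ccontr)
  assume "x \<noteq> \<zero>"
  define b where "b = star A x \<otimes> x"
  have b [simp]: "b \<in> carrier A" using x by (simp add: b_def)
  have bP: "b \<otimes> y = \<zero>" if "y \<in> P" for y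
  proof -
    have "y \<in> carrier A" using that P by blast
    then show ?thesis using x xP[OF that] by (simp add: b_def m_assoc)
  qed
  define e where "e = E b"
  have e: "e \<in> D" unfolding e_def by (rule E_in[OF b])
  have e0: "e \<noteq> \<zero>" using E_faithful[OF x] \<open>x \<noteq> \<zero>\<close> by (auto simp: e_def b_def)
  have "b \<in> cstar_positive A" using x by (auto simp: cstar_positive_def b_def)
  then have "e \<in> cstar_positive A" unfolding e_def by (rule E_positive)
  then have es: "star A e = e" by (auto simp: cstar_positive_def star_mult)
  obtain w g where w: "w \<in> D" and g: "g \<in> D" "e \<otimes> w \<otimes> g = g" "g \<noteq> \<zero>"
    using local_unit[OF D_subalgebra e es e0] by metis
  \<comment> \<open>For z = f y the proof ends with the norm of z at most
    \<open>2 * \<delta> * nrm A w\<close> times itself.\<close>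
  define \<delta> where "\<delta> = 1 / (4 * (nrm A w + 1))"
  have [simp]: "w \<in> carrier A" "g \<in> carrier A" "e \<in> carrier A" using w g e by auto
  have wn: "0 \<le> nrm A w" by (simp add: nrm_nonneg)
  then have \<delta>: "0 < \<delta>" "2 * \<delta> * nrm A w < 1" by (auto simp: \<delta>_def field_simps)
  obtain s where s: "s \<in> clinear_span (normalizers D A) A" "s \<in> carrier A" "nrm A (b \<ominus> s) < \<delta>"
    using span_approx[OF b \<delta>(1)] .
  obtain k where k: "k \<in> D" "g \<otimes> k \<noteq> \<zero>" "(g \<otimes> k) \<otimes> s \<otimes> (g \<otimes> k) \<in> D"
    using local_span[OF s(1) g(1) g(3)] by blast
  define h' where "h' = g \<otimes> k"
  have h': "h' \<in> D" unfolding h'_def using g k by (intro D_mult)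
  have [simp]: "k \<in> carrier A" "h' \<in> carrier A" using k h' by auto
  have "h' \<noteq> \<zero>" using k by (simp add: h'_def)
  define h where "h = h' \<otimes> star A h'"
  have h: "h \<in> D" "star A h = h" "h \<noteq> \<zero>"
    unfolding h_def using h' \<open>h' \<noteq> \<zero>\<close> mult_star_self_eq_zero[of h']
    by (auto simp: star_mult intro: D_mult D_star)
  obtain u f where u: "u \<in> D" and f: "f \<in> D" "nrm A (h \<otimes> u) \<le> 1" "h \<otimes> u \<otimes> f = f" "f \<noteq> \<zero>"
    using local_unit[OF D_subalgebra h] by metis
  have [simp]: "u \<in> carrier A" "f \<in> carrier A" "h \<in> carrier A" using u f h by auto
  \<comment> \<open>\<open>c = h u = h' r\<close> has norm at most 1, fixes \<open>f\<close>, and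
    contains the factor \<open>h'\<close>; hence c s c again lies in \<open>D\<close>.\<close>
  define r where "r = star A h' \<otimes> u"
  have r: "r \<in> D" unfolding r_def by (intro D_mult D_star h' u)
  define c where "c = h' \<otimes> r"
  have c: "c \<in> D" unfolding c_def by (intro D_mult h' r)
  have [simp]: "r \<in> carrier A" "c \<in> carrier A" using r c by auto
  have chu: "c = h \<otimes> u" by (simp add: c_def r_def h_def m_assoc)
  have c1: "nrm A c \<le> 1" and cf: "c \<otimes> f = f" using f by (simp_all add: chu)
  have "c \<otimes> s \<otimes> c = r \<otimes> (h' \<otimes> s \<otimes> h') \<otimes> r"
    using s(2) D_commute[OF h' r] by (simp add: c_def m_assoc)
  also have "\<dots> \<in> D" by (rule D_mult[OF D_mult[OF r k(3)[folded h'_def]] r])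
  finally have "E (c \<otimes> s \<otimes> c) = c \<otimes> s \<otimes> c" by (rule E_D)
  then have csc: "c \<otimes> s \<otimes> c = c \<otimes> E s \<otimes> c"
    using s(2) c by (simp add: E_mult_left E_mult_right)
  have "f \<otimes> y = \<zero>" if y: "y \<in> P" for y
  proof (rule ccontr)
    assume ne: "f \<otimes> y \<noteq> \<zero>"
    have yA [simp]: "y \<in> carrier A" using y P by blast
    let ?z = "f \<otimes> y"
    have cz: "c \<otimes> ?z = ?z" using cf by (simp flip: m_assoc)
    have bz: "b \<otimes> ?z = \<zero>" by (rule bP[OF P(2)[OF _ y]]) simp
    have gz: "e \<otimes> w \<otimes> ?z = ?z"
    proof -
      have "f = c \<otimes> f" using cf by simp
      also have "\<dots> = g \<otimes> (k \<otimes> r \<otimes> f)" by (simp add: c_def h'_def m_assoc)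
      finally have f': "f = g \<otimes> (k \<otimes> r \<otimes> f)" .
      have "e \<otimes> w \<otimes> f = (e \<otimes> w \<otimes> g) \<otimes> (k \<otimes> r \<otimes> f)"
        by (subst f') (simp add: m_assoc)
      also have "\<dots> = f" unfolding g(2) using f' by simp
      finally show ?thesis by (simp flip: m_assoc)
    qed
    have Es [simp]: "E s \<in> carrier A" using s(2) by simp
    have "c \<otimes> (E s \<otimes> ?z) = c \<otimes> E s \<otimes> (c \<otimes> ?z)"
      unfolding cz by (simp add: m_assoc)
    also have "\<dots> = (c \<otimes> E s \<otimes> c) \<otimes> ?z" by (simp add: m_assoc)
    also have "\<dots> = (c \<otimes> s \<otimes> c) \<otimes> ?z" unfolding csc ..
    also have "\<dots> = c \<otimes> (s \<otimes> (c \<otimes> ?z))" using s(2) by (simp add: m_assoc)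
    also have "\<dots> = c \<otimes> (s \<otimes> ?z)" unfolding cz ..
    also have "\<dots> = c \<otimes> ((s \<ominus> b) \<otimes> ?z)" using s(2) by (simp add: bz mult_diff_left)
    finally have t1: "c \<otimes> (E s \<otimes> ?z) = c \<otimes> ((s \<ominus> b) \<otimes> ?z)" .
    \<comment> \<open>As \<open>b\<close> kills \<open>?z\<close> and c s c = c E(s) c, the element
      e z is c (e - E s) z + c (s - b) z. Both differences have norm below \<delta>, while z = w e
      z.\<close>
    have "e \<otimes> ?z = e \<otimes> (c \<otimes> ?z)" unfolding cz ..
    also have "\<dots> = (e \<otimes> c) \<otimes> ?z" by (simp add: m_assoc)
    also have "\<dots> = c \<otimes> (e \<otimes> ?z)" unfolding D_commute[OF e c] by (simp add: m_assoc)
    also have "\<dots> = c \<otimes> ((e \<ominus> E s) \<otimes> ?z \<oplus> E s \<otimes> ?z)" by (simp add: mult_diff_left)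
    also have "\<dots> = c \<otimes> ((e \<ominus> E s) \<otimes> ?z) \<oplus> c \<otimes> (E s \<otimes> ?z)" by (intro r_distr) simp_all
    also have "\<dots> = c \<otimes> ((e \<ominus> E s) \<otimes> ?z) \<oplus> c \<otimes> ((s \<ominus> b) \<otimes> ?z)" unfolding t1 ..
    finally have "nrm A (e \<otimes> ?z) = nrm A (c \<otimes> ((e \<ominus> E s) \<otimes> ?z) \<oplus> c \<otimes> ((s \<ominus> b) \<otimes> ?z))"
      by (rule arg_cong)
    also have "\<dots> \<le> nrm A (c \<otimes> ((e \<ominus> E s) \<otimes> ?z)) + nrm A (c \<otimes> ((s \<ominus> b) \<otimes> ?z))"
      using s(2) by (intro nrm_triangle) auto
    also have "\<dots> \<le> \<delta> * nrm A ?z + \<delta> * nrm A ?z"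
    proof (rule add_mono)
      have le: "nrm A (c \<otimes> (t \<otimes> ?z)) \<le> \<delta> * nrm A ?z" if t: "t \<in> carrier A" "nrm A t \<le> \<delta>" for t
      proof -
        have "nrm A (c \<otimes> (t \<otimes> ?z)) \<le> nrm A c * nrm A (t \<otimes> ?z)" using t by (intro nrm_mult) auto
        also have "\<dots> \<le> 1 * (nrm A t * nrm A ?z)"
          using t c1 by (intro mult_mono nrm_mult) (auto simp: nrm_nonneg)
        also have "\<dots> \<le> 1 * (\<delta> * nrm A ?z)"
          using t by (intro mult_left_mono mult_right_mono) (auto simp: nrm_nonneg)
        finally show ?thesis by simp
      qed
      have "nrm A (e \<ominus> E s) = nrm A (E (b \<ominus> s))" using s(2) by (simp add: e_def E_diff)
      also have "\<dots> \<le> nrm A (b \<ominus> s)" using s(2) by (intro E_nrm) simp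
      finally show "nrm A (c \<otimes> ((e \<ominus> E s) \<otimes> ?z)) \<le> \<delta> * nrm A ?z"
        using s by (intro le) auto
      have "nrm A (s \<ominus> b) = nrm A (b \<ominus> s)" using s(2) by (intro nrm_diff_commute) auto
      then show "nrm A (c \<otimes> ((s \<ominus> b) \<otimes> ?z)) \<le> \<delta> * nrm A ?z"
        using s by (intro le) auto
    qed
    finally have ez: "nrm A (e \<otimes> ?z) \<le> 2 * \<delta> * nrm A ?z" by simp
    have "nrm A ?z = nrm A (w \<otimes> (e \<otimes> ?z))"
      using gz D_commute[OF e w] by (simp flip: m_assoc)
    also have "\<dots> \<le> nrm A w * nrm A (e \<otimes> ?z)" by (intro nrm_mult) auto
    also have "\<dots> \<le> nrm A w * (2 * \<delta> * nrm A ?z)" by (intro mult_left_mono ez wn)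
    also have "\<dots> = (2 * \<delta> * nrm A w) * nrm A ?z" by simp
    also have "\<dots> < 1 * nrm A ?z" using \<delta>(2) ne by (intro mult_strict_right_mono nrm_pos) auto
    finally show False by simp
  qed
  then have "f = \<zero>" by (rule DP[OF f(1)])
  then show False using f by simp
qed

lemma mult_zero_if_normalizers:
  assumes a: "a \<in> carrier A" and m: "m \<in> carrier A"
    and 0: "\<And>n. n \<in> normalizers D A \<Longrightarrow> a \<otimes> n \<otimes> m = \<zero>" and z: "z \<in> carrier A"
  shows "a \<otimes> z \<otimes> m = \<zero>"
proof -
  let ?V = "{z \<in> carrier A. a \<otimes> z \<otimes> m = \<zero>}"
  have "csubspace ?V A"
    unfolding csubspace_iff using a m by (auto simp: l_distr r_distr smult_m_left smult_m_right)
  then have span: "clinear_span (normalizers D A) A \<subseteq> ?V"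
    unfolding clinear_span_def using 0 by (intro hull_minimal) auto
  show ?thesis
  proof (rule eq_zero_if_nrm_less)
    fix e :: real assume "0 < e"
    define K where "K = nrm A a * nrm A m + 1"
    have K: "0 < K" using nrm_nonneg[OF a] nrm_nonneg[OF m] by (auto simp: K_def intro: add_nonneg_pos)
    obtain s where s: "s \<in> clinear_span (normalizers D A) A" "s \<in> carrier A" "nrm A (z \<ominus> s) < e / K"
      using span_approx[OF z divide_pos_pos[OF \<open>0 < e\<close> K]] .
    have "a \<otimes> s \<otimes> m = \<zero>" using span s by blast
    then have "a \<otimes> z \<otimes> m = a \<otimes> (z \<ominus> s) \<otimes> m"
      using a m z s by (simp add: mult_diff_left mult_diff_right)
    then have "nrm A (a \<otimes> z \<otimes> m) \<le> nrm A (a \<otimes> (z \<ominus> s)) * nrm A m"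
      using a m z s nrm_mult[of "a \<otimes> (z \<ominus> s)" m] by simp
    also have "\<dots> \<le> (nrm A a * nrm A (z \<ominus> s)) * nrm A m"
      using a m z s by (intro mult_right_mono nrm_mult) (auto simp: nrm_nonneg)
    also have "\<dots> \<le> K * nrm A (z \<ominus> s)"
      using z s nrm_nonneg[of "z \<ominus> s"] by (simp add: K_def algebra_simps)
    also have "\<dots> < e" using s(3) K by (simp only: pos_less_divide_eq mult.commute)
    finally show "nrm A (a \<otimes> z \<otimes> m) < e" .
  qed (use a m z in simp)
qed

end

section \<open>Annihilators of ideals\<close>

context cstar_algebra
begin

lemma
  assumes "cstar_ideal J A"
  shows ideal_closed: "x \<in> J \<Longrightarrow> x \<in> carrier A"
    and ideal_mult_left: "\<lbrakk>a \<in> carrier A; x \<in> J\<rbrakk> \<Longrightarrow> a \<otimes> x \<in> J"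
    and ideal_mult_right: "\<lbrakk>a \<in> carrier A; x \<in> J\<rbrakk> \<Longrightarrow> x \<otimes> a \<in> J"
  using assms csubspace_closed by (auto simp: cstar_ideal_def)

text \<open>For \<open>x\<close> in \<open>S\<close> the products x x* and x* x also lie in
  \<open>S\<close>, so \<open>b\<close> annihilates them; they occur inside the products of
  \<open>star A b \<otimes> x\<close> and \<open>x \<otimes> star A b\<close> with their
  stars.\<close>

lemma annihilator_star:
  assumes S: "S \<subseteq> carrier A" "\<And>a x. \<lbrakk>a \<in> carrier A; x \<in> S\<rbrakk> \<Longrightarrow> a \<otimes> x \<in> S"
    "\<And>a x. \<lbrakk>a \<in> carrier A; x \<in> S\<rbrakk> \<Longrightarrow> x \<otimes> a \<in> S"
    and b: "b \<in> annihilator A S"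
  shows "star A b \<in> annihilator A S"
proof -
  have bA: "b \<in> carrier A" and b0: "\<And>x. x \<in> S \<Longrightarrow> b \<otimes> x = \<zero>" "\<And>x. x \<in> S \<Longrightarrow> x \<otimes> b = \<zero>"
    using b by (auto simp: annihilator_def)
  have "star A b \<otimes> x = \<zero> \<and> x \<otimes> star A b = \<zero>" if x: "x \<in> S" for x
  proof -
    have xA: "x \<in> carrier A" using x S by blast
    have 1: "(x \<otimes> star A x) \<otimes> b = \<zero>" "b \<otimes> (star A x \<otimes> x) = \<zero>"
      by (rule b0(2)[OF S(3)[OF _ x]], use xA in simp) (rule b0(1)[OF S(2)[OF _ x]], use xA in simp)
    have "(star A b \<otimes> x) \<otimes> star A (star A b \<otimes> x) = star A b \<otimes> ((x \<otimes> star A x) \<otimes> b)"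
      using xA bA by (simp add: star_mult m_assoc)
    also have "\<dots> = \<zero>" unfolding 1 using bA by simp
    finally have "star A b \<otimes> x = \<zero>"
      by (rule mult_star_self_eq_zero[rotated]) (use xA bA in simp)
    moreover have "star A (x \<otimes> star A b) \<otimes> (x \<otimes> star A b) = (b \<otimes> (star A x \<otimes> x)) \<otimes> star A b"
      using xA bA by (simp add: star_mult m_assoc)
    then have "star A (x \<otimes> star A b) \<otimes> (x \<otimes> star A b) = \<zero>" unfolding 1 using bA by simp
    then have "x \<otimes> star A b = \<zero>"
      by (rule star_mult_self_eq_zero[rotated]) (use xA bA in simp)
    ultimately show ?thesis ..
  qed
  then show ?thesis using bA by (simp add: annihilator_def)
qed

lemma
  assumes S: "S \<subseteq> carrier A"
  shows annihilator_closed: "b \<in> annihilator A S \<Longrightarrow> b \<in> carrier A"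
    and annihilator_mult_left: "(\<And>a x. \<lbrakk>a \<in> carrier A; x \<in> S\<rbrakk> \<Longrightarrow> x \<otimes> a \<in> S) \<Longrightarrow>
      a \<in> carrier A \<Longrightarrow> b \<in> annihilator A S \<Longrightarrow> a \<otimes> b \<in> annihilator A S"
    and annihilator_mult_right: "(\<And>a x. \<lbrakk>a \<in> carrier A; x \<in> S\<rbrakk> \<Longrightarrow> a \<otimes> x \<in> S) \<Longrightarrow>
      a \<in> carrier A \<Longrightarrow> b \<in> annihilator A S \<Longrightarrow> b \<otimes> a \<in> annihilator A S"
proof -
  have SA: "x \<in> carrier A" if "x \<in> S" for x using that S by blast
  show "b \<in> annihilator A S \<Longrightarrow> b \<in> carrier A" by (simp add: annihilator_def)
  assume a: "a \<in> carrier A" and b: "b \<in> annihilator A S"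
  then have bA: "b \<in> carrier A" and b0: "\<And>x. x \<in> S \<Longrightarrow> b \<otimes> x = \<zero>" "\<And>x. x \<in> S \<Longrightarrow> x \<otimes> b = \<zero>"
    by (auto simp: annihilator_def)
  show "a \<otimes> b \<in> annihilator A S" if r: "\<And>a x. \<lbrakk>a \<in> carrier A; x \<in> S\<rbrakk> \<Longrightarrow> x \<otimes> a \<in> S"
  proof -
    have "a \<otimes> b \<otimes> x = \<zero> \<and> x \<otimes> (a \<otimes> b) = \<zero>" if x: "x \<in> S" for x
      using a bA SA[OF x] b0(1)[OF x] b0(2)[OF r[OF a x]] by (simp add: m_assoc)
    then show ?thesis using a bA by (simp add: annihilator_def)
  qed
  show "b \<otimes> a \<in> annihilator A S" if l: "\<And>a x. \<lbrakk>a \<in> carrier A; x \<in> S\<rbrakk> \<Longrightarrow> a \<otimes> x \<in> S"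
  proof -
    have "b \<otimes> a \<otimes> x = \<zero> \<and> x \<otimes> (b \<otimes> a) = \<zero>" if x: "x \<in> S" for x
      using a bA SA[OF x] b0(1)[OF l[OF a x]] b0(2)[OF x] by (simp add: m_assoc[of b] flip: m_assoc[of x])
    then show ?thesis using a bA by (simp add: annihilator_def)
  qed
qed

end

locale cartan_regular = cartan A D E
  for A :: "('a, 'm) cstar_struct_scheme" (structure) and D E +
  fixes J :: "'a set"
  assumes regular_J: "regular_ideal J A"
begin

definition K :: "'a set" where "K = annihilator A J"

lemma J_ideal: "cstar_ideal J A"
  using regular_J by (simp add: regular_ideal_def)

lemma mem_J: "x \<in> J \<longleftrightarrow> x \<in> annihilator A K"
proof (rule arg_cong[where f = "\<lambda>S. x \<in> S"])
  show "J = annihilator A K"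
    unfolding K_def using regular_J unfolding regular_ideal_def by (rule conjunct2)
qed

lemmas J_closed' = ideal_closed[OF J_ideal]
lemmas J_left = ideal_mult_left[OF J_ideal]
lemmas J_right = ideal_mult_right[OF J_ideal]

lemma J_subset: "J \<subseteq> carrier A" using J_closed' by blast

lemma K_closed: "b \<in> K \<Longrightarrow> b \<in> carrier A"
  and K_left: "\<lbrakk>a \<in> carrier A; b \<in> K\<rbrakk> \<Longrightarrow> a \<otimes> b \<in> K"
  and K_right: "\<lbrakk>a \<in> carrier A; b \<in> K\<rbrakk> \<Longrightarrow> b \<otimes> a \<in> K"
  unfolding K_def using annihilator_closed[OF J_subset] annihilator_mult_left[OF J_subset J_right]
    annihilator_mult_right[OF J_subset J_left] by blast+

lemma K_J: "\<lbrakk>b \<in> K; j \<in> J\<rbrakk> \<Longrightarrow> b \<otimes> j = \<zero>"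
  by (simp add: K_def annihilator_def)

lemma K_star: "b \<in> K \<Longrightarrow> star A b \<in> K"
  unfolding K_def by (rule annihilator_star[OF J_subset J_left J_right])

lemma K_subset: "K \<subseteq> carrier A" using K_closed by blast

lemma J_star: "x \<in> J \<Longrightarrow> star A x \<in> J"
  unfolding mem_J by (rule annihilator_star[OF K_subset K_left K_right])

text \<open>Since d* j* lies in \<open>J\<close>, the hypothesis gives d d* j* = 0, and multiplying
  by \<open>j\<close> makes the product of j d with its star vanish.\<close>

lemma K_I:
  assumes d: "d \<in> carrier A" and 0: "\<And>j. j \<in> J \<Longrightarrow> d \<otimes> j = \<zero>"
  shows "d \<in> K"
proof -
  have "j \<otimes> d = \<zero>" if j: "j \<in> J" for j
  proof -
    have jA: "j \<in> carrier A" using j by (rule J_closed')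
    have "d \<otimes> (star A d \<otimes> star A j) = \<zero>" by (rule 0[OF J_left[OF _ J_star[OF j]]]) (use d in simp)
    then have "(j \<otimes> d) \<otimes> star A (j \<otimes> d) = \<zero>" using d jA by (simp add: star_mult m_assoc)
    then show ?thesis
      by (rule mult_star_self_eq_zero[rotated]) (use d jA in simp)
  qed
  then show ?thesis using d 0 by (simp add: K_def annihilator_def)
qed

lemma mem_J_if_annihilates:
  assumes a: "a \<in> carrier A" and 0: "\<And>m. m \<in> K \<inter> D \<Longrightarrow> a \<otimes> m = \<zero>"
  shows "a \<in> J"
proof -
  have azm: "a \<otimes> z \<otimes> m = \<zero>" if m: "m \<in> K \<inter> D" and z: "z \<in> carrier A" for m z
  proof (rule mult_zero_if_normalizers[OF a _ _ z])
    show mA: "m \<in> carrier A" using m by simp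
    fix n assume n: "n \<in> normalizers D A"
    have nA: "n \<in> carrier A" using n by simp
    \<comment> \<open>The conjugate n m m* n* lies in \<open>K \<inter> D\<close>, and a n m m* n*
      a* is the product of a n m with its star.\<close>
    have "m \<otimes> star A m \<in> K \<inter> D" using m mA by (auto intro: K_right D_mult D_star)
    then have "n \<otimes> (m \<otimes> star A m) \<otimes> star A n \<in> K \<inter> D"
      using normalizer_conj[OF n] K_right[OF star_closed[OF nA] K_left[OF nA]] by blast
    from 0[OF this] have "(a \<otimes> n \<otimes> m) \<otimes> star A (a \<otimes> n \<otimes> m) = \<zero>"
      using a nA mA by (simp add: star_mult m_assoc) (simp flip: m_assoc)
    then show "a \<otimes> n \<otimes> m = \<zero>"
      by (rule mult_star_self_eq_zero[rotated]) (use a nA mA in simp)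
  qed
  have aK: "a \<otimes> k = \<zero>" if k: "k \<in> K" for k
  proof -
    have kA: "k \<in> carrier A" using k by (rule K_closed)
    let ?x = "a \<otimes> k"
    have xK: "?x \<in> K" using a k by (rule K_left)
    \<comment> \<open>The equation \<open>?x \<otimes> y = \<zero>\<close> is listed separately, as
      there is no unit to insert for \<open>z\<close>.\<close>
    let ?P = "{y \<in> carrier A. ?x \<otimes> y = \<zero> \<and> (\<forall>z\<in>carrier A. ?x \<otimes> z \<otimes> y = \<zero>)}"
    show ?thesis
    proof (rule annihilating_zero[where P = ?P])
      show "?x \<in> carrier A" using a kA by simp
      show "b \<otimes> y \<in> ?P" if b: "b \<in> carrier A" and y: "y \<in> ?P" for b y
      proof -
        have yA: "y \<in> carrier A" and y0: "\<And>z. z \<in> carrier A \<Longrightarrow> ?x \<otimes> z \<otimes> y = \<zero>" using y by auto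
        have "?x \<otimes> (b \<otimes> y) = ?x \<otimes> b \<otimes> y" using a kA b yA by (simp add: m_assoc)
        moreover have "?x \<otimes> z \<otimes> (b \<otimes> y) = ?x \<otimes> (z \<otimes> b) \<otimes> y" if "z \<in> carrier A" for z
          using a kA b yA that by (simp add: m_assoc)
        ultimately show ?thesis using b yA y0 by simp
      qed
      fix d assume d: "d \<in> D" and dP: "\<And>y. y \<in> ?P \<Longrightarrow> d \<otimes> y = \<zero>"
      have "J \<subseteq> ?P" using K_J[OF xK] K_J[OF K_right[OF _ xK]] J_closed' by auto
      then have "d \<in> K" using d dP by (intro K_I) auto
      then have sd: "star A d \<in> K \<inter> D" using d by (auto intro: K_star D_star)
      have "?x \<otimes> z \<otimes> star A d = \<zero>" if "z \<in> carrier A" for z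
        using azm[OF sd, of "k \<otimes> z"] that a kA d by (simp add: m_assoc)
      then have "star A d \<in> ?P"
        using azm[OF sd kA] d by simp
      then have "d \<otimes> star A d = \<zero>" by (rule dP)
      then show "d = \<zero>"
        by (rule mult_star_self_eq_zero[rotated]) (use d in simp)
    qed auto
  qed
  have "k \<otimes> a = \<zero>" if k: "k \<in> K" for k
  proof -
    have kA: "k \<in> carrier A" using k by (rule K_closed)
    have "a \<otimes> (star A a \<otimes> star A k) = \<zero>" by (rule aK[OF K_left[OF _ K_star[OF k]]]) (use a in simp)
    then have "(k \<otimes> a) \<otimes> star A (k \<otimes> a) = \<zero>" using a kA by (simp add: star_mult m_assoc)
    then show ?thesis
      by (rule mult_star_self_eq_zero[rotated]) (use a kA in simp)
  qed
  then show ?thesis using a aK unfolding mem_J by (simp add: annihilator_def)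
qed

text \<open>\<open>E\<close> is linear over \<open>D\<close>, so E(a) m = E(a m), and
  \<open>a\<close> annihilates every \<open>m\<close> in \<open>K\<close>.\<close>

lemma E_J:
  assumes a: "a \<in> J"
  shows "E a \<in> J"
proof (rule mem_J_if_annihilates)
  have aA: "a \<in> carrier A" using a by (rule J_closed')
  then show "E a \<in> carrier A" by simp
  fix m assume m: "m \<in> K \<inter> D"
  have "a \<otimes> m = \<zero>" using a m unfolding mem_J by (auto simp: annihilator_def)
  then have "E a \<otimes> m = E \<zero>" using aA m by (simp flip: E_mult_right)
  then show "E a \<otimes> m = \<zero>" by (simp add: E_D)
qed

end

section \<open>The quotient by a regular ideal\<close>

sublocale cartan_regular \<subseteq> quot: star_ideal A J
  by unfold_locales (rule J_ideal, rule J_star)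

section \<open>The image of the subalgebra and the induced expectation\<close>

context cartan_regular
begin

abbreviation "Q \<equiv> cstar_quotient A J"
abbreviation "q \<equiv> \<lambda>x. J +> x"
abbreviation "DQ \<equiv> quotient_subalgebra A D J"

lemma J_mult_K: "\<lbrakk>j \<in> J; k \<in> K\<rbrakk> \<Longrightarrow> j \<otimes> k = \<zero>"
  unfolding mem_J by (simp add: annihilator_def)

lemma DQ_eq: "DQ = q ` D"
  by (rule quotient_subalgebra_eq[OF cstar_algebra_axioms D_subalgebra J_ideal])

lemma DQ_I: "d \<in> D \<Longrightarrow> q d \<in> DQ"
  by (simp add: DQ_eq)

lemma DQ_E: "C \<in> DQ \<Longrightarrow> (\<And>d. d \<in> D \<Longrightarrow> C = q d \<Longrightarrow> P) \<Longrightarrow> P"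
  by (auto simp: DQ_eq)

lemma E_complement_J: "x \<in> J \<Longrightarrow> x \<ominus> E x \<in> J"
  by (intro quot.J_diff E_J)

lemma E_complement_diff:
  "\<lbrakk>x \<in> carrier A; y \<in> carrier A\<rbrakk> \<Longrightarrow> (x \<ominus> y) \<ominus> E (x \<ominus> y) = (x \<ominus> E x) \<ominus> (y \<ominus> E y)"
  by (simp add: E_diff) (simp add: a_minus_def M.minus_add M.a_ac)

text \<open>The map sending x to x - E(x) kills \<open>D\<close>, preserves \<open>J\<close> and has
  norm at most 2. If \<open>a\<close> is close to \<open>D\<close> modulo \<open>J\<close>, its
  image is therefore close to \<open>J\<close>. This is how closedness of \<open>DQ\<close> is
  obtained.\<close>

lemma mem_DQ_limit:
  assumes a: "a \<in> carrier A" and lim: "\<And>e. 0 < e \<Longrightarrow> \<exists>d\<in>D. nrm Q (q (a \<ominus> d)) < e"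
  shows "a \<ominus> E a \<in> J"
proof (rule closedin_limit[OF quot.J_closedin])
  fix e :: real assume "0 < e"
  then obtain d where d: "d \<in> D" "nrm Q (q (a \<ominus> d)) < e / 2" using lim[of "e / 2"] by auto
  have dA: "d \<in> carrier A" using d by simp
  define x where "x = a \<ominus> d"
  have x: "x \<in> carrier A" using a dA by (simp add: x_def)
  have "0 < e / 2 - nrm Q (q x)" using d by (simp add: x_def)
  from quot.nrm_q_approx[OF x this] obtain y where y: "y \<in> carrier A" "q y = q x" "nrm A y < e / 2"
    by auto
  have "x \<ominus> y \<in> J" using y x by (simp flip: quot.q_eq_iff)
  then have v: "(x \<ominus> y) \<ominus> E (x \<ominus> y) \<in> J" by (rule E_complement_J)
  have "x \<ominus> E x = a \<ominus> E a"
    unfolding x_def using a dA d(1) by (simp only: E_complement_diff E_D diff_self) simp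
  then have "(a \<ominus> E a) \<ominus> ((x \<ominus> y) \<ominus> E (x \<ominus> y)) = y \<ominus> E y"
    using a x y by (simp only: E_complement_diff diff_diff_cancel M.minus_closed E_closed)
  moreover have "nrm A (y \<ominus> E y) \<le> nrm A y + nrm A y"
    using y by (intro order_trans[OF nrm_diff_le] add_mono E_nrm) auto
  ultimately have "nrm A ((a \<ominus> E a) \<ominus> ((x \<ominus> y) \<ominus> E (x \<ominus> y))) < e" using y by simp
  then show "\<exists>v\<in>J. nrm A ((a \<ominus> E a) \<ominus> v) < e" using v by blast
qed (use a in simp)

lemma q_in_DQ:
  assumes a: "a \<in> carrier A" and "a \<ominus> E a \<in> J"
  shows "q a \<in> DQ"
proof -
  have "q a = q (E a)" using assms by (simp add: quot.q_eq_iff)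
  then show ?thesis using DQ_I[OF E_in[OF a]] by simp
qed

lemma DQ_subalgebra: "cstar_subalgebra DQ Q"
proof -
  interpret Q: cstar_algebra Q by (rule quot.cstar_algebra_Q)
  show ?thesis
  proof (rule Q.cstar_subalgebraI)
    show "DQ \<subseteq> carrier Q" by (auto elim!: DQ_E)
    show "\<zero>\<^bsub>Q\<^esub> \<in> DQ" unfolding quot.Q_zero by (intro DQ_I D_zero)
    show "x \<oplus>\<^bsub>Q\<^esub> y \<in> DQ" if "x \<in> DQ" "y \<in> DQ" for x y
      using that by (auto elim!: DQ_E simp: quot.q_simps intro!: DQ_I D_add)
    show "c \<odot>\<^bsub>Q\<^esub> x \<in> DQ" if "x \<in> DQ" for c x
      using that by (auto elim!: DQ_E simp: quot.q_simps intro!: DQ_I D_smult)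
    show "x \<otimes>\<^bsub>Q\<^esub> y \<in> DQ" if "x \<in> DQ" "y \<in> DQ" for x y
      using that by (auto elim!: DQ_E simp: quot.q_simps intro!: DQ_I D_mult)
    show "star Q x \<in> DQ" if "x \<in> DQ" for x
      using that by (auto elim!: DQ_E simp: quot.q_simps intro!: DQ_I D_star)
    fix C assume C: "C \<in> carrier Q" and lim: "\<And>e. 0 < e \<Longrightarrow> \<exists>v\<in>DQ. nrm Q (C \<ominus>\<^bsub>Q\<^esub> v) < e"
    from C obtain a where a: "a \<in> carrier A" "C = q a" by (rule quot.Q_E)
    have "a \<ominus> E a \<in> J"
    proof (rule mem_DQ_limit[OF a(1)])
      fix e :: real assume "0 < e"
      then obtain v where v: "v \<in> DQ" "nrm Q (C \<ominus>\<^bsub>Q\<^esub> v) < e" using lim by blast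
      then show "\<exists>d\<in>D. nrm Q (q (a \<ominus> d)) < e" using a by (auto elim!: DQ_E simp: quot.q_diff)
    qed
    then show "C \<in> DQ" unfolding a(2) by (rule q_in_DQ[OF a(1)])
  qed
qed

lemma q_positive:
  assumes "u \<in> cstar_positive A"
  shows "q u \<in> cstar_positive Q"
proof -
  obtain b where b: "b \<in> carrier A" "u = star A b \<otimes> b"
    using assms unfolding cstar_positive_def by blast
  then have "q u = star Q (q b) \<otimes>\<^bsub>Q\<^esub> q b" by (simp add: quot.q_simps)
  then show ?thesis unfolding cstar_positive_def using quot.q_closed[OF b(1)] by blast
qed

lemma positive_closed: "u \<in> cstar_positive A \<Longrightarrow> u \<in> carrier A"
  by (auto simp: cstar_positive_def)

text \<open>The quotient map is contractive and preserves positivity, so the image filter of the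
  approximate unit serves again.\<close>

lemma cstar_inclusion_DQ: "cstar_inclusion DQ Q"
proof -
  obtain F where F: "approximate_unit A F" "\<forall>\<^sub>F u in F. u \<in> D"
    using regular by (auto simp: regular_inclusion_def cstar_inclusion_def)
  have F0: "F \<noteq> bot" and pos: "\<forall>\<^sub>F u in F. u \<in> cstar_positive A \<and> nrm A u \<le> 1"
    and lim: "\<And>a. a \<in> carrier A \<Longrightarrow> ((\<lambda>u. nrm A (u \<otimes> a \<ominus> a)) \<longlongrightarrow> 0) F"
      "\<And>a. a \<in> carrier A \<Longrightarrow> ((\<lambda>u. nrm A (a \<otimes> u \<ominus> a)) \<longlongrightarrow> 0) F"
    using F(1) unfolding approximate_unit_def by blast+
  have carr: "\<forall>\<^sub>F u in F. u \<in> carrier A"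
    using pos by eventually_elim (auto intro: positive_closed)
  have "approximate_unit Q (filtermap q F)"
    unfolding approximate_unit_def
  proof (intro conjI ballI)
    show "filtermap q F \<noteq> bot" using F0 by (simp add: filtermap_bot_iff)
    show "\<forall>\<^sub>F U in filtermap q F. U \<in> cstar_positive Q \<and> nrm Q U \<le> 1"
      unfolding eventually_filtermap using pos
    proof eventually_elim
      case (elim u)
      then have "u \<in> carrier A" by (auto intro: positive_closed)
      from order_trans[OF quot.nrm_q_le[OF this], of 1] show ?case
        using elim q_positive[of u] by blast
    qed
    fix C assume "C \<in> carrier Q"
    then obtain a where a: "a \<in> carrier A" "C = q a" by (rule quot.Q_E)
    have "((\<lambda>u. nrm Q (q u \<otimes>\<^bsub>Q\<^esub> C \<ominus>\<^bsub>Q\<^esub> C)) \<longlongrightarrow> 0) F"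
    proof (rule Lim_null_comparison[OF _ lim(1)[OF a(1)]])
      show "\<forall>\<^sub>F u in F. norm (nrm Q (q u \<otimes>\<^bsub>Q\<^esub> C \<ominus>\<^bsub>Q\<^esub> C)) \<le> nrm A (u \<otimes> a \<ominus> a)"
        using carr by eventually_elim (use a in \<open>simp add: quot.q_simps quot.q_diff quot.nrm_q_nonneg\<close>)
    qed
    then show "((\<lambda>U. nrm Q (U \<otimes>\<^bsub>Q\<^esub> C \<ominus>\<^bsub>Q\<^esub> C)) \<longlongrightarrow> 0) (filtermap q F)"
      by (simp add: filterlim_filtermap)
    have "((\<lambda>u. nrm Q (C \<otimes>\<^bsub>Q\<^esub> q u \<ominus>\<^bsub>Q\<^esub> C)) \<longlongrightarrow> 0) F"
    proof (rule Lim_null_comparison[OF _ lim(2)[OF a(1)]])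
      show "\<forall>\<^sub>F u in F. norm (nrm Q (C \<otimes>\<^bsub>Q\<^esub> q u \<ominus>\<^bsub>Q\<^esub> C)) \<le> nrm A (a \<otimes> u \<ominus> a)"
        using carr by eventually_elim (use a in \<open>simp add: quot.q_simps quot.q_diff quot.nrm_q_nonneg\<close>)
    qed
    then show "((\<lambda>U. nrm Q (C \<otimes>\<^bsub>Q\<^esub> U \<ominus>\<^bsub>Q\<^esub> C)) \<longlongrightarrow> 0) (filtermap q F)"
      by (simp add: filterlim_filtermap)
  qed
  moreover have "\<forall>\<^sub>F U in filtermap q F. U \<in> DQ"
    unfolding eventually_filtermap using F(2) by eventually_elim (rule DQ_I)
  ultimately show ?thesis
    unfolding cstar_inclusion_def using quot.cstar_algebra_Q DQ_subalgebra by blast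
qed

lemma q_normalizer:
  assumes n: "n \<in> normalizers D A"
  shows "q n \<in> normalizers DQ Q"
proof -
  have nA: "n \<in> carrier A" using n by simp
  show ?thesis
    unfolding normalizers_def
  proof (rule CollectI, intro conjI ballI)
    show "q n \<in> carrier Q" using nA by simp
    fix C assume "C \<in> DQ"
    then obtain d where d: "d \<in> D" "C = q d" by (rule DQ_E)
    have dA: "d \<in> carrier A" using d by simp
    show "q n \<otimes>\<^bsub>Q\<^esub> C \<otimes>\<^bsub>Q\<^esub> star Q (q n) \<in> DQ"
      using DQ_I[OF normalizer_conj[OF n d(1)]] nA dA by (simp add: d(2) quot.q_simps)
    show "star Q (q n) \<otimes>\<^bsub>Q\<^esub> C \<otimes>\<^bsub>Q\<^esub> q n \<in> DQ"
      using DQ_I[OF normalizer_conj_star[OF n d(1)]] nA dA by (simp add: d(2) quot.q_simps)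
  qed
qed

text \<open>The preimage of a subspace containing the normalizers of \<open>DQ\<close> is a subspace
  containing those of \<open>D\<close>.\<close>

lemma q_span:
  assumes s: "s \<in> clinear_span (normalizers D A) A"
  shows "q s \<in> clinear_span (normalizers DQ Q) Q"
  unfolding clinear_span_def hull_def
proof (rule InterI)
  interpret Q: cstar_algebra Q by (rule quot.cstar_algebra_Q)
  fix T assume "T \<in> {T. csubspace T Q \<and> normalizers DQ Q \<subseteq> T}"
  then have T: "csubspace T Q" "normalizers DQ Q \<subseteq> T" by auto
  let ?V = "{x \<in> carrier A. q x \<in> T}"
  have "csubspace ?V A"
    unfolding csubspace_iff
  proof (intro conjI ballI allI)
    show "\<zero> \<in> ?V" using Q.csubspace_zero[OF T(1)] by (simp add: quot.Q_zero)
    show "x \<oplus> y \<in> ?V" if "x \<in> ?V" "y \<in> ?V" for x y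
      using that Q.csubspace_add[OF T(1), of "q x" "q y"] by (simp add: quot.q_simps)
    show "c \<odot> x \<in> ?V" if "x \<in> ?V" for c x
      using that Q.csubspace_smult[OF T(1), of "q x" c] by (simp add: quot.q_simps)
  qed auto
  moreover have "normalizers D A \<subseteq> ?V" using q_normalizer T(2) by auto
  ultimately have "clinear_span (normalizers D A) A \<subseteq> ?V"
    unfolding clinear_span_def by (intro hull_minimal)
  then show "q s \<in> T" using s by blast
qed

lemma regular_inclusion_DQ: "regular_inclusion DQ Q"
proof -
  interpret Q: cstar_algebra Q by (rule quot.cstar_algebra_Q)
  have "C \<in> nrm_topology Q closure_of clinear_span (normalizers DQ Q) Q" if C: "C \<in> carrier Q" for C
    unfolding Q.closure_of_iff
  proof (intro conjI allI impI)
    from C obtain a where a: "a \<in> carrier A" "C = q a" by (rule quot.Q_E)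
    fix e :: real assume e: "0 < e"
    obtain s where s: "s \<in> clinear_span (normalizers D A) A" "s \<in> carrier A" "nrm A (a \<ominus> s) < e"
      using span_approx[OF a(1) e] .
    have "nrm Q (C \<ominus>\<^bsub>Q\<^esub> q s) \<le> nrm A (a \<ominus> s)" using a s by (simp add: quot.q_diff)
    then show "\<exists>y\<in>clinear_span (normalizers DQ Q) Q. y \<in> carrier Q \<and> nrm Q (C \<ominus>\<^bsub>Q\<^esub> y) < e"
      using s q_span[OF s(1)] by (intro bexI[of _ "q s"]) auto
  qed (rule C)
  then show ?thesis
    unfolding regular_inclusion_def using cstar_inclusion_DQ Q.closure_of_iff by blast
qed

text \<open>A representative is chosen arbitrarily; \<open>E_J\<close> makes the value independent
  of the choice.\<close>

definition EQ :: "'a set \<Rightarrow> 'a set"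
  where "EQ C = q (E (SOME x. x \<in> carrier A \<and> C = q x))"

lemma EQ_q:
  assumes x: "x \<in> carrier A"
  shows "EQ (q x) = q (E x)"
proof -
  define y where "y = (SOME y. y \<in> carrier A \<and> q x = q y)"
  have y: "y \<in> carrier A" "q x = q y"
    using someI[of "\<lambda>y. y \<in> carrier A \<and> q x = q y" x] x by (auto simp: y_def)
  then have "x \<ominus> y \<in> J" using x by (simp add: quot.q_eq_iff)
  then have "E x \<ominus> E y \<in> J" using E_J[of "x \<ominus> y"] x y by (simp add: E_diff)
  then have "q (E x) = q (E y)" using x y by (simp add: quot.q_eq_iff)
  then show ?thesis by (simp add: EQ_def y_def)
qed

lemma conditional_expectation_EQ: "conditional_expectation EQ DQ Q"
  unfolding conditional_expectation_def
proof (intro conjI ballI allI)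
  show "EQ \<in> carrier Q \<rightarrow> DQ" by (auto elim!: quot.Q_E simp: EQ_q intro!: DQ_I E_in)
  show "EQ (x \<oplus>\<^bsub>Q\<^esub> y) = EQ x \<oplus>\<^bsub>Q\<^esub> EQ y" if "x \<in> carrier Q" "y \<in> carrier Q" for x y
    using that by (auto elim!: quot.Q_E simp: EQ_q quot.q_simps E_add)
  show "EQ (c \<odot>\<^bsub>Q\<^esub> x) = c \<odot>\<^bsub>Q\<^esub> EQ x" if "x \<in> carrier Q" for c x
    using that by (auto elim!: quot.Q_E simp: EQ_q quot.q_simps E_smult)
  show "EQ x = x" if "x \<in> DQ" for x
    using that by (auto elim!: DQ_E simp: EQ_q E_D)
  fix x assume x: "x \<in> carrier Q"
  then obtain a where a: "a \<in> carrier A" "x = q a" by (rule quot.Q_E)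
  show "EQ (d \<otimes>\<^bsub>Q\<^esub> x) = d \<otimes>\<^bsub>Q\<^esub> EQ x" "EQ (x \<otimes>\<^bsub>Q\<^esub> d) = EQ x \<otimes>\<^bsub>Q\<^esub> d" if "d \<in> DQ" for d
    using that a by (auto elim!: DQ_E simp: EQ_q quot.q_simps E_mult_left E_mult_right)
  show "nrm Q (EQ x) \<le> nrm Q x"
  proof (rule field_le_epsilon)
    fix e :: real assume "0 < e"
    \<comment> \<open>Contractivity of \<open>E\<close> must be applied to a representative of
      nearly minimal norm, not to \<open>a\<close>.\<close>
    then obtain y where y: "y \<in> carrier A" "q y = q a" "nrm A y < nrm Q (q a) + e"
      using quot.nrm_q_approx[OF a(1)] by blast
    have "nrm Q (EQ x) = nrm Q (q (E y))" using y EQ_q[of y] by (simp add: a)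
    also have "\<dots> \<le> nrm A (E y)" using y by simp
    also have "\<dots> \<le> nrm A y" using y by (intro E_nrm)
    finally show "nrm Q (EQ x) \<le> nrm Q x + e" using y a by simp
  qed
next
  fix x assume "x \<in> cstar_positive Q"
  then obtain B where B: "B \<in> carrier Q" "x = star Q B \<otimes>\<^bsub>Q\<^esub> B" by (auto simp: cstar_positive_def)
  then obtain b where b: "b \<in> carrier A" "B = q b" by (auto elim: quot.Q_E)
  have "EQ x = q (E (star A b \<otimes> b))" using B b by (simp add: quot.q_simps EQ_q)
  moreover have "E (star A b \<otimes> b) \<in> cstar_positive A"
    using b by (intro E_positive) (auto simp: cstar_positive_def)
  ultimately show "EQ x \<in> cstar_positive Q" by (simp add: q_positive)
qed

lemma faithful_EQ: "faithful_map EQ Q"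
  unfolding faithful_map_def
proof (intro ballI impI)
  fix C assume "C \<in> carrier Q" and 0: "EQ (star Q C \<otimes>\<^bsub>Q\<^esub> C) = \<zero>\<^bsub>Q\<^esub>"
  then obtain a where a: "a \<in> carrier A" "C = q a" by (auto elim: quot.Q_E)
  have "q (E (star A a \<otimes> a)) = q \<zero>" using 0 a by (simp add: quot.q_simps EQ_q quot.Q_zero)
  then have Ea: "E (star A a \<otimes> a) \<in> J" using a quot.q_eq_zero_iff[of "E (star A a \<otimes> a)"] by simp
  have "a \<in> J"
  proof (rule mem_J_if_annihilates[OF a(1)])
    fix m assume m: "m \<in> K \<inter> D"
    have mA: "m \<in> carrier A" using m by simp
    have "star A (a \<otimes> m) \<otimes> (a \<otimes> m) = star A m \<otimes> ((star A a \<otimes> a) \<otimes> m)"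
      using a mA by (simp add: star_mult m_assoc)
    then have "E (star A (a \<otimes> m) \<otimes> (a \<otimes> m)) = star A m \<otimes> (E (star A a \<otimes> a) \<otimes> m)"
      using a mA m by (simp add: E_mult_left E_mult_right D_star)
    also have "E (star A a \<otimes> a) \<otimes> m = \<zero>" using Ea m by (intro J_mult_K) auto
    finally have "E (star A (a \<otimes> m) \<otimes> (a \<otimes> m)) = \<zero>" using mA by simp
    then show "a \<otimes> m = \<zero>"
      by (rule E_faithful[rotated]) (use a mA in simp)
  qed
  then show "C = \<zero>\<^bsub>Q\<^esub>" using a by (simp add: quot.Q_zero quot.q_eq_iff)
qed

lemma relative_commutant:
  assumes a: "a \<in> carrier A" and comm: "\<And>d. d \<in> D \<Longrightarrow> a \<otimes> d \<ominus> d \<otimes> a \<in> J"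
  shows "a \<ominus> E a \<in> J"
proof (rule mem_J_if_annihilates)
  show "a \<ominus> E a \<in> carrier A" using a by simp
  fix m assume m: "m \<in> K \<inter> D"
  have mA: "m \<in> carrier A" using m by simp
  have Ea: "E a \<in> D" by (rule E_in[OF a])
  let ?y = "(a \<ominus> E a) \<otimes> m"
  have "?y \<in> D"
  proof (rule masa)
    show "?y \<in> carrier A" using a mA by simp
    fix d assume d: "d \<in> D"
    have dA: "d \<in> carrier A" using d by simp
    have md: "m \<otimes> d = d \<otimes> m" using m d by (intro D_commute) auto
    have "?y \<otimes> d = (a \<otimes> d) \<otimes> m \<ominus> (E a \<otimes> d) \<otimes> m"
      using a mA dA md by (simp add: mult_diff_left m_assoc)
    moreover have "d \<otimes> ?y = (d \<otimes> a) \<otimes> m \<ominus> (d \<otimes> E a) \<otimes> m"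
      using a mA dA by (simp add: mult_diff_left mult_diff_right m_assoc)
    moreover have "(a \<otimes> d) \<otimes> m = (d \<otimes> a) \<otimes> m"
    proof -
      have "(a \<otimes> d \<ominus> d \<otimes> a) \<otimes> m = \<zero>" using comm[OF d] m by (intro J_mult_K) auto
      then show ?thesis using a mA dA by (simp add: mult_diff_left)
    qed
    ultimately show "?y \<otimes> d = d \<otimes> ?y" by (simp add: D_commute[OF Ea d])
  qed
  then have "?y = E ?y" by (rule E_D[symmetric])
  also have "\<dots> = E (a \<ominus> E a) \<otimes> m" using a m by (intro E_mult_right) auto
  also have "E (a \<ominus> E a) = \<zero>" using a E_D[OF Ea] by (simp add: E_diff)
  finally show "?y = \<zero>" using mA by simp
qed

text \<open>Any abelian \<open>B\<close> above \<open>DQ\<close> lies in the commutant of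
  \<open>DQ\<close>; for a representative this is commutation with \<open>D\<close> modulo
  \<open>J\<close>, the situation of \<open>relative_commutant\<close>.\<close>

lemma maximal_abelian_DQ: "maximal_abelian DQ Q"
  unfolding maximal_abelian_def
proof (intro conjI allI impI)
  have "x \<otimes>\<^bsub>Q\<^esub> y = y \<otimes>\<^bsub>Q\<^esub> x" if x: "x \<in> DQ" and y: "y \<in> DQ" for x y
  proof -
    from x obtain c where c: "c \<in> D" "x = q c" by (rule DQ_E)
    from y obtain d where d: "d \<in> D" "y = q d" by (rule DQ_E)
    show ?thesis using c d D_commute[OF c(1) d(1)] by (simp add: quot.q_simps)
  qed
  then show "abelian_subalgebra DQ Q"
    using DQ_subalgebra by (simp add: abelian_subalgebra_def)
  interpret Q: cstar_algebra Q by (rule quot.cstar_algebra_Q)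
  fix B assume B: "abelian_subalgebra B Q \<and> DQ \<subseteq> B"
  then have Bc: "x \<otimes>\<^bsub>Q\<^esub> y = y \<otimes>\<^bsub>Q\<^esub> x" if "x \<in> B" "y \<in> B" for x y
    using that by (simp add: abelian_subalgebra_def)
  have BQ: "x \<in> carrier Q" if "x \<in> B" for x
    using B that Q.csubspace_closed[OF Q.cstar_subalgebra_csubspace] by (auto simp: abelian_subalgebra_def)
  have "B \<subseteq> DQ"
  proof
    fix C assume C: "C \<in> B"
    from BQ[OF C] obtain a where a: "a \<in> carrier A" "C = q a" by (rule quot.Q_E)
    have "a \<ominus> E a \<in> J"
    proof (rule relative_commutant[OF a(1)])
      fix d assume d: "d \<in> D"
      have dA: "d \<in> carrier A" using d by simp
      have "C \<otimes>\<^bsub>Q\<^esub> q d = q d \<otimes>\<^bsub>Q\<^esub> C" using C B DQ_I[OF d] by (intro Bc) auto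
      then have "q (a \<otimes> d) = q (d \<otimes> a)" using a dA by (simp add: quot.q_simps)
      then show "a \<otimes> d \<ominus> d \<otimes> a \<in> J" using a dA by (simp add: quot.q_eq_iff)
    qed
    then show "C \<in> DQ" unfolding a(2) by (rule q_in_DQ[OF a(1)])
  qed
  then show "B = DQ" using B by blast
qed

lemma cartan_subalgebra_DQ: "cartan_subalgebra DQ Q"
  unfolding cartan_subalgebra_def
  using regular_inclusion_DQ conditional_expectation_EQ faithful_EQ maximal_abelian_DQ by blast

end

theorem theorem4p8:
  fixes A :: "'a cstar_struct" and D J :: "'a set"
  assumes "cstar_algebra A"
    and "cartan_subalgebra D A"
    and "regular_ideal J A"
  shows "cartan_subalgebra (quotient_subalgebra A D J) (cstar_quotient A J)"
proof -
  obtain E where E: "conditional_expectation E D A" "faithful_map E A"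
    using assms(2) by (auto simp: cartan_subalgebra_def)
  have "cartan A D E"
    using assms(2) E
    by (intro cartan.intro[OF assms(1)] cartan_axioms.intro) (auto simp: cartan_subalgebra_def)
  then interpret cartan_regular A D E J
    using assms(3) by (intro cartan_regular.intro cartan_regular_axioms.intro)
  show ?thesis by (rule cartan_subalgebra_DQ)
qed

end
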